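(* Let $E$ be an exact real Courant algebroid over a smooth manifold $M$, and let $(\mathbb{J}_+,\mathbb{J}_-)$ be an almost generalized Kähler structure on $E$, described equivalently by the almost bi-Hermitian data $(s,g,I_+,I_-)$ (see context). Then $(\mathbb{J}_+,\mathbb{J}_-)$ is integrable (i.e. both $\mathbb{J}_+$ and $\mathbb{J}_-$ are generalized complex structures, so that the pair is a generalized Kähler structure) if and only if $I_+$ and $I_-$ are integrable complex structures on $M$ and $$\pm d^c_\pm\omega_\pm=H,$$ that is, $d^c_+\omega_+=H$ and $-d^c_-\omega_-=H$, where $\omega_\pm=gI_\pm$, $H\in\Omega^{3}(M,\mathbb{R})$ is the closed 3-form determined by the splitting $s$, and $d^c_\pm=i(\overline\partial_\pm-\partial_\pm)$ are the real Dolbeault operators of $I_\pm$.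
   Context: Courant algebroids. For a smooth manifold $M$, $\mathbb{T}M=TM\oplus T^*M$ carries the pairing $\langle X+\xi,Y+\eta\rangle=\tfrac12(\xi(Y)+\eta(X))$ and the Courant bracket $[X+\xi,Y+\eta]=[X,Y]+L_X\eta-i_Yd\xi$. An (exact, real) Courant algebroid on $M$ is a vector bundle $E$ which is an extension $0\to T^*M\to E\xrightarrow{\pi}TM\to0$, with a nondegenerate symmetric pairing $\langle\cdot,\cdot\rangle$ and a bracket $[\cdot,\cdot]$ on its sheaf of sections, such that locally there is a splitting of $\pi$ inducing an isomorphism (of extensions, pairings and brackets) with $\mathbb{T}M$. An almost generalized complex structure on $E$ is an orthogonal bundle endomorphism $\mathbb{J}$ with $\mathbb{J}^2=-1$; it is a generalized complex structure (integrable) if its $+i$-eigenbundle in $E\otimes\mathbb{C}$ is involutive, i.e. its sections are closed under the ($\mathbb{C}$-bilinearly extended) bracket. An almost generalized Kähler structure is a commuting pair $(\mathbb{J}_+,\mathbb{J}_-)$ of almost generalized complex structures such that $G(x,y)=\langle\mathbb{J}_+x,\mathbb{J}_-y\rangle$ is positive-definite; it is a generalized Kähler structure if both are integrable. Bi-Hermitian data. The $\pm1$-eigenbundles $C_\pm$ of $G=-\mathbb{J}_+\mathbb{J}_-$ project isomorphically to $TM$; with inverses $s_\pm:TM\to C_\pm$, put $s=\tfrac12(s_++s_-)$, an isotropic splitting of $\pi$; the Riemannian metric $g$ is determined by $s_\pm(X)=s(X)\pm g(X)$, and the $g$-orthogonal almost complex structures $I_\pm$ by $s_\pm I_\pm=\mathbb{J}_+s_\pm$.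 The assignment $(\mathbb{J}_+,\mathbb{J}_-)\mapsto(s,g,I_+,I_-)$ is a bijection between almost generalized Kähler structures and such data. Conventions. $\omega_\pm=gI_\pm$ means $\omega_\pm(X,Y)=g(I_\pm X,Y)$. The closed 3-form $H$ of the isotropic splitting $s$ is defined by $[s(X),s(Y)]=s([X,Y])+i_Xi_YH$ for vector fields $X,Y$, where $i_Xi_YH=H(Y,X,\cdot)$ (so $s$ identifies $E$ with $\mathbb{T}M$ equipped with the bracket $[X+\xi,Y+\eta]_H=[X,Y]+L_X\eta-i_Yd\xi+i_Xi_YH$). *)

theory Defs
  imports "HOL-Analysis.Analysis"
begin

section \<open>Smooth manifolds\<close>

primrec Ck_on :: "nat \<Rightarrow> 'a::real_normed_vector set \<Rightarrow> ('a \<Rightarrow> 'b::real_normed_vector) \<Rightarrow> bool" where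
  "Ck_on 0 S f \<longleftrightarrow> continuous_on S f"
| "Ck_on (Suc k) S f \<longleftrightarrow> (\<forall>x\<in>S. f differentiable (at x)) \<and>
     (\<forall>v. Ck_on k S (\<lambda>x. frechet_derivative f (at x) v))"

text \<open>Only used for open \<open>S\<close> in a finite-dimensional space.\<close>

definition smooth_on :: "'a::real_normed_vector set \<Rightarrow> ('a \<Rightarrow> 'b::real_normed_vector) \<Rightarrow> bool" where
  "smooth_on S f \<longleftrightarrow> (\<forall>k. Ck_on k S f)"

type_synonym ('m, 'e) chart = "'m set \<times> ('m \<Rightarrow> 'e)"

abbreviation chart_inv :: "('m, 'e) chart \<Rightarrow> 'e \<Rightarrow> 'm" where
  "chart_inv c \<equiv> inv_into (fst c) (snd c)"

text \<open>The manifold is the whole type \<open>'m\<close>. The model space is a finite-dimensional inner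
  product space; unlike a space of class \<open>euclidean_space\<close> it may be zero-dimensional.\<close>

definition smooth_atlas ::
    "('m::{t2_space,second_countable_topology}, 'e::real_inner) chart set \<Rightarrow> bool" where
  "smooth_atlas A \<longleftrightarrow>
     (\<exists>B::'e set. finite B \<and> span B = UNIV) \<and>
     (\<Union>c\<in>A. fst c) = UNIV \<and>
     (\<forall>c\<in>A. open (fst c) \<and> open (snd c ` fst c) \<and>
        homeomorphism (fst c) (snd c ` fst c) (snd c) (chart_inv c)) \<and>
     (\<forall>c\<in>A. \<forall>d\<in>A. smooth_on (snd c ` (fst c \<inter> fst d)) (snd d \<circ> chart_inv c))"

definition smooth_fun ::
    "('m::topological_space, 'e::real_normed_vector) chart set \<Rightarrow> 'm set
      \<Rightarrow> ('m \<Rightarrow> 'b::real_normed_vector) \<Rightarrow> bool" where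
  "smooth_fun A U f \<longleftrightarrow> (\<forall>c\<in>A. smooth_on (snd c ` (U \<inter> fst c)) (f \<circ> chart_inv c))"

section \<open>Vector bundles\<close>

definition linear_on :: "'a::real_vector set \<Rightarrow> ('a \<Rightarrow> 'b::real_vector) \<Rightarrow> bool" where
  "linear_on S f \<longleftrightarrow> (\<forall>u\<in>S. \<forall>v\<in>S. \<forall>a b. f (a *\<^sub>R u + b *\<^sub>R v) = a *\<^sub>R f u + b *\<^sub>R f v)"

text \<open>A vector bundle is a family of fibres (subspaces of an auxiliary vector space
  \<open>'v\<close>, which carries no topology) together with a set of local trivialisations: pairs
  \<open>(U, \<Phi>)\<close> where each \<open>\<Phi> y\<close>, \<open>y \<in> U\<close>, is an isomorphism of the fibre over \<open>y\<close> onto the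
  finite-dimensional space \<open>'f\<close>, with smooth transition functions.\<close>

type_synonym ('m, 'v, 'f) triv = "'m set \<times> ('m \<Rightarrow> 'v \<Rightarrow> 'f)"

definition vector_bundle ::
    "('m::topological_space, 'e::real_normed_vector) chart set \<Rightarrow> ('m \<Rightarrow> 'v::real_vector set)
      \<Rightarrow> ('m, 'v, 'f::real_inner) triv set \<Rightarrow> bool" where
  "vector_bundle A F T \<longleftrightarrow>
     (\<exists>B::'f set. finite B \<and> span B = UNIV) \<and>
     (\<forall>x. subspace (F x)) \<and>
     (\<Union>t\<in>T. fst t) = UNIV \<and>
     (\<forall>(U, \<Phi>)\<in>T. open U \<and> (\<forall>y\<in>U. linear_on (F y) (\<Phi> y) \<and> bij_betw (\<Phi> y) (F y) UNIV)) \<and>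
     (\<forall>(U, \<Phi>)\<in>T. \<forall>(V, \<Psi>)\<in>T. \<forall>w.
        smooth_fun A (U \<inter> V) (\<lambda>y. \<Psi> y (inv_into (F y) (\<Phi> y) w)))"

definition smooth_section ::
    "('m::topological_space, 'e::real_normed_vector) chart set \<Rightarrow> ('m \<Rightarrow> 'v set)
      \<Rightarrow> ('m, 'v, 'f::real_normed_vector) triv set \<Rightarrow> 'm set \<Rightarrow> ('m \<Rightarrow> 'v) \<Rightarrow> bool" where
  "smooth_section A F T U s \<longleftrightarrow>
     (\<forall>y\<in>U. s y \<in> F y) \<and> (\<forall>(V, \<Phi>)\<in>T. smooth_fun A (U \<inter> V) (\<lambda>y. \<Phi> y (s y)))"

section \<open>Tangent bundle and vector fields\<close>

text \<open>A tangent vector at \<open>x\<close> is recorded by its components in the chosen chart \<open>chart_at A x\<close>,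
  so that every tangent space is the model space \<open>'e\<close>. The choice of chart need not depend
  continuously on \<open>x\<close>: the smooth structure of the tangent bundle is that given by the
  trivialisations \<open>tangent_trivs\<close>, which pass from these components to those in a fixed chart.\<close>

definition chart_at :: "('m, 'e) chart set \<Rightarrow> 'm \<Rightarrow> ('m, 'e) chart" where
  "chart_at A x = (SOME c. c \<in> A \<and> x \<in> fst c)"

text \<open>The derivative at \<open>y\<close> of the transition from the chart \<open>c\<close> to the chart \<open>d\<close>.\<close>

definition jac ::
    "('m, 'e::real_normed_vector) chart \<Rightarrow> ('m, 'e) chart \<Rightarrow> 'm \<Rightarrow> 'e \<Rightarrow> 'e" where
  "jac c d y = frechet_derivative (snd d \<circ> chart_inv c) (at (snd c y))"

definition tangent_trivs ::
    "('m, 'e::real_normed_vector) chart set \<Rightarrow> ('m, 'e, 'e) triv set" where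
  "tangent_trivs A = (\<lambda>c. (fst c, \<lambda>y. jac (chart_at A y) c y)) ` A"

definition vector_field ::
    "('m::topological_space, 'e::real_normed_vector) chart set \<Rightarrow> 'm set \<Rightarrow> ('m \<Rightarrow> 'e) \<Rightarrow> bool" where
  "vector_field A U X \<longleftrightarrow> smooth_section A (\<lambda>_. UNIV) (tangent_trivs A) U X"

text \<open>The vector field near \<open>x\<close> that extends the tangent vector \<open>v\<close> at \<open>x\<close> and has constant
  components in the chart chosen at \<open>x\<close>.\<close>

definition extend ::
    "('m, 'e::real_normed_vector) chart set \<Rightarrow> 'm \<Rightarrow> 'e \<Rightarrow> 'm \<Rightarrow> 'e" where
  "extend A x v y = jac (chart_at A x) (chart_at A y) y v"

definition dir_deriv ::
    "('m, 'e::real_normed_vector) chart set \<Rightarrow> 'm \<Rightarrow> 'e \<Rightarrow> ('m \<Rightarrow> 'b::real_normed_vector) \<Rightarrow> 'b" where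
  "dir_deriv A x v f =
     frechet_derivative (f \<circ> chart_inv (chart_at A x)) (at (snd (chart_at A x) x)) v"

text \<open>In components with respect to a chart, \<open>[X,Y] = DY(X) - DX(Y)\<close>.\<close>

definition lie_bracket ::
    "('m, 'e::real_normed_vector) chart set \<Rightarrow> ('m \<Rightarrow> 'e) \<Rightarrow> ('m \<Rightarrow> 'e) \<Rightarrow> 'm \<Rightarrow> 'e" where
  "lie_bracket A X Y x =
     dir_deriv A x (X x) (\<lambda>y. jac (chart_at A y) (chart_at A x) y (Y y)) -
     dir_deriv A x (Y x) (\<lambda>y. jac (chart_at A y) (chart_at A x) y (X y))"

section \<open>Differential forms\<close>

definition one_form ::
    "('m::topological_space, 'e::real_normed_vector) chart set \<Rightarrow> 'm set
      \<Rightarrow> ('m \<Rightarrow> 'e \<Rightarrow> real) \<Rightarrow> bool" where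
  "one_form A U \<xi> \<longleftrightarrow> (\<forall>x\<in>U. linear (\<xi> x)) \<and>
     (\<forall>V X. open V \<and> V \<subseteq> U \<and> vector_field A V X \<longrightarrow> smooth_fun A V (\<lambda>y. \<xi> y (X y)))"

text \<open>The value of a \<open>k\<close>-form at a point is a function of lists of tangent vectors, of which
  only the values on lists of length \<open>k\<close> matter.\<close>

definition diff_form ::
    "('m::topological_space, 'e::real_normed_vector) chart set \<Rightarrow> nat
      \<Rightarrow> ('m \<Rightarrow> 'e list \<Rightarrow> 'b::real_normed_vector) \<Rightarrow> bool" where
  "diff_form A k \<omega> \<longleftrightarrow>
     (\<forall>x vs. length vs = k \<longrightarrow> (\<forall>i<k. linear (\<lambda>u. \<omega> x (vs[i := u])))) \<and>
     (\<forall>x vs. length vs = k \<and> \<not> distinct vs \<longrightarrow> \<omega> x vs = 0) \<and>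
     (\<forall>V Xs. open V \<and> length Xs = k \<and> (\<forall>X\<in>set Xs. vector_field A V X) \<longrightarrow>
        smooth_fun A V (\<lambda>y. \<omega> y (map (\<lambda>X. X y) Xs)))"

text \<open>Exterior derivative, normalised by
  \<open>d\<omega>(v\<^sub>0,\<dots>,v\<^sub>k) = \<Sum>\<^sub>i (-1)^i v\<^sub>i(\<omega>(v\<^sub>0,\<dots>,v\<^sub>i\<^sub>-\<^sub>1,v\<^sub>i\<^sub>+\<^sub>1,\<dots>,v\<^sub>k))\<close> for coordinate vector fields.\<close>

definition ext_deriv ::
    "('m, 'e::real_normed_vector) chart set \<Rightarrow> ('m \<Rightarrow> 'e list \<Rightarrow> 'b::real_normed_vector)
      \<Rightarrow> 'm \<Rightarrow> 'e list \<Rightarrow> 'b" where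
  "ext_deriv A \<omega> x vs = (\<Sum>i<length vs. (-1)^i *\<^sub>R
     dir_deriv A x (vs ! i) (\<lambda>y. \<omega> y (map (\<lambda>v. extend A x v y) (take i vs @ drop (Suc i) vs))))"

text \<open>\<open>(L\<^sub>X \<eta>)(Z) = X(\<eta>(Z)) - \<eta>([X,Z])\<close> for any \<open>Z\<close> extending \<open>v\<close>.\<close>

definition lie_deriv1 ::
    "('m, 'e::real_normed_vector) chart set \<Rightarrow> ('m \<Rightarrow> 'e) \<Rightarrow> ('m \<Rightarrow> 'e \<Rightarrow> real) \<Rightarrow> 'm \<Rightarrow> 'e \<Rightarrow> real" where
  "lie_deriv1 A X \<eta> x v =
     dir_deriv A x (X x) (\<lambda>y. \<eta> y (extend A x v y)) - \<eta> x (lie_bracket A X (extend A x v) x)"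

section \<open>Complexification\<close>

text \<open>\<open>V \<otimes> \<complex>\<close> is the set of pairs \<open>(a, b)\<close>, standing for \<open>a + \<i>b\<close>. The following is the
  condition \<open>J(a + \<i>b) = \<i>(a + \<i>b)\<close>.\<close>

definition plus_i_eigen :: "('v::real_vector \<Rightarrow> 'v) \<Rightarrow> 'v \<times> 'v \<Rightarrow> bool" where
  "plus_i_eigen J z \<longleftrightarrow> J (fst z) = - snd z \<and> J (snd z) = fst z"

text \<open>The complex-bilinear extension of a bracket of sections.\<close>

definition complexify_bracket ::
    "(('m \<Rightarrow> 'v::real_vector) \<Rightarrow> ('m \<Rightarrow> 'v) \<Rightarrow> ('m \<Rightarrow> 'v))
      \<Rightarrow> ('m \<Rightarrow> 'v \<times> 'v) \<Rightarrow> ('m \<Rightarrow> 'v \<times> 'v) \<Rightarrow> 'm \<Rightarrow> 'v \<times> 'v" where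
  "complexify_bracket br z w x =
     (br (fst \<circ> z) (fst \<circ> w) x - br (snd \<circ> z) (snd \<circ> w) x,
      br (fst \<circ> z) (snd \<circ> w) x + br (snd \<circ> z) (fst \<circ> w) x)"

text \<open>The complex-multilinear extension of a complex-valued real-multilinear map.\<close>

primrec complexify_form :: "('e list \<Rightarrow> complex) \<Rightarrow> ('e \<times> 'e) list \<Rightarrow> complex" where
  "complexify_form \<alpha> [] = \<alpha> []"
| "complexify_form \<alpha> (z # zs) =
     complexify_form (\<lambda>vs. \<alpha> (fst z # vs)) zs + \<i> * complexify_form (\<lambda>vs. \<alpha> (snd z # vs)) zs"

section \<open>Complex structures and Dolbeault operators\<close>

definition almost_complex ::
    "('m::topological_space, 'e::real_normed_vector) chart set \<Rightarrow> ('m \<Rightarrow> 'e \<Rightarrow> 'e) \<Rightarrow> bool" where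
  "almost_complex A I \<longleftrightarrow> (\<forall>x. linear (I x) \<and> (\<forall>v. I x (I x v) = - v)) \<and>
     (\<forall>U X. open U \<and> vector_field A U X \<longrightarrow> vector_field A U (\<lambda>y. I y (X y)))"

text \<open>Integrability of an almost complex structure is involutivity of \<open>T\<^sup>1\<^sup>,\<^sup>0\<close>, its
  \<open>+\<i>\<close>-eigenbundle.\<close>

definition complex_structure ::
    "('m::topological_space, 'e::real_normed_vector) chart set \<Rightarrow> ('m \<Rightarrow> 'e \<Rightarrow> 'e) \<Rightarrow> bool" where
  "complex_structure A I \<longleftrightarrow> almost_complex A I \<and>
     (\<forall>U Z W. open U \<and>
        vector_field A U (fst \<circ> Z) \<and> vector_field A U (snd \<circ> Z) \<and>
        vector_field A U (fst \<circ> W) \<and> vector_field A U (snd \<circ> W) \<and>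
        (\<forall>x\<in>U. plus_i_eigen (I x) (Z x) \<and> plus_i_eigen (I x) (W x)) \<longrightarrow>
        (\<forall>x\<in>U. plus_i_eigen (I x) (complexify_bracket (lie_bracket A) Z W x)))"

text \<open>The projections \<open>(v - \<i>Iv)/2\<close> and \<open>(v + \<i>Iv)/2\<close> of \<open>v\<close> to \<open>T\<^sup>1\<^sup>,\<^sup>0\<close> and \<open>T\<^sup>0\<^sup>,\<^sup>1\<close>.\<close>

definition proj_type :: "('e::real_vector \<Rightarrow> 'e) \<Rightarrow> bool \<Rightarrow> 'e \<Rightarrow> 'e \<times> 'e" where
  "proj_type I holo v = ((1/2) *\<^sub>R v, (if holo then -1/2 else 1/2) *\<^sub>R I v)"

text \<open>The \<open>(p,q)\<close>-component of a complex-valued \<open>(p+q)\<close>-form: the sum over all ways of projecting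
  \<open>p\<close> of the arguments to \<open>T\<^sup>1\<^sup>,\<^sup>0\<close> and the others to \<open>T\<^sup>0\<^sup>,\<^sup>1\<close>.\<close>

definition type_part ::
    "('e::real_vector \<Rightarrow> 'e) \<Rightarrow> nat \<Rightarrow> nat \<Rightarrow> ('e list \<Rightarrow> complex) \<Rightarrow> 'e list \<Rightarrow> complex" where
  "type_part I p q \<alpha> vs =
     (\<Sum>bs | length bs = p + q \<and> count_list bs True = p. complexify_form \<alpha> (map2 (proj_type I) bs vs))"

text \<open>On forms of degree \<open>k\<close>: \<open>\<partial>\<close> and \<open>\<partial>\<close>-bar are the components of bidegree \<open>(1,0)\<close> and \<open>(0,1)\<close>
  of \<open>d\<close>.\<close>

definition dolbeault ::
    "('m, 'e::real_normed_vector) chart set \<Rightarrow> ('m \<Rightarrow> 'e \<Rightarrow> 'e) \<Rightarrow> nat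
      \<Rightarrow> ('m \<Rightarrow> 'e list \<Rightarrow> complex) \<Rightarrow> 'm \<Rightarrow> 'e list \<Rightarrow> complex" where
  "dolbeault A I k \<omega> x vs = (\<Sum>p\<le>k.
     type_part (I x) (Suc p) (k - p) (ext_deriv A (\<lambda>y. type_part (I y) p (k - p) (\<omega> y)) x) vs)"

definition dolbeault_bar ::
    "('m, 'e::real_normed_vector) chart set \<Rightarrow> ('m \<Rightarrow> 'e \<Rightarrow> 'e) \<Rightarrow> nat
      \<Rightarrow> ('m \<Rightarrow> 'e list \<Rightarrow> complex) \<Rightarrow> 'm \<Rightarrow> 'e list \<Rightarrow> complex" where
  "dolbeault_bar A I k \<omega> x vs = (\<Sum>p\<le>k.
     type_part (I x) p (Suc (k - p)) (ext_deriv A (\<lambda>y. type_part (I y) p (k - p) (\<omega> y)) x) vs)"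

definition d_c ::
    "('m, 'e::real_normed_vector) chart set \<Rightarrow> ('m \<Rightarrow> 'e \<Rightarrow> 'e) \<Rightarrow> nat
      \<Rightarrow> ('m \<Rightarrow> 'e list \<Rightarrow> complex) \<Rightarrow> 'm \<Rightarrow> 'e list \<Rightarrow> complex" where
  "d_c A I k \<omega> x vs = \<i> * (dolbeault_bar A I k \<omega> x vs - dolbeault A I k \<omega> x vs)"

section \<open>Exact Courant algebroids\<close>

text \<open>The covectors at any point are the linear functionals on \<open>'e\<close>. The bracket is a family of
  operations on sections over the open sets \<open>U\<close>, a section over \<open>U\<close> being a function of which
  only the values on \<open>U\<close> matter.\<close>

record ('m, 'e, 'v, 'f) courant =
  fibre :: "'m \<Rightarrow> 'v set"
  trivs :: "('m, 'v, 'f) triv set"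
  anchor :: "'m \<Rightarrow> 'v \<Rightarrow> 'e"
  coanchor :: "'m \<Rightarrow> ('e \<Rightarrow> real) \<Rightarrow> 'v"
  pairing :: "'m \<Rightarrow> 'v \<Rightarrow> 'v \<Rightarrow> real"
  bracket :: "'m set \<Rightarrow> ('m \<Rightarrow> 'v) \<Rightarrow> ('m \<Rightarrow> 'v) \<Rightarrow> 'm \<Rightarrow> 'v"

abbreviation esection ::
    "('m::topological_space, 'e::real_normed_vector) chart set
      \<Rightarrow> ('m, 'e, 'v, 'f::real_normed_vector) courant \<Rightarrow> 'm set \<Rightarrow> ('m \<Rightarrow> 'v) \<Rightarrow> bool" where
  "esection A E U a \<equiv> smooth_section A (fibre E) (trivs E) U a"

definition smooth_extension ::
    "('m::topological_space, 'e::real_normed_vector) chart set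
      \<Rightarrow> ('m, 'e, 'v::real_vector, 'f::real_normed_vector) courant \<Rightarrow> bool" where
  "smooth_extension A E \<longleftrightarrow>
     (\<forall>x. linear_on (fibre E x) (anchor E x) \<and> anchor E x ` fibre E x = UNIV) \<and>
     (\<forall>U a. open U \<and> esection A E U a \<longrightarrow> vector_field A U (\<lambda>y. anchor E y (a y))) \<and>
     (\<forall>x \<alpha> \<beta> a b. linear \<alpha> \<and> linear \<beta> \<longrightarrow>
        coanchor E x (\<lambda>v. a * \<alpha> v + b * \<beta> v) = a *\<^sub>R coanchor E x \<alpha> + b *\<^sub>R coanchor E x \<beta>) \<and>
     (\<forall>x. inj_on (coanchor E x) {\<alpha>. linear \<alpha>} \<and>
        coanchor E x ` {\<alpha>. linear \<alpha>} = {e \<in> fibre E x. anchor E x e = 0}) \<and>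
     (\<forall>U \<xi>. open U \<and> one_form A U \<xi> \<longrightarrow> esection A E U (\<lambda>y. coanchor E y (\<xi> y)))"

definition smooth_pairing ::
    "('m::topological_space, 'e::real_normed_vector) chart set
      \<Rightarrow> ('m, 'e, 'v::real_vector, 'f::real_normed_vector) courant \<Rightarrow> bool" where
  "smooth_pairing A E \<longleftrightarrow>
     (\<forall>x. \<forall>a\<in>fibre E x. linear_on (fibre E x) (pairing E x a)) \<and>
     (\<forall>x. \<forall>a\<in>fibre E x. \<forall>b\<in>fibre E x. pairing E x a b = pairing E x b a) \<and>
     (\<forall>x. \<forall>a\<in>fibre E x. (\<forall>b\<in>fibre E x. pairing E x a b = 0) \<longrightarrow> a = 0) \<and>
     (\<forall>U a b. open U \<and> esection A E U a \<and> esection A E U b \<longrightarrow>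
        smooth_fun A U (\<lambda>y. pairing E y (a y) (b y)))"

definition sheaf_bracket ::
    "('m::topological_space, 'e::real_normed_vector) chart set
      \<Rightarrow> ('m, 'e, 'v::real_vector, 'f::real_normed_vector) courant \<Rightarrow> bool" where
  "sheaf_bracket A E \<longleftrightarrow>
     (\<forall>U a b. open U \<and> esection A E U a \<and> esection A E U b \<longrightarrow> esection A E U (bracket E U a b)) \<and>
     (\<forall>U V a b a' b'. open U \<and> open V \<and> V \<subseteq> U \<and> esection A E U a \<and> esection A E U b \<and>
        (\<forall>y\<in>V. a' y = a y \<and> b' y = b y) \<longrightarrow>
        (\<forall>x\<in>V. bracket E V a' b' x = bracket E U a b x))"

definition splitting ::
    "('m::topological_space, 'e::real_normed_vector) chart set
      \<Rightarrow> ('m, 'e, 'v::real_vector, 'f::real_normed_vector) courant \<Rightarrow> 'm set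
      \<Rightarrow> ('m \<Rightarrow> 'e \<Rightarrow> 'v) \<Rightarrow> bool" where
  "splitting A E U s \<longleftrightarrow>
     (\<forall>x\<in>U. linear (s x) \<and> (\<forall>v. s x v \<in> fibre E x \<and> anchor E x (s x v) = v)) \<and>
     (\<forall>V X. open V \<and> V \<subseteq> U \<and> vector_field A V X \<longrightarrow> esection A E V (\<lambda>y. s y (X y)))"

text \<open>A splitting \<open>s\<close> over \<open>U\<close> induces the isomorphism of extensions \<open>X + \<xi> \<mapsto> s(X) + \<xi>\<close>. It is
  required to match the pairing \<open>\<langle>X+\<xi>, Y+\<eta>\<rangle> = (\<xi>(Y) + \<eta>(X))/2\<close> and, over all open subsets of \<open>U\<close>,
  the bracket \<open>[X+\<xi>, Y+\<eta>] = [X,Y] + L\<^sub>X \<eta> - i\<^sub>Y d\<xi>\<close>.\<close>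

definition standard_splitting ::
    "('m::topological_space, 'e::real_normed_vector) chart set
      \<Rightarrow> ('m, 'e, 'v::real_vector, 'f::real_normed_vector) courant \<Rightarrow> 'm set
      \<Rightarrow> ('m \<Rightarrow> 'e \<Rightarrow> 'v) \<Rightarrow> bool" where
  "standard_splitting A E U s \<longleftrightarrow> splitting A E U s \<and>
     (\<forall>x\<in>U. \<forall>u v \<alpha> \<beta>. linear \<alpha> \<and> linear \<beta> \<longrightarrow>
        pairing E x (s x u + coanchor E x \<alpha>) (s x v + coanchor E x \<beta>) = (\<alpha> v + \<beta> u) / 2) \<and>
     (\<forall>V X Y \<xi> \<eta>. open V \<and> V \<subseteq> U \<and> vector_field A V X \<and> vector_field A V Y \<and>
        one_form A V \<xi> \<and> one_form A V \<eta> \<longrightarrow>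
        (\<forall>x\<in>V. bracket E V (\<lambda>y. s y (X y) + coanchor E y (\<xi> y))
                            (\<lambda>y. s y (Y y) + coanchor E y (\<eta> y)) x =
           s x (lie_bracket A X Y x) +
           coanchor E x (\<lambda>v. lie_deriv1 A X \<eta> x v - ext_deriv A (\<lambda>y vs. \<xi> y (hd vs)) x [Y x, v])))"

definition courant_algebroid ::
    "('m::topological_space, 'e::real_normed_vector) chart set
      \<Rightarrow> ('m, 'e, 'v::real_vector, 'f::real_inner) courant \<Rightarrow> bool" where
  "courant_algebroid A E \<longleftrightarrow>
     vector_bundle A (fibre E) (trivs E) \<and> smooth_extension A E \<and> smooth_pairing A E \<and>
     sheaf_bracket A E \<and>
     (\<forall>x. \<exists>U s. open U \<and> x \<in> U \<and> standard_splitting A E U s)"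

section \<open>Generalized complex and generalized Kaehler structures\<close>

definition almost_gen_complex ::
    "('m::topological_space, 'e::real_normed_vector) chart set
      \<Rightarrow> ('m, 'e, 'v::real_vector, 'f::real_inner) courant \<Rightarrow> ('m \<Rightarrow> 'v \<Rightarrow> 'v) \<Rightarrow> bool" where
  "almost_gen_complex A E J \<longleftrightarrow>
     (\<forall>x. linear_on (fibre E x) (J x)) \<and>
     (\<forall>x. \<forall>a\<in>fibre E x. J x a \<in> fibre E x \<and> J x (J x a) = - a) \<and>
     (\<forall>x. \<forall>a\<in>fibre E x. \<forall>b\<in>fibre E x. pairing E x (J x a) (J x b) = pairing E x a b) \<and>
     (\<forall>U a. open U \<and> esection A E U a \<longrightarrow> esection A E U (\<lambda>y. J y (a y)))"

definition gen_complex ::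
    "('m::topological_space, 'e::real_normed_vector) chart set
      \<Rightarrow> ('m, 'e, 'v::real_vector, 'f::real_inner) courant \<Rightarrow> ('m \<Rightarrow> 'v \<Rightarrow> 'v) \<Rightarrow> bool" where
  "gen_complex A E J \<longleftrightarrow> almost_gen_complex A E J \<and>
     (\<forall>U z w. open U \<and>
        esection A E U (fst \<circ> z) \<and> esection A E U (snd \<circ> z) \<and>
        esection A E U (fst \<circ> w) \<and> esection A E U (snd \<circ> w) \<and>
        (\<forall>x\<in>U. plus_i_eigen (J x) (z x) \<and> plus_i_eigen (J x) (w x)) \<longrightarrow>
        (\<forall>x\<in>U. plus_i_eigen (J x) (complexify_bracket (bracket E U) z w x)))"

definition almost_gen_kahler ::
    "('m::topological_space, 'e::real_normed_vector) chart set
      \<Rightarrow> ('m, 'e, 'v::real_vector, 'f::real_inner) courant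
      \<Rightarrow> ('m \<Rightarrow> 'v \<Rightarrow> 'v) \<Rightarrow> ('m \<Rightarrow> 'v \<Rightarrow> 'v) \<Rightarrow> bool" where
  "almost_gen_kahler A E Jp Jm \<longleftrightarrow>
     almost_gen_complex A E Jp \<and> almost_gen_complex A E Jm \<and>
     (\<forall>x. \<forall>a\<in>fibre E x. Jp x (Jm x a) = Jm x (Jp x a)) \<and>
     (\<forall>x. \<forall>a\<in>fibre E x. a \<noteq> 0 \<longrightarrow> pairing E x (Jp x a) (Jm x a) > 0)"

definition gen_kahler ::
    "('m::topological_space, 'e::real_normed_vector) chart set
      \<Rightarrow> ('m, 'e, 'v::real_vector, 'f::real_inner) courant
      \<Rightarrow> ('m \<Rightarrow> 'v \<Rightarrow> 'v) \<Rightarrow> ('m \<Rightarrow> 'v \<Rightarrow> 'v) \<Rightarrow> bool" where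
  "gen_kahler A E Jp Jm \<longleftrightarrow>
     almost_gen_kahler A E Jp Jm \<and> gen_complex A E Jp \<and> gen_complex A E Jm"

section \<open>Bi-Hermitian data\<close>

definition riemannian_metric ::
    "('m::topological_space, 'e::real_normed_vector) chart set \<Rightarrow> ('m \<Rightarrow> 'e \<Rightarrow> 'e \<Rightarrow> real) \<Rightarrow> bool" where
  "riemannian_metric A g \<longleftrightarrow>
     (\<forall>x u. linear (g x u)) \<and> (\<forall>x u v. g x u v = g x v u) \<and> (\<forall>x u. u \<noteq> 0 \<longrightarrow> g x u u > 0) \<and>
     (\<forall>U X Y. open U \<and> vector_field A U X \<and> vector_field A U Y \<longrightarrow>
        smooth_fun A U (\<lambda>y. g y (X y) (Y y)))"

definition almost_bihermitian ::
    "('m::topological_space, 'e::real_normed_vector) chart set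
      \<Rightarrow> ('m, 'e, 'v::real_vector, 'f::real_inner) courant \<Rightarrow> ('m \<Rightarrow> 'e \<Rightarrow> 'v)
      \<Rightarrow> ('m \<Rightarrow> 'e \<Rightarrow> 'e \<Rightarrow> real) \<Rightarrow> ('m \<Rightarrow> 'e \<Rightarrow> 'e) \<Rightarrow> ('m \<Rightarrow> 'e \<Rightarrow> 'e) \<Rightarrow> bool" where
  "almost_bihermitian A E s g Iplus Iminus \<longleftrightarrow>
     splitting A E UNIV s \<and> (\<forall>x u v. pairing E x (s x u) (s x v) = 0) \<and>
     riemannian_metric A g \<and>
     almost_complex A Iplus \<and> (\<forall>x u v. g x (Iplus x u) (Iplus x v) = g x u v) \<and>
     almost_complex A Iminus \<and> (\<forall>x u v. g x (Iminus x u) (Iminus x v) = g x u v)"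

text \<open>The eigenbundle \<open>C\<^sub>\<plusminus>\<close> of \<open>G = -J\<^sub>+J\<^sub>-\<close> for the eigenvalue \<open>r = \<plusminus>1\<close>.\<close>

definition C_eigen ::
    "('m, 'e, 'v::real_vector, 'f) courant \<Rightarrow> ('m \<Rightarrow> 'v \<Rightarrow> 'v) \<Rightarrow> ('m \<Rightarrow> 'v \<Rightarrow> 'v)
      \<Rightarrow> real \<Rightarrow> 'm \<Rightarrow> 'v set" where
  "C_eigen E Jp Jm r x = {a \<in> fibre E x. - Jp x (Jm x a) = r *\<^sub>R a}"

definition inverse_projection ::
    "('m, 'e, 'v::real_vector, 'f) courant \<Rightarrow> ('m \<Rightarrow> 'v set) \<Rightarrow> ('m \<Rightarrow> 'e \<Rightarrow> 'v) \<Rightarrow> bool" where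
  "inverse_projection E C t \<longleftrightarrow>
     (\<forall>x. (\<forall>v. t x v \<in> C x \<and> anchor E x (t x v) = v) \<and> (\<forall>a\<in>C x. t x (anchor E x a) = a))"

text \<open>The data \<open>(s, g, I\<^sub>+, I\<^sub>-)\<close> assigned to the almost generalized Kaehler structure
  \<open>(J\<^sub>+, J\<^sub>-)\<close>; below, \<open>sp\<close> and \<open>sm\<close> are \<open>s\<^sub>+\<close> and \<open>s\<^sub>-\<close>.\<close>

definition bihermitian_data_of ::
    "('m::topological_space, 'e::real_normed_vector) chart set
      \<Rightarrow> ('m, 'e, 'v::real_vector, 'f::real_inner) courant
      \<Rightarrow> ('m \<Rightarrow> 'v \<Rightarrow> 'v) \<Rightarrow> ('m \<Rightarrow> 'v \<Rightarrow> 'v) \<Rightarrow> ('m \<Rightarrow> 'e \<Rightarrow> 'v)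
      \<Rightarrow> ('m \<Rightarrow> 'e \<Rightarrow> 'e \<Rightarrow> real) \<Rightarrow> ('m \<Rightarrow> 'e \<Rightarrow> 'e) \<Rightarrow> ('m \<Rightarrow> 'e \<Rightarrow> 'e) \<Rightarrow> bool" where
  "bihermitian_data_of A E Jp Jm s g Iplus Iminus \<longleftrightarrow> almost_bihermitian A E s g Iplus Iminus \<and>
     (\<exists>sp sm.
        inverse_projection E (C_eigen E Jp Jm 1) sp \<and>
        inverse_projection E (C_eigen E Jp Jm (-1)) sm \<and>
        (\<forall>x v. s x v = (1/2) *\<^sub>R (sp x v + sm x v)) \<and>
        (\<forall>x v. sp x v = s x v + coanchor E x (g x v)) \<and>
        (\<forall>x v. sm x v = s x v - coanchor E x (g x v)) \<and>
        (\<forall>x v. sp x (Iplus x v) = Jp x (sp x v)) \<and>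
        (\<forall>x v. sm x (Iminus x v) = Jp x (sm x v)))"

text \<open>\<open>[s(X), s(Y)] = s([X,Y]) + i\<^sub>X i\<^sub>Y H\<close>, where \<open>i\<^sub>X i\<^sub>Y H = H(Y, X, \<cdot>)\<close>.\<close>

definition splitting_3form ::
    "('m::topological_space, 'e::real_normed_vector) chart set
      \<Rightarrow> ('m, 'e, 'v::real_vector, 'f::real_inner) courant
      \<Rightarrow> ('m \<Rightarrow> 'e \<Rightarrow> 'v) \<Rightarrow> ('m \<Rightarrow> 'e list \<Rightarrow> real) \<Rightarrow> bool" where
  "splitting_3form A E s H \<longleftrightarrow> diff_form A 3 H \<and>
     (\<forall>U X Y. open U \<and> vector_field A U X \<and> vector_field A U Y \<longrightarrow>
        (\<forall>x\<in>U. bracket E U (\<lambda>y. s y (X y)) (\<lambda>y. s y (Y y)) x =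
           s x (lie_bracket A X Y x) + coanchor E x (\<lambda>v. H x [Y x, X x, v])))"

text \<open>The form \<open>\<omega>(X,Y) = g(IX,Y)\<close>, regarded as complex-valued.\<close>

definition fundamental_form ::
    "('m \<Rightarrow> 'e \<Rightarrow> 'e \<Rightarrow> real) \<Rightarrow> ('m \<Rightarrow> 'e \<Rightarrow> 'e) \<Rightarrow> 'm \<Rightarrow> 'e list \<Rightarrow> complex" where
  "fundamental_form g I x vs = complex_of_real (g x (I x (vs ! 0)) (vs ! 1))"

end

(* Every section of E is s_+ X_1 + s_- X_2 for vector fields X_1, X_2, both J_+ and J_- preserve this
   decomposition, and their +i-eigenbundles are s_+ T10_+ + s_- T10_- and s_+ T10_+ + s_- T01_-.
   By the Courant bracket in the splitting s, the components of [s_+ X, s_- Y] are, up to sign,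
   D+_Y X and D-_X Y for the two metric connections D+, D- with torsion -H and H, and the component
   of [s_+ X, s_+ Y] in C_- is dual to w |-> g(D+_w X, Y); similarly for s_-. So J_+ and J_- are
   both integrable iff I_+ and I_- are integrable and D+ I_+ = 0 = D- I_-.  Given integrability of
   I, the equation D I = 0 says that H + i d omega (resp. H - i d omega) vanishes on
   T10 x T10 x T; since d omega has no (3,0)-part, this is H = d^c omega (resp. -d^c omega). *)

theory Submission
  imports Defs
begin

text \<open>The bracket is given only through local splittings, so involutivity is tested by
  pairing. A section of the +i-eigenbundle is J b + i b with b real; as J is skew, closure under the
  bracket says <D, J c> = <S, c> for all c, where D and S are the real and imaginary parts of the
  bracket. Split along the eigenbundles of G, this is an identity between the numbers
  2<[sg e1 X, sg e2 Y], sg e3 Z>, which depend on three signs and on the values and first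
  derivatives of X and Y at one point. Two of the three signs always agree, and the repeated sign
  selects the connection. For signs e, e, -e each of J_+, J_- gives only a combination of two
  conditions; adding or subtracting their equations isolates D I = 0. For three equal signs the
  connection terms then cancel and the Nijenhuis tensor remains. Tangent vectors are stored as
  components in charts whose choice may jump from point to point. Derivatives at x are therefore
  taken in the chart chosen at x, on fields with constant components there; \<open>dg\<close> and
  \<open>dI\<close> are such coordinate derivatives, and only suitable combinations of them are
  tensors.\<close>

section \<open>Calculus of smooth functions\<close>

text \<open>An orthogonal spanning set takes the place of a basis, since the model space may be
  zero-dimensional and is not of class \<open>euclidean_space\<close>. The set \<open>C\<close> may
  contain 0, which contributes nothing to the sum.\<close>

lemma finite_span_expansion:
  fixes B :: "'e::real_inner set"
  assumes "finite B" "span B = UNIV"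
  obtains C :: "'e set" and l :: "'e \<Rightarrow> 'e"
  where "finite C" "\<And>v. v = (\<Sum>b\<in>C. (l b \<bullet> v) *\<^sub>R b)"
proof -
  obtain C :: "'e set" where C: "finite C" "span C = UNIV" "pairwise orthogonal C"
    using basis_orthogonal[OF assms(1)] assms(2) by metis
  define l where "l b = b /\<^sub>R (b \<bullet> b)" for b :: 'e
  let ?P = "\<lambda>v. v = (\<Sum>b\<in>C. (l b \<bullet> v) *\<^sub>R b)"
  have "?P v" if "v \<in> span C" for v
    using that
  proof (induction rule: span_induct)
    case base
    show ?case
      unfolding subspace_def
      by (auto simp: inner_add_right scaleR_add_left sum.distrib)
        (metis (no_types, lifting) scaleR_scaleR scaleR_sum_right sum.cong)
  next
    case (step c)
    have "(\<Sum>b\<in>C. (l b \<bullet> c) *\<^sub>R b) = (\<Sum>b\<in>C. if b = c then c else 0)"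
    proof (rule sum.cong[OF refl])
      fix b assume "b \<in> C"
      show "(l b \<bullet> c) *\<^sub>R b = (if b = c then c else 0)"
      proof (cases "b = c")
        case True
        then show ?thesis by (cases "c = 0") (auto simp: l_def)
      next
        case False
        then have "b \<bullet> c = 0"
          using C(3) \<open>b \<in> C\<close> step by (auto simp: pairwise_def orthogonal_def)
        then show ?thesis using False by (simp add: l_def)
      qed
    qed
    then show ?case using C(1) step by simp
  qed
  then show ?thesis using that[OF C(1), of l] C(2) by blast
qed

section \<open>C^k functions: locality, algebra and composition\<close>

lemma frechet_derivative_cong_open:
  assumes "open S" "x \<in> S" "\<And>y. y \<in> S \<Longrightarrow> f y = g y"
  shows "frechet_derivative f (at x) = frechet_derivative g (at x)"
proof -
  have "(f has_derivative D) (at x) \<longleftrightarrow> (g has_derivative D) (at x)" for D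
    using assms by (metis has_derivative_transform_within_open)
  then show ?thesis by (simp add: frechet_derivative_def)
qed

lemma differentiable_cong_open:
  assumes "open S" "x \<in> S" "\<And>y. y \<in> S \<Longrightarrow> f y = g y"
  shows "f differentiable (at x) \<longleftrightarrow> g differentiable (at x)"
  unfolding differentiable_def
  using assms by (metis has_derivative_transform_within_open)

lemma Ck_on_cong:
  assumes "open S" "\<And>y. y \<in> S \<Longrightarrow> f y = g y"
  shows "Ck_on k S f \<longleftrightarrow> Ck_on k S g"
  using assms(2)
proof (induction k arbitrary: f g)
  case 0
  then show ?case by (auto cong: continuous_on_cong)
next
  case (Suc k)
  have "Ck_on k S (\<lambda>x. frechet_derivative f (at x) v)
      \<longleftrightarrow> Ck_on k S (\<lambda>x. frechet_derivative g (at x) v)" for v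
    by (rule Suc.IH) (simp add: frechet_derivative_cong_open[OF assms(1) _ Suc.prems])
  then show ?case
    using differentiable_cong_open[OF assms(1) _ Suc.prems] by simp
qed

lemma Ck_on_subset:
  "Ck_on k S f \<Longrightarrow> T \<subseteq> S \<Longrightarrow> Ck_on k T f"
  by (induction k arbitrary: f) (auto intro: continuous_on_subset)

text \<open>Lets inductions on \<open>k\<close> run with the explicit derivative produced by the
  usual rules instead of \<open>frechet_derivative\<close>; the two agree at the points of
  \<open>S\<close>.\<close>

lemma Ck_on_Suc_has_derivative:
  assumes "open S" "\<And>x. x \<in> S \<Longrightarrow> (f has_derivative D x) (at x)"
  shows "Ck_on (Suc k) S f \<longleftrightarrow> (\<forall>v. Ck_on k S (\<lambda>x. D x v))"
proof -
  have "Ck_on k S (\<lambda>x. frechet_derivative f (at x) v) \<longleftrightarrow> Ck_on k S (\<lambda>x. D x v)" for v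
    by (rule Ck_on_cong[OF assms(1)]) (metis assms(2) frechet_derivative_at)
  then show ?thesis
    using assms(2) by (auto simp: differentiable_def)
qed

lemma Ck_on_Suc_imp_has_derivative:
  assumes "Ck_on (Suc k) S f" "x \<in> S"
  shows "(f has_derivative frechet_derivative f (at x)) (at x)"
  using assms frechet_derivative_works by auto

lemma Ck_on_SucD:
  assumes "Ck_on (Suc k) S f"
  shows "Ck_on k S f"
  using assms
proof (induction k arbitrary: f)
  case 0
  then show ?case
    by (auto simp: continuous_at_imp_continuous_on differentiable_imp_continuous_within)
next
  case (Suc k)
  then show ?case
    by (metis Ck_on.simps(2))
qed

lemma Ck_on_const: "Ck_on k S (\<lambda>x. c)"
  by (induction k arbitrary: c) auto

lemma Ck_on_bounded_linear:
  assumes "bounded_linear L" "open S" "Ck_on k S f"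
  shows "Ck_on k S (\<lambda>x. L (f x))"
  using assms(3)
proof (induction k arbitrary: f)
  case 0
  then show ?case
    using bounded_linear.continuous_on[OF assms(1)] by auto
next
  case (Suc k)
  note D = Ck_on_Suc_imp_has_derivative[OF Suc.prems]
  have "((\<lambda>x. L (f x)) has_derivative (\<lambda>h. L (frechet_derivative f (at x) h))) (at x)"
    if "x \<in> S" for x
    by (rule bounded_linear.has_derivative[OF assms(1) D[OF that]])
  then show ?case
    using Suc by (subst Ck_on_Suc_has_derivative[OF assms(2)]) auto
qed

lemma Ck_on_add:
  assumes "open S" "Ck_on k S f" "Ck_on k S g"
  shows "Ck_on k S (\<lambda>x. f x + g x)"
  using assms(2,3)
proof (induction k arbitrary: f g)
  case 0
  then show ?case by (auto intro: continuous_intros)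
next
  case (Suc k)
  note D = Ck_on_Suc_imp_has_derivative[OF Suc.prems(1)]
    Ck_on_Suc_imp_has_derivative[OF Suc.prems(2)]
  show ?case
    using Suc by (subst Ck_on_Suc_has_derivative[OF assms(1) has_derivative_add[OF D]]) auto
qed

lemma Ck_on_sum:
  assumes "open S" "\<And>i. i \<in> I \<Longrightarrow> Ck_on k S (f i)"
  shows "Ck_on k S (\<lambda>x. \<Sum>i\<in>I. f i x)"
  using assms(2)
  by (induction I rule: infinite_finite_induct) (auto intro: Ck_on_const Ck_on_add[OF assms(1)])

lemma Ck_on_scaleR:
  fixes r :: "'a::real_normed_vector \<Rightarrow> real"
  assumes "open S" "Ck_on k S r" "Ck_on k S f"
  shows "Ck_on k S (\<lambda>x. r x *\<^sub>R f x)"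
  using assms(2,3)
proof (induction k arbitrary: r f)
  case 0
  then show ?case by (auto intro: continuous_intros)
next
  case (Suc k)
  note D = Ck_on_Suc_imp_has_derivative[OF Suc.prems(1)]
    Ck_on_Suc_imp_has_derivative[OF Suc.prems(2)]
  note C = Ck_on_SucD[OF Suc.prems(1)] Ck_on_SucD[OF Suc.prems(2)]
  have "Ck_on k S (\<lambda>x. r x *\<^sub>R frechet_derivative f (at x) h
      + frechet_derivative r (at x) h *\<^sub>R f x)" for h
    using Suc C by (intro Ck_on_add[OF assms(1)] Suc.IH) auto
  then show ?case
    by (subst Ck_on_Suc_has_derivative[OF assms(1) has_derivative_scaleR[OF D]]) auto
qed

text \<open>The chain rule applies f'(g x) to g'(x) v, which varies with x, whereas the induction
  hypothesis covers only fixed directions. Expanding g'(x) v over \<open>C\<close> leaves products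
  of scalar functions with f'(g x) b for fixed b.\<close>

lemma Ck_on_compose:
  fixes f :: "'e::real_inner \<Rightarrow> 'b::real_normed_vector" and g :: "'a::real_normed_vector \<Rightarrow> 'e"
  assumes "finite (B :: 'e set)" "span B = UNIV" "open S" "open T" "\<And>x. x \<in> S \<Longrightarrow> g x \<in> T"
    and "Ck_on k S g" "Ck_on k T f"
  shows "Ck_on k S (\<lambda>x. f (g x))"
  using assms(6,7)
proof (induction k arbitrary: f)
  case 0
  then show ?case
    using assms(5) continuous_on_compose2[of T f S g] by auto
next
  case (Suc k)
  obtain C :: "'e set" and l where C: "finite C" "\<And>v. v = (\<Sum>b\<in>C. (l b \<bullet> v) *\<^sub>R b)"
    using finite_span_expansion[OF assms(1,2)] by blast
  note Dg = Ck_on_Suc_imp_has_derivative[OF Suc.prems(1)]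
  note Df = Ck_on_Suc_imp_has_derivative[OF Suc.prems(2)]
  let ?D = "\<lambda>x v. frechet_derivative f (at (g x)) (frechet_derivative g (at x) v)"
  have D: "((\<lambda>x. f (g x)) has_derivative ?D x) (at x)" if "x \<in> S" for x
    using diff_chain_at[OF Dg[OF that] Df[OF assms(5)[OF that]]] by (simp add: o_def)
  have "Ck_on k S (\<lambda>x. ?D x v)" for v
  proof -
    have eq: "?D x v = (\<Sum>b\<in>C. (l b \<bullet> frechet_derivative g (at x) v) *\<^sub>R
        frechet_derivative f (at (g x)) b)" if "x \<in> S" for x
    proof -
      have "linear (frechet_derivative f (at (g x)))"
        using Df[OF assms(5)[OF that]] has_derivative_linear by blast
      then show ?thesis
        using arg_cong[OF C(2)[of "frechet_derivative g (at x) v"],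
            of "frechet_derivative f (at (g x))"]
        by (simp add: linear_sum linear_scale)
    qed
    have "Ck_on k S (\<lambda>x. \<Sum>b\<in>C. (l b \<bullet> frechet_derivative g (at x) v) *\<^sub>R
        frechet_derivative f (at (g x)) b)"
    proof (intro Ck_on_sum[OF assms(3)] Ck_on_scaleR[OF assms(3)])
      show "Ck_on k S (\<lambda>x. l b \<bullet> frechet_derivative g (at x) v)" for b
        using Suc.prems by (intro Ck_on_bounded_linear[OF bounded_linear_inner_right assms(3)]) auto
      show "Ck_on k S (\<lambda>x. frechet_derivative f (at (g x)) b)" for b
        using Suc.IH[of "\<lambda>y. frechet_derivative f (at y) b"] Suc.prems Ck_on_SucD[OF Suc.prems(1)]
        by auto
    qed
    then show ?thesis
      by (subst Ck_on_cong[OF assms(3) eq])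
  qed
  then show ?case
    using Ck_on_Suc_has_derivative[OF assms(3) D] by blast
qed

lemma smooth_on_subset: "smooth_on S f \<Longrightarrow> T \<subseteq> S \<Longrightarrow> smooth_on T f"
  unfolding smooth_on_def using Ck_on_subset by blast

lemma smooth_on_cong:
  assumes "open S" "\<And>y. y \<in> S \<Longrightarrow> f y = g y"
  shows "smooth_on S f \<longleftrightarrow> smooth_on S g"
  unfolding smooth_on_def by (subst Ck_on_cong[OF assms]) auto

lemma smooth_on_imp_differentiable: "smooth_on S f \<Longrightarrow> x \<in> S \<Longrightarrow> f differentiable (at x)"
  unfolding smooth_on_def by (metis Ck_on.simps(2))

lemma smooth_on_derivative: "smooth_on S f \<Longrightarrow> smooth_on S (\<lambda>x. frechet_derivative f (at x) v)"
  unfolding smooth_on_def by (metis Ck_on.simps(2))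

lemma smooth_on_lincomb:
  assumes "open S" "smooth_on S f" "smooth_on S g"
  shows "smooth_on S (\<lambda>x. a *\<^sub>R f x + b *\<^sub>R g x)"
  using assms unfolding smooth_on_def
  by (auto intro!: Ck_on_add Ck_on_scaleR Ck_on_const)

lemma smooth_on_compose:
  fixes f :: "'e::real_inner \<Rightarrow> 'b::real_normed_vector" and g :: "'a::real_normed_vector \<Rightarrow> 'e"
  assumes "finite (B :: 'e set)" "span B = UNIV" "open S" "open T" "\<And>x. x \<in> S \<Longrightarrow> g x \<in> T"
    and "smooth_on S g" "smooth_on T f"
  shows "smooth_on S (\<lambda>x. f (g x))"
  unfolding smooth_on_def
proof
  fix k show "Ck_on k S (\<lambda>x. f (g x))"
    by (rule Ck_on_compose[OF assms(1-5)]) (use assms(6,7) in \<open>auto simp: smooth_on_def\<close>)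
qed

text \<open>Expanding the argument in a basis reduces this to the product rule for scalar multiples.\<close>

lemma has_derivative_family_apply:
  fixes f :: "'a::real_normed_vector \<Rightarrow> 'e::real_inner \<Rightarrow> 'b::real_normed_vector"
  assumes "finite (B :: 'e set)" "span B = UNIV" "open S" "p \<in> S"
    and lin: "\<And>q. q \<in> S \<Longrightarrow> linear (f q)"
    and df: "\<And>u. (\<lambda>q. f q u) differentiable (at p)"
    and X: "(X has_derivative D) (at p)"
  shows "((\<lambda>q. f q (X q)) has_derivative
      (\<lambda>h. frechet_derivative (\<lambda>q. f q (X p)) (at p) h + f p (D h))) (at p)"
proof -
  obtain C :: "'e set" and l where C: "finite C" "\<And>v. v = (\<Sum>b\<in>C. (l b \<bullet> v) *\<^sub>R b)"
    using finite_span_expansion[OF assms(1,2)] by blast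
  have eq: "f q v = (\<Sum>b\<in>C. (l b \<bullet> v) *\<^sub>R f q b)" if "q \<in> S" for q v
    using arg_cong[OF C(2)[of v], of "f q"] lin[OF that] by (simp add: linear_sum linear_scale)
  have df': "((\<lambda>q. f q u) has_derivative frechet_derivative (\<lambda>q. f q u) (at p)) (at p)" for u
    using df frechet_derivative_works by blast
  have 1: "((\<lambda>q. \<Sum>b\<in>C. (l b \<bullet> X q) *\<^sub>R f q b) has_derivative (\<lambda>h. \<Sum>b\<in>C.
      (l b \<bullet> X p) *\<^sub>R frechet_derivative (\<lambda>q. f q b) (at p) h + (l b \<bullet> D h) *\<^sub>R f p b)) (at p)"
    by (intro has_derivative_sum has_derivative_scaleR df' has_derivative_inner_right X)
  have 2: "((\<lambda>q. \<Sum>b\<in>C. (l b \<bullet> X p) *\<^sub>R f q b) has_derivative (\<lambda>h. \<Sum>b\<in>C.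
      (l b \<bullet> X p) *\<^sub>R frechet_derivative (\<lambda>q. f q b) (at p) h)) (at p)"
    by (intro has_derivative_sum has_derivative_scaleR_right df')
  have 3: "((\<lambda>q. f q (X p)) has_derivative (\<lambda>h. \<Sum>b\<in>C.
      (l b \<bullet> X p) *\<^sub>R frechet_derivative (\<lambda>q. f q b) (at p) h)) (at p)"
    by (rule has_derivative_transform_within_open[OF 2 assms(3,4)]) (simp add: eq)
  have 4: "((\<lambda>q. f q (X q)) has_derivative (\<lambda>h. \<Sum>b\<in>C.
      (l b \<bullet> X p) *\<^sub>R frechet_derivative (\<lambda>q. f q b) (at p) h + (l b \<bullet> D h) *\<^sub>R f p b)) (at p)"
    by (rule has_derivative_transform_within_open[OF 1 assms(3,4)]) (simp add: eq)
  then show ?thesis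
    by (simp add: sum.distrib frechet_derivative_at[OF 3, symmetric] flip: eq[OF assms(4)])
qed

section \<open>Sections and derivatives in the chart at a point\<close>

text \<open>The record package has introduced another constant \<open>extend\<close>.\<close>

hide_const courant.extend
hide_fact courant.extend_def

text \<open>The field read in the single chart chosen at \<open>x\<close>. Unlike the stored values
  of \<open>X\<close>, which refer to a chart depending on the point, these components vary smoothly
  near \<open>x\<close>.\<close>

definition comps ::
    "('m, 'e::real_normed_vector) chart set \<Rightarrow> 'm \<Rightarrow> ('m \<Rightarrow> 'e) \<Rightarrow> 'm \<Rightarrow> 'e" where
  "comps A x X y = jac (chart_at A y) (chart_at A x) y (X y)"

text \<open>The flat connection of the chart chosen at \<open>x\<close>, evaluated at
  \<open>x\<close>. It has no torsion, so the Lie bracket is its antisymmetrisation.\<close>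

definition field_deriv ::
    "('m, 'e::real_normed_vector) chart set \<Rightarrow> 'm \<Rightarrow> ('m \<Rightarrow> 'e) \<Rightarrow> 'e \<Rightarrow> 'e" where
  "field_deriv A x X v = dir_deriv A x v (comps A x X)"

definition diff_at ::
    "('m, 'e::real_normed_vector) chart set \<Rightarrow> 'm \<Rightarrow> ('m \<Rightarrow> 'b::real_normed_vector) \<Rightarrow> bool" where
  "diff_at A x f \<longleftrightarrow>
     (f \<circ> chart_inv (chart_at A x)) differentiable (at (snd (chart_at A x) x))"

lemma lie_bracket_field_deriv:
  "lie_bracket A X Y x = field_deriv A x Y (X x) - field_deriv A x X (Y x)"
  by (simp add: lie_bracket_def field_deriv_def comps_def[abs_def])

lemma smooth_fun_subset: "smooth_fun A U f \<Longrightarrow> V \<subseteq> U \<Longrightarrow> smooth_fun A V f"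
  unfolding smooth_fun_def by (meson image_mono inf_mono order_refl smooth_on_subset)

lemma smooth_section_subset: "smooth_section A F T U a \<Longrightarrow> V \<subseteq> U \<Longrightarrow> smooth_section A F T V a"
  unfolding smooth_section_def
  by (auto intro: smooth_fun_subset[of A "U \<inter> _"])

lemma vector_field_subset: "vector_field A U X \<Longrightarrow> V \<subseteq> U \<Longrightarrow> vector_field A V X"
  unfolding vector_field_def by (rule smooth_section_subset)

lemma one_form_subset: "one_form A U \<xi> \<Longrightarrow> V \<subseteq> U \<Longrightarrow> one_form A V \<xi>"
  unfolding one_form_def by (meson order_trans subsetD)

lemma dir_deriv_works:
  assumes "diff_at A x f"
  shows "((f \<circ> chart_inv (chart_at A x)) has_derivative (\<lambda>v. dir_deriv A x v f))
    (at (snd (chart_at A x) x))"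
  using assms unfolding diff_at_def dir_deriv_def frechet_derivative_works .

lemma dir_deriv_eqI:
  assumes "((f \<circ> chart_inv (chart_at A x)) has_derivative D) (at (snd (chart_at A x) x))"
  shows "dir_deriv A x v f = D v"
  using frechet_derivative_at[OF assms] unfolding dir_deriv_def by simp

lemma linear_dir_deriv: "diff_at A x f \<Longrightarrow> linear (\<lambda>v. dir_deriv A x v f)"
  by (rule has_derivative_linear[OF dir_deriv_works])

lemma dir_deriv_const: "dir_deriv A x v (\<lambda>y. c) = 0"
proof -
  have "(((\<lambda>y. c) \<circ> chart_inv (chart_at A x)) has_derivative (\<lambda>_. 0)) (at (snd (chart_at A x) x))"
    by (simp add: o_def)
  from dir_deriv_eqI[OF this] show ?thesis .
qed

lemma dir_deriv_bounded_linear: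
  assumes "bounded_linear L" "diff_at A x f"
  shows "dir_deriv A x v (\<lambda>y. L (f y)) = L (dir_deriv A x v f)"
proof -
  have "(((\<lambda>y. L (f y)) \<circ> chart_inv (chart_at A x)) has_derivative (\<lambda>v. L (dir_deriv A x v f)))
      (at (snd (chart_at A x) x))"
    using bounded_linear.has_derivative[OF assms(1) dir_deriv_works[OF assms(2)]]
    by (simp add: o_def)
  from dir_deriv_eqI[OF this] show ?thesis .
qed

lemma dir_deriv_lincomb:
  assumes "diff_at A x f" "diff_at A x g"
  shows "dir_deriv A x v (\<lambda>y. a *\<^sub>R f y + b *\<^sub>R g y) =
    a *\<^sub>R dir_deriv A x v f + b *\<^sub>R dir_deriv A x v g"
proof -
  have "(((\<lambda>y. a *\<^sub>R f y + b *\<^sub>R g y) \<circ> chart_inv (chart_at A x)) has_derivative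
      (\<lambda>v. a *\<^sub>R dir_deriv A x v f + b *\<^sub>R dir_deriv A x v g)) (at (snd (chart_at A x) x))"
    using has_derivative_add[OF has_derivative_scaleR_right[OF dir_deriv_works[OF assms(1)]]
      has_derivative_scaleR_right[OF dir_deriv_works[OF assms(2)]]]
    by (simp add: o_def)
  from dir_deriv_eqI[OF this] show ?thesis .
qed

lemma dir_deriv_add:
  assumes "diff_at A x f" "diff_at A x g"
  shows "dir_deriv A x v (\<lambda>y. f y + g y) = dir_deriv A x v f + dir_deriv A x v g"
  using dir_deriv_lincomb[OF assms, of _ 1 1] by simp

lemma linear_linear_on: "linear f \<Longrightarrow> linear_on S f"
  by (simp add: linear_on_def linear_add linear_scale)

section \<open>Charts, vector fields and coordinate derivatives on a fixed manifold\<close>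

locale manifold =
  fixes A :: "('m::{t2_space,second_countable_topology}, 'e::real_inner) chart set"
  assumes atlas: "smooth_atlas A"
begin

lemma model_basis: obtains B :: "'e set" where "finite B" "span B = UNIV"
  using atlas unfolding smooth_atlas_def by blast

lemma chart_at_mem: "chart_at A x \<in> A" and mem_chart_at: "x \<in> fst (chart_at A x)"
proof -
  have "x \<in> (\<Union>c\<in>A. fst c)" using atlas unfolding smooth_atlas_def by simp
  then have "\<exists>c. c \<in> A \<and> x \<in> fst c" by blast
  from someI_ex[OF this] show "chart_at A x \<in> A" "x \<in> fst (chart_at A x)"
    unfolding chart_at_def by auto
qed

lemma open_chart: "c \<in> A \<Longrightarrow> open (fst c)"
  using atlas unfolding smooth_atlas_def by blast

lemma chart_homeomorphism:
  "c \<in> A \<Longrightarrow> homeomorphism (fst c) (snd c ` fst c) (snd c) (chart_inv c)"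
  using atlas unfolding smooth_atlas_def by blast

lemma chart_inv_chart: "c \<in> A \<Longrightarrow> y \<in> fst c \<Longrightarrow> chart_inv c (snd c y) = y"
  using chart_homeomorphism homeomorphism_apply1 by blast

lemma open_chart_image:
  assumes "c \<in> A" "open V"
  shows "open (snd c ` (V \<inter> fst c))"
proof -
  have "openin (top_of_set (snd c ` fst c)) (snd c ` (V \<inter> fst c))"
    using homeomorphism_imp_open_map[OF chart_homeomorphism[OF assms(1)], of "V \<inter> fst c"] assms(2)
    by (metis inf_commute openin_open_Int)
  moreover have "open (snd c ` fst c)"
    using atlas assms(1) unfolding smooth_atlas_def by blast
  ultimately show ?thesis
    using openin_open_eq by blast
qed

lemma smooth_transition:
  "c \<in> A \<Longrightarrow> d \<in> A \<Longrightarrow> smooth_on (snd c ` (fst c \<inter> fst d)) (snd d \<circ> chart_inv c)"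
  using atlas unfolding smooth_atlas_def by blast

lemma open_overlap_image: "c \<in> A \<Longrightarrow> d \<in> A \<Longrightarrow> open (snd c ` (fst c \<inter> fst d))"
  using open_chart_image[of c "fst d"] open_chart[of d] by (simp add: inf_commute)

lemma jac_works:
  assumes "c \<in> A" "d \<in> A" "y \<in> fst c" "y \<in> fst d"
  shows "((snd d \<circ> chart_inv c) has_derivative jac c d y) (at (snd c y))"
  unfolding jac_def
  by (rule frechet_derivative_works[THEN iffD1],
      rule smooth_on_imp_differentiable[OF smooth_transition[OF assms(1,2)]]) (use assms(3,4) in auto)

lemma linear_jac: "c \<in> A \<Longrightarrow> d \<in> A \<Longrightarrow> y \<in> fst c \<Longrightarrow> y \<in> fst d \<Longrightarrow> linear (jac c d y)"
  by (rule has_derivative_linear[OF jac_works])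

lemma jac_cocycle:
  assumes "c \<in> A" "d \<in> A" "e \<in> A" "y \<in> fst c" "y \<in> fst d" "y \<in> fst e"
  shows "jac d e y (jac c d y v) = jac c e y v"
proof -
  have y: "snd d y = (snd d \<circ> chart_inv c) (snd c y)"
    using chart_inv_chart assms by simp
  have 1: "((snd e \<circ> chart_inv d) \<circ> (snd d \<circ> chart_inv c) has_derivative jac d e y \<circ> jac c d y)
      (at (snd c y))"
    using diff_chain_at[OF jac_works[OF assms(1,2,4,5)]] jac_works[OF assms(2,3,5,6)] y by simp
  have "(snd e \<circ> chart_inv c has_derivative jac d e y \<circ> jac c d y) (at (snd c y))"
    by (rule has_derivative_transform_within_open[OF 1 open_chart_image[OF assms(1)
          open_chart[OF assms(2)]]])
      (use assms chart_inv_chart in auto)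
  from has_derivative_unique[OF this jac_works[OF assms(1,3,4,6)]]
  show ?thesis by (metis comp_apply)
qed

lemma jac_same: "c \<in> A \<Longrightarrow> y \<in> fst c \<Longrightarrow> jac c c y v = v"
proof -
  assume c: "c \<in> A" "y \<in> fst c"
  have "(snd c \<circ> chart_inv c has_derivative (\<lambda>v. v)) (at (snd c y))"
    by (rule has_derivative_transform_within_open[OF has_derivative_ident open_chart_image[OF c(1)
          open_chart[OF c(1)]]])
      (use c chart_inv_chart in auto)
  from has_derivative_unique[OF this jac_works[OF c(1,1,2,2)]]
  show "jac c c y v = v" by metis
qed

lemma extend_same: "extend A x v x = v"
  unfolding extend_def using jac_same chart_at_mem mem_chart_at by blast

lemma comps_same: "comps A x X x = X x"
  unfolding comps_def using jac_same chart_at_mem mem_chart_at by blast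

lemma comps_extend: "y \<in> fst (chart_at A x) \<Longrightarrow> comps A x (extend A x v) y = v"
  unfolding comps_def extend_def by (simp add: jac_cocycle jac_same chart_at_mem mem_chart_at)

lemma extend_comps: "y \<in> fst (chart_at A x) \<Longrightarrow> extend A x (comps A x X y) y = X y"
  unfolding comps_def extend_def by (simp add: jac_cocycle jac_same chart_at_mem mem_chart_at)

lemma linear_extend: "y \<in> fst (chart_at A x) \<Longrightarrow> linear (\<lambda>v. extend A x v y)"
  unfolding extend_def by (simp add: linear_jac chart_at_mem mem_chart_at)

lemma comps_lincomb:
  assumes "y \<in> fst (chart_at A x)"
  shows "comps A x (\<lambda>y. a *\<^sub>R X y + b *\<^sub>R Y y) y = a *\<^sub>R comps A x X y + b *\<^sub>R comps A x Y y"
proof -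
  have "linear (jac (chart_at A y) (chart_at A x) y)"
    using assms by (simp add: linear_jac chart_at_mem mem_chart_at)
  then show ?thesis
    by (simp add: comps_def linear_add linear_scale)
qed

lemma open_domain: "open (fst (chart_at A x))"
  using open_chart chart_at_mem by blast

lemma dir_deriv_cong:
  assumes "open V" "x \<in> V" "\<And>y. y \<in> V \<Longrightarrow> y \<in> fst (chart_at A x) \<Longrightarrow> f y = h y"
  shows "dir_deriv A x v f = dir_deriv A x v h"
proof -
  let ?c = "chart_at A x"
  have o: "open (snd ?c ` (V \<inter> fst ?c))" "snd ?c x \<in> snd ?c ` (V \<inter> fst ?c)"
    using open_chart_image[OF chart_at_mem assms(1)] assms(2) mem_chart_at by auto
  have eq: "(f \<circ> chart_inv ?c) p = (h \<circ> chart_inv ?c) p" if "p \<in> snd ?c ` (V \<inter> fst ?c)" for p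
    using that assms(3) chart_inv_chart[OF chart_at_mem] by auto
  show ?thesis
    unfolding dir_deriv_def by (simp only: frechet_derivative_cong_open[OF o eq])
qed

lemma smooth_fun_cong:
  assumes "open U" "\<And>y. y \<in> U \<Longrightarrow> f y = h y"
  shows "smooth_fun A U f \<longleftrightarrow> smooth_fun A U h"
proof -
  have "smooth_on (snd c ` (U \<inter> fst c)) (f \<circ> chart_inv c)
      \<longleftrightarrow> smooth_on (snd c ` (U \<inter> fst c)) (h \<circ> chart_inv c)" if "c \<in> A" for c
    by (rule smooth_on_cong[OF open_chart_image[OF that assms(1)]])
      (use assms(2) chart_inv_chart[OF that] in auto)
  then show ?thesis unfolding smooth_fun_def by blast
qed

lemma smooth_fun_lincomb:
  assumes "open U" "smooth_fun A U f" "smooth_fun A U h"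
  shows "smooth_fun A U (\<lambda>y. a *\<^sub>R f y + b *\<^sub>R h y)"
  unfolding smooth_fun_def
proof
  fix c assume c: "c \<in> A"
  then show "smooth_on (snd c ` (U \<inter> fst c)) ((\<lambda>y. a *\<^sub>R f y + b *\<^sub>R h y) \<circ> chart_inv c)"
    using smooth_on_lincomb[OF open_chart_image[OF c assms(1)], of "f \<circ> chart_inv c"
        "h \<circ> chart_inv c" a b] assms(2,3)
    by (simp add: smooth_fun_def o_def)
qed

lemma smooth_fun_imp_diff_at:
  assumes "smooth_fun A U f" "x \<in> U"
  shows "diff_at A x f"
  using assms smooth_on_imp_differentiable chart_at_mem mem_chart_at
  unfolding smooth_fun_def diff_at_def by blast

lemma smooth_section_lincomb:
  assumes "open U" "smooth_section A F T U a" "smooth_section A F T U b"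
    and "\<And>y. subspace (F y)" "\<And>V \<Phi>. (V, \<Phi>) \<in> T \<Longrightarrow> open V"
    and "\<And>V \<Phi> y. (V, \<Phi>) \<in> T \<Longrightarrow> y \<in> V \<Longrightarrow> linear_on (F y) (\<Phi> y)"
  shows "smooth_section A F T U (\<lambda>y. r *\<^sub>R a y + t *\<^sub>R b y)"
  unfolding smooth_section_def
proof (intro conjI ballI, goal_cases)
  case (1 y)
  then show ?case
    using assms(2,3,4) by (simp add: smooth_section_def subspace_add subspace_scale)
next
  case (2 V\<Phi>)
  obtain V \<Phi> where V: "V\<Phi> = (V, \<Phi>)" "(V, \<Phi>) \<in> T" using 2 by (cases V\<Phi>) auto
  have "smooth_fun A (U \<inter> V) (\<lambda>y. r *\<^sub>R \<Phi> y (a y) + t *\<^sub>R \<Phi> y (b y))"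
    using assms(1,2,3) assms(5)[OF V(2)] V(2)
    by (intro smooth_fun_lincomb) (auto simp: smooth_section_def)
  moreover have "\<Phi> y (r *\<^sub>R a y + t *\<^sub>R b y) = r *\<^sub>R \<Phi> y (a y) + t *\<^sub>R \<Phi> y (b y)" if "y \<in> U \<inter> V" for y
    using assms(2,3) assms(6)[OF V(2), of y] that by (auto simp: smooth_section_def linear_on_def)
  ultimately show ?case
    unfolding V(1) prod.case by (subst smooth_fun_cong[OF open_Int[OF assms(1) assms(5)[OF V(2)]]])
qed

lemma tangent_triv:
  assumes "(V, \<Phi>) \<in> tangent_trivs A"
  shows "open V" "y \<in> V \<Longrightarrow> linear_on UNIV (\<Phi> y)"
  using assms open_chart linear_jac[OF chart_at_mem _ mem_chart_at]
  by (auto simp: tangent_trivs_def intro!: linear_linear_on)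

lemma vector_field_lincomb:
  "open U \<Longrightarrow> vector_field A U X \<Longrightarrow> vector_field A U Y \<Longrightarrow>
    vector_field A U (\<lambda>y. r *\<^sub>R X y + t *\<^sub>R Y y)"
  unfolding vector_field_def by (rule smooth_section_lincomb) (auto dest: tangent_triv)

lemma vector_field_scale:
  "open U \<Longrightarrow> vector_field A U X \<Longrightarrow> vector_field A U (\<lambda>y. r *\<^sub>R X y)"
  using vector_field_lincomb[of U X X r 0] by simp

text \<open>The cocycle rule removes \<open>chart_at A y\<close>, whose choice need not be
  continuous in \<open>y\<close>: read in a fixed chart \<open>c\<close>, the field is the
  derivative of the transition from the chart at \<open>x\<close>, applied to the fixed vector
  \<open>u\<close>.\<close>

lemma vector_field_extend: "vector_field A (fst (chart_at A x)) (extend A x u)"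
proof -
  let ?c = "chart_at A x"
  have "smooth_fun A (fst ?c \<inter> fst c) (\<lambda>y. jac (chart_at A y) c y (extend A x u y))"
    if c: "c \<in> A" for c
  proof -
    have "smooth_fun A (fst ?c \<inter> fst c) (\<lambda>y. jac ?c c y u)"
      unfolding smooth_fun_def
    proof
      fix d assume d: "d \<in> A"
      let ?S = "snd d ` (fst ?c \<inter> fst c \<inter> fst d)" and ?T = "snd ?c ` (fst ?c \<inter> fst c)"
      obtain B :: "'e set" where B: "finite B" "span B = UNIV" using model_basis by blast
      have S: "open ?S"
        using open_chart_image[OF d, of "fst ?c \<inter> fst c"] open_chart c chart_at_mem by blast
      have T: "open ?T"
        using open_overlap_image chart_at_mem c by blast
      \<comment> \<open>Smoothness is tested in an arbitrary chart \<open>d\<close>, while the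
        derivative is a function of the coordinates of \<open>?c\<close>; the transition from
        \<open>d\<close> to \<open>?c\<close> connects the two.\<close>
      have "smooth_on ?S (\<lambda>p. frechet_derivative (snd c \<circ> chart_inv ?c)
          (at ((snd ?c \<circ> chart_inv d) p)) u)"
      proof (rule smooth_on_compose[OF B S T,
            where f = "\<lambda>q. frechet_derivative (snd c \<circ> chart_inv ?c) (at q) u"])
        show "(snd ?c \<circ> chart_inv d) p \<in> ?T" if "p \<in> ?S" for p
          using that chart_inv_chart[OF d] by auto
        show "smooth_on ?S (snd ?c \<circ> chart_inv d)"
          by (rule smooth_on_subset[OF smooth_transition[OF d chart_at_mem]]) auto
        show "smooth_on ?T (\<lambda>q. frechet_derivative (snd c \<circ> chart_inv ?c) (at q) u)"
          by (rule smooth_on_derivative[OF smooth_transition[OF chart_at_mem c]])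
      qed
      then show "smooth_on ?S ((\<lambda>y. jac ?c c y u) \<circ> chart_inv d)"
        by (simp add: jac_def o_def)
    qed
    moreover have "jac (chart_at A y) c y (extend A x u y) = jac ?c c y u"
      if "y \<in> fst ?c \<inter> fst c" for y
      using that c by (simp add: extend_def jac_cocycle chart_at_mem mem_chart_at)
    ultimately show ?thesis
      by (subst smooth_fun_cong[OF open_Int[OF open_domain open_chart[OF c]]]) auto
  qed
  then show ?thesis
    unfolding vector_field_def smooth_section_def tangent_trivs_def by auto
qed

lemma diff_at_comps:
  assumes "vector_field A U X" "x \<in> U"
  shows "diff_at A x (comps A x X)"
proof -
  let ?c = "chart_at A x"
  have "(fst ?c, \<lambda>y. jac (chart_at A y) ?c y) \<in> tangent_trivs A"
    unfolding tangent_trivs_def using chart_at_mem by blast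
  then have "smooth_fun A (U \<inter> fst ?c) (comps A x X)"
    using assms(1) unfolding vector_field_def smooth_section_def comps_def[abs_def] by auto
  then show ?thesis
    using smooth_fun_imp_diff_at assms(2) mem_chart_at by blast
qed

lemma linear_field_deriv: "vector_field A U X \<Longrightarrow> x \<in> U \<Longrightarrow> linear (field_deriv A x X)"
  using linear_dir_deriv[OF diff_at_comps] unfolding field_deriv_def[abs_def] .

lemma field_deriv_cong:
  assumes "open U" "x \<in> U" "\<And>y. y \<in> U \<Longrightarrow> X y = Y y"
  shows "field_deriv A x X = field_deriv A x Y"
  unfolding field_deriv_def[abs_def]
  by (rule ext, rule dir_deriv_cong[OF assms(1,2)]) (simp add: comps_def assms(3))

lemma field_deriv_extend: "field_deriv A x (extend A x u) = (\<lambda>_. 0)"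
proof
  fix v
  have "dir_deriv A x v (comps A x (extend A x u)) = dir_deriv A x v (\<lambda>y. u)"
    by (rule dir_deriv_cong[OF open_domain mem_chart_at]) (simp add: comps_extend)
  then show "field_deriv A x (extend A x u) v = 0"
    by (simp add: field_deriv_def dir_deriv_const)
qed

lemma field_deriv_lincomb:
  assumes "vector_field A U X" "vector_field A U Y" "x \<in> U"
  shows "field_deriv A x (\<lambda>y. a *\<^sub>R X y + b *\<^sub>R Y y) v =
    a *\<^sub>R field_deriv A x X v + b *\<^sub>R field_deriv A x Y v"
proof -
  have "dir_deriv A x v (comps A x (\<lambda>y. a *\<^sub>R X y + b *\<^sub>R Y y)) =
      dir_deriv A x v (\<lambda>y. a *\<^sub>R comps A x X y + b *\<^sub>R comps A x Y y)"
    by (rule dir_deriv_cong[OF open_domain mem_chart_at]) (simp add: comps_lincomb)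
  then show ?thesis
    by (simp add: field_deriv_def dir_deriv_lincomb[OF assms(1,2)[THEN diff_at_comps, OF assms(3)]])
qed

lemma field_deriv_scale:
  assumes "vector_field A U X" "x \<in> U"
  shows "field_deriv A x (\<lambda>y. r *\<^sub>R X y) v = r *\<^sub>R field_deriv A x X v"
  using field_deriv_lincomb[OF assms(1,1,2), of r 0 v] by simp

text \<open>Leibniz rule: one term freezes the components of \<open>X\<close> at \<open>x\<close>,
  the other lets them vary. In the chart at \<open>x\<close> this is
  \<open>has_derivative_family_apply\<close> for the family \<open>F\<close>.\<close>

lemma dir_deriv_apply:
  fixes f :: "'m \<Rightarrow> 'e \<Rightarrow> 'b::real_normed_vector"
  assumes U: "open U" "x \<in> U" and lin: "\<And>y. y \<in> U \<Longrightarrow> linear (f y)"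
    and df: "\<And>u. diff_at A x (\<lambda>y. f y (extend A x u y))"
    and X: "vector_field A U X"
  shows "dir_deriv A x v (\<lambda>y. f y (X y)) =
      dir_deriv A x v (\<lambda>y. f y (extend A x (X x) y)) + f x (field_deriv A x X v)"
proof -
  let ?c = "chart_at A x" and ?p = "snd (chart_at A x) x"
  let ?S = "snd ?c ` (U \<inter> fst ?c)"
  define F where "F q u = f (chart_inv ?c q) (extend A x u (chart_inv ?c q))" for q u
  obtain B :: "'e set" where B: "finite B" "span B = UNIV" using model_basis by blast
  have S: "open ?S" "?p \<in> ?S"
    using open_chart_image[OF chart_at_mem U(1)] U(2) mem_chart_at by auto
  have inv: "chart_inv ?c ?p = x"
    using chart_inv_chart chart_at_mem mem_chart_at by blast
  have "linear (F q)" if "q \<in> ?S" for q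
  proof -
    from that have "chart_inv ?c q \<in> U \<inter> fst ?c"
      using chart_inv_chart[OF chart_at_mem] by auto
    then show ?thesis
      unfolding F_def using linear_compose[OF linear_extend lin] by (auto simp: o_def)
  qed
  moreover have "(\<lambda>q. F q u) differentiable (at ?p)" for u
    using df[of u] by (simp add: diff_at_def F_def o_def)
  moreover have "(comps A x X \<circ> chart_inv ?c has_derivative field_deriv A x X) (at ?p)"
    using dir_deriv_works[OF diff_at_comps[OF X U(2)]] unfolding field_deriv_def[abs_def] .
  ultimately have "((\<lambda>q. F q ((comps A x X \<circ> chart_inv ?c) q)) has_derivative
      (\<lambda>h. frechet_derivative (\<lambda>q. F q ((comps A x X \<circ> chart_inv ?c) ?p)) (at ?p) h
        + F ?p (field_deriv A x X h))) (at ?p)"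
    by (intro has_derivative_family_apply[OF B S])
  moreover have "F ?p u = f x u" for u
    by (simp add: F_def inv extend_same)
  moreover have "frechet_derivative (\<lambda>q. F q u) (at ?p) h = dir_deriv A x h (\<lambda>y. f y (extend A x u y))"
    for u h
    by (simp add: dir_deriv_def F_def o_def)
  ultimately have 1: "((\<lambda>q. F q (comps A x X (chart_inv ?c q))) has_derivative
      (\<lambda>h. dir_deriv A x h (\<lambda>y. f y (extend A x (X x) y)) + f x (field_deriv A x X h))) (at ?p)"
    by (simp add: inv comps_same)
  have "((\<lambda>y. f y (X y)) \<circ> chart_inv ?c has_derivative
      (\<lambda>h. dir_deriv A x h (\<lambda>y. f y (extend A x (X x) y)) + f x (field_deriv A x X h))) (at ?p)"
    by (rule has_derivative_transform_within_open[OF 1 S])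
      (auto simp: F_def chart_inv_chart[OF chart_at_mem] extend_comps)
  from dir_deriv_eqI[OF this] show ?thesis .
qed

text \<open>Source of the linearity of \<open>dg\<close>, \<open>dI\<close> and
  \<open>d_form\<close> in the arguments other than the direction of differentiation.\<close>

lemma linear_dir_deriv_family:
  fixes f :: "'m \<Rightarrow> 'e \<Rightarrow> 'b::real_normed_vector"
  assumes "open U" "x \<in> U" "\<And>y. y \<in> U \<Longrightarrow> linear (f y)" "\<And>u. diff_at A x (\<lambda>y. f y u)"
  shows "linear (\<lambda>u. dir_deriv A x v (\<lambda>y. f y u))"
proof (rule linearI)
  fix u w r
  have "dir_deriv A x v (\<lambda>y. f y (u + w)) = dir_deriv A x v (\<lambda>y. f y u + f y w)"
    by (rule dir_deriv_cong[OF assms(1,2)]) (simp add: assms(3) linear_add)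
  then show "dir_deriv A x v (\<lambda>y. f y (u + w)) =
      dir_deriv A x v (\<lambda>y. f y u) + dir_deriv A x v (\<lambda>y. f y w)"
    by (simp add: dir_deriv_add assms(4))
  have "dir_deriv A x v (\<lambda>y. f y (r *\<^sub>R u)) = dir_deriv A x v (\<lambda>y. r *\<^sub>R f y u + 0 *\<^sub>R f y u)"
    by (rule dir_deriv_cong[OF assms(1,2)]) (simp add: assms(3) linear_scale)
  then show "dir_deriv A x v (\<lambda>y. f y (r *\<^sub>R u)) = r *\<^sub>R dir_deriv A x v (\<lambda>y. f y u)"
    using dir_deriv_lincomb[OF assms(4,4), of v r u 0 u] by simp
qed

end

section \<open>Almost Hermitian geometry at a point\<close>

text \<open>Either of the two eigenvector equations is the other one with \<open>J\<close> applied
  to it, so an eigenvector is determined by its imaginary part.\<close>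

lemma plus_i_eigen_iff:
  assumes "linear J" "\<And>v. J (J v) = - v"
  shows "plus_i_eigen J z \<longleftrightarrow> fst z = J (snd z)"
  unfolding plus_i_eigen_def using assms by metis

lemma length_3_iff: "length xs = 3 \<longleftrightarrow> (\<exists>a b c. xs = [a, b, c])"
  by (auto simp: numeral_3_eq_3 length_Suc_conv)

lemma type_part_3_eq_0:
  assumes "p + q = 3" "\<And>a b c. \<alpha> [a, b, c] = 0"
  shows "type_part J p q \<alpha> [u, v, w] = 0"
  unfolding type_part_def
proof (rule sum.neutral, rule ballI)
  fix bs assume "bs \<in> {bs. length bs = p + q \<and> count_list bs True = p}"
  then obtain b1 b2 b3 where "bs = [b1, b2, b3]"
    using assms(1) by (auto simp: length_3_iff)
  then show "complexify_form \<alpha> (map2 (proj_type J) bs [u, v, w]) = 0"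
    by (simp add: assms(2))
qed

lemma type_part_21:
  "type_part J 2 1 \<alpha> [u, v, w] =
     complexify_form \<alpha> [proj_type J True u, proj_type J True v, proj_type J False w]
   + complexify_form \<alpha> [proj_type J True u, proj_type J False v, proj_type J True w]
   + complexify_form \<alpha> [proj_type J False u, proj_type J True v, proj_type J True w]"
  and type_part_12:
  "type_part J 1 2 \<alpha> [u, v, w] =
     complexify_form \<alpha> [proj_type J False u, proj_type J False v, proj_type J True w]
   + complexify_form \<alpha> [proj_type J False u, proj_type J True v, proj_type J False w]
   + complexify_form \<alpha> [proj_type J True u, proj_type J False v, proj_type J False w]"
proof -
  have bs: "{bs. length bs = 2 + 1 \<and> count_list bs True = 2} =
      {[True, True, False], [True, False, True], [False, True, True]}"
    "{bs. length bs = 1 + 2 \<and> count_list bs True = 1} =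
      {[False, False, True], [False, True, False], [True, False, False]}"
    by (auto simp: length_3_iff length_3_iff[unfolded numeral_3_eq_3] ex_bool_eq)
  show "type_part J 2 1 \<alpha> [u, v, w] =
       complexify_form \<alpha> [proj_type J True u, proj_type J True v, proj_type J False w]
     + complexify_form \<alpha> [proj_type J True u, proj_type J False v, proj_type J True w]
     + complexify_form \<alpha> [proj_type J False u, proj_type J True v, proj_type J True w]"
    "type_part J 1 2 \<alpha> [u, v, w] =
       complexify_form \<alpha> [proj_type J False u, proj_type J False v, proj_type J True w]
     + complexify_form \<alpha> [proj_type J False u, proj_type J True v, proj_type J False w]
     + complexify_form \<alpha> [proj_type J True u, proj_type J False v, proj_type J False w]"
    unfolding type_part_def bs by simp_all
qed

lemma
  fixes H :: "'m::topological_space \<Rightarrow> 'e::real_normed_vector list \<Rightarrow> real"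
  assumes "diff_form A 3 H"
  shows diff_form_linear: "linear (\<lambda>u. H x [u, v, w])" "linear (\<lambda>v. H x [u, v, w])"
      "linear (\<lambda>w. H x [u, v, w])"
    and diff_form_alternating: "H x [v, u, w] = - H x [u, v, w]" "H x [u, w, v] = - H x [u, v, w]"
proof -
  have lin: "linear (\<lambda>u. H x (vs[i := u]))" if "length vs = 3" "i < 3" for vs i
    using assms[unfolded diff_form_def] that by (elim conjE) simp
  have alt: "H x vs = 0" if "length vs = 3" "\<not> distinct vs" for vs
    using assms[unfolded diff_form_def] that by (elim conjE) simp
  show lin': "linear (\<lambda>u. H x [u, v, w])" "linear (\<lambda>v. H x [u, v, w])" "linear (\<lambda>w. H x [u, v, w])"
    for u v w
    using lin[of "[u, v, w]" 0] lin[of "[u, v, w]" 1] lin[of "[u, v, w]" 2] by simp_all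
  note add = lin'[THEN linear_add]
  \<comment> \<open>Polarisation: expanding by additivity leaves two mixed terms, whose sum must
    vanish.\<close>
  have "H x [u + v, u + v, w] = 0" "H x [u, v + w, v + w] = 0"
    "H x [u, u, w] = 0" "H x [v, v, w] = 0" "H x [u, w, w] = 0" "H x [u, v, v] = 0"
    by (simp_all add: alt)
  note zero = this[unfolded add]
  show "H x [v, u, w] = - H x [u, v, w]"
    using zero by linarith
  show "H x [u, w, v] = - H x [u, v, w]"
    using zero by linarith
qed

section \<open>Almost Hermitian structures: coordinate derivatives of the metric and of I\<close>

locale almost_hermitian = manifold A
  for A :: "('m::{t2_space,second_countable_topology}, 'e::real_inner) chart set" +
  fixes g :: "'m \<Rightarrow> 'e \<Rightarrow> 'e \<Rightarrow> real" and I :: "'m \<Rightarrow> 'e \<Rightarrow> 'e"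
  assumes metric: "riemannian_metric A g"
    and acs: "almost_complex A I"
    and hermitian: "\<And>x u v. g x (I x u) (I x v) = g x u v"
begin

text \<open>Derivatives of the metric components in the chart at \<open>x\<close>, the ingredients
  of the Christoffel symbols there.\<close>

definition dg :: "'m \<Rightarrow> 'e \<Rightarrow> 'e \<Rightarrow> 'e \<Rightarrow> real" where
  "dg x v a b = dir_deriv A x v (\<lambda>y. g y (extend A x a y) (extend A x b y))"

definition dI :: "'m \<Rightarrow> 'e \<Rightarrow> 'e \<Rightarrow> 'e" where
  "dI x v u = field_deriv A x (\<lambda>y. I y (extend A x u y)) v"

lemma g_sym: "g x u v = g x v u"
  and linear_g: "linear (g x u)"
  and g_pos: "u \<noteq> 0 \<Longrightarrow> g x u u > 0"
  using metric unfolding riemannian_metric_def by auto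

lemma linear_g1: "linear (\<lambda>u. g x u v)"
  using linear_g[of x v] by (simp add: g_sym[of x _ v])

lemma g_linear_simps [simp]:
  "g x (a + b) c = g x a c + g x b c" "g x c (a + b) = g x c a + g x c b"
  "g x (a - b) c = g x a c - g x b c" "g x c (a - b) = g x c a - g x c b"
  "g x (- a) c = - g x a c" "g x c (- a) = - g x c a"
  "g x (r *\<^sub>R a) c = r * g x a c" "g x c (r *\<^sub>R a) = r * g x c a"
  "g x 0 c = 0" "g x c 0 = 0"
  using linear_g[of x c]
  by (simp_all add: linear_add linear_diff linear_neg linear_scale linear_0 g_sym[of x _ c])

lemma linear_I: "linear (I x)"
  and I_I [simp]: "I x (I x v) = - v"
  using acs unfolding almost_complex_def by auto

lemma I_linear_simps [simp]:
  "I x (a + b) = I x a + I x b" "I x (a - b) = I x a - I x b" "I x (- a) = - I x a"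
  "I x (r *\<^sub>R a) = r *\<^sub>R I x a" "I x 0 = 0"
  using linear_I[of x] by (simp_all add: linear_add linear_diff linear_neg linear_scale linear_0)

lemma g_I: "g x (I x u) v = - g x u (I x v)"
  using hermitian[of x u "I x v"] by simp

lemma I_eq_0_iff: "I x v = 0 \<longleftrightarrow> v = 0"
  by (metis I_I I_linear_simps(5) neg_equal_0_iff_equal)

lemma g_nondegenerate: "(\<And>v. g x u v = 0) \<Longrightarrow> u = 0"
  using g_pos less_irrefl by metis

lemma vector_field_I: "open U \<Longrightarrow> vector_field A U X \<Longrightarrow> vector_field A U (\<lambda>y. I y (X y))"
  using acs unfolding almost_complex_def by blast

lemma smooth_g:
  "open U \<Longrightarrow> vector_field A U X \<Longrightarrow> vector_field A U Y \<Longrightarrow> smooth_fun A U (\<lambda>y. g y (X y) (Y y))"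
  using metric unfolding riemannian_metric_def by blast

lemma diff_at_g:
  "open U \<Longrightarrow> vector_field A U X \<Longrightarrow> vector_field A U Y \<Longrightarrow> x \<in> U \<Longrightarrow>
    diff_at A x (\<lambda>y. g y (X y) (Y y))"
  by (rule smooth_fun_imp_diff_at[OF smooth_g])

lemma diff_at_g_extend: "diff_at A x (\<lambda>y. g y (extend A x a y) (extend A x b y))"
  by (rule diff_at_g[OF open_domain vector_field_extend vector_field_extend mem_chart_at])

lemma one_form_g: "vector_field A U X \<Longrightarrow> one_form A U (\<lambda>y. g y (X y))"
  unfolding one_form_def using linear_g smooth_g vector_field_subset by blast

lemma dir_deriv_g:
  assumes "open U" "x \<in> U" "vector_field A U X" "vector_field A U Y"
  shows "dir_deriv A x v (\<lambda>y. g y (X y) (Y y)) =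
    dg x v (X x) (Y x) + g x (field_deriv A x X v) (Y x) + g x (X x) (field_deriv A x Y v)"
proof -
  let ?V = "U \<inter> fst (chart_at A x)"
  have V: "open ?V" "x \<in> ?V"
    using assms(1,2) open_domain mem_chart_at by auto
  have f: "vector_field A ?V X" "vector_field A ?V (extend A x u)" for u
    using vector_field_subset[OF assms(3)] vector_field_subset[OF vector_field_extend] by auto
  have "dir_deriv A x v (\<lambda>y. g y (X y) (Y y)) =
      dir_deriv A x v (\<lambda>y. g y (X y) (extend A x (Y x) y)) + g x (X x) (field_deriv A x Y v)"
    by (rule dir_deriv_apply[OF assms(1,2) linear_g _ assms(4)])
      (rule diff_at_g[OF V(1) f V(2)])
  also have "dir_deriv A x v (\<lambda>y. g y (X y) (extend A x (Y x) y)) =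
      dg x v (X x) (Y x) + g x (field_deriv A x X v) (Y x)"
    unfolding dg_def
    using dir_deriv_apply[OF assms(1,2) linear_g1 diff_at_g_extend assms(3), of v "Y x"]
    by (simp add: extend_same)
  finally show ?thesis by simp
qed

lemma dg_sym: "dg x v a b = dg x v b a"
  unfolding dg_def by (simp add: g_sym)

lemma linear_dg1: "linear (\<lambda>v. dg x v a b)"
  unfolding dg_def by (rule linear_dir_deriv[OF diff_at_g_extend])

lemma linear_dg3: "linear (\<lambda>b. dg x v a b)"
  unfolding dg_def
  by (rule linear_dir_deriv_family[OF open_domain mem_chart_at])
    (use linear_compose[OF linear_extend linear_g] diff_at_g_extend in \<open>auto simp: o_def\<close>)

lemma dg_linear_simps [simp]:
  "dg x (a + b) c d = dg x a c d + dg x b c d" "dg x (a - b) c d = dg x a c d - dg x b c d"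
  "dg x (- a) c d = - dg x a c d" "dg x (r *\<^sub>R a) c d = r * dg x a c d"
  "dg x c d (a + b) = dg x c d a + dg x c d b" "dg x c d (a - b) = dg x c d a - dg x c d b"
  "dg x c d (- a) = - dg x c d a" "dg x c d (r *\<^sub>R a) = r * dg x c d a"
  "dg x c (a + b) d = dg x c a d + dg x c b d" "dg x c (a - b) d = dg x c a d - dg x c b d"
  "dg x c (- a) d = - dg x c a d" "dg x c (r *\<^sub>R a) d = r * dg x c a d"
  using linear_dg3[of x c d]
  by (simp_all add: linear_add linear_diff linear_neg linear_scale dg_sym[of x c _ d]
      linear_dg1[THEN linear_add] linear_dg1[THEN linear_diff] linear_dg1[THEN linear_neg]
      linear_dg1[THEN linear_scale])

lemma field_deriv_I:
  assumes "open U" "x \<in> U" "vector_field A U X"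
  shows "field_deriv A x (\<lambda>y. I y (X y)) v = dI x v (X x) + I x (field_deriv A x X v)"
proof -
  let ?V = "U \<inter> fst (chart_at A x)"
  \<comment> \<open>\<open>I y\<close> followed by the passage to components in the chart at
    \<open>x\<close>: a family of linear maps with values in one space, as
    \<open>dir_deriv_apply\<close> requires.\<close>
  let ?f = "\<lambda>y w. jac (chart_at A y) (chart_at A x) y (I y w)"
  have V: "open ?V" "x \<in> ?V"
    using assms(1,2) open_domain mem_chart_at by auto
  have lin: "linear (?f y)" if "y \<in> ?V" for y
    using linear_compose[OF linear_I linear_jac[of "chart_at A y" "chart_at A x" y], of y]
      that chart_at_mem mem_chart_at
    by (auto simp: o_def)
  have d: "diff_at A x (\<lambda>y. ?f y (extend A x u y))" for u
    using diff_at_comps[OF vector_field_I[OF open_domain vector_field_extend] mem_chart_at, of x u]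
    unfolding comps_def[abs_def] .
  have "?f x w = I x w" for w
    using comps_same[of x "\<lambda>_. I x w"] by (simp add: comps_def)
  then show ?thesis
    using dir_deriv_apply[OF V lin d vector_field_subset[OF assms(3)], of v]
    by (simp add: field_deriv_def dI_def comps_def[abs_def])
qed

lemma linear_dI1: "linear (\<lambda>v. dI x v u)"
  unfolding dI_def
  by (rule linear_field_deriv[OF vector_field_I[OF open_domain vector_field_extend] mem_chart_at])

lemma linear_dI2: "linear (dI x v)"
proof -
  have "linear (\<lambda>u. dir_deriv A x v (\<lambda>y. comps A x (\<lambda>y. I y (extend A x u y)) y))"
  proof (rule linear_dir_deriv_family[OF open_domain mem_chart_at])
    fix y assume y: "y \<in> fst (chart_at A x)"
    show "linear (\<lambda>u. comps A x (\<lambda>y. I y (extend A x u y)) y)"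
      unfolding comps_def
      using linear_compose[OF linear_compose[OF linear_extend[OF y] linear_I[of y]]
          linear_jac[OF chart_at_mem chart_at_mem mem_chart_at y]]
      by (simp add: o_def)
  next
    show "diff_at A x (\<lambda>y. comps A x (\<lambda>y. I y (extend A x u y)) y)" for u
      by (rule diff_at_comps[OF vector_field_I[OF open_domain vector_field_extend] mem_chart_at])
  qed
  then show ?thesis
    unfolding dI_def[abs_def] field_deriv_def .
qed

lemma dI_linear_simps [simp]:
  "dI x (a + b) c = dI x a c + dI x b c" "dI x (a - b) c = dI x a c - dI x b c"
  "dI x (- a) c = - dI x a c" "dI x (r *\<^sub>R a) c = r *\<^sub>R dI x a c"
  "dI x c (a + b) = dI x c a + dI x c b" "dI x c (a - b) = dI x c a - dI x c b"
  "dI x c (- a) = - dI x c a" "dI x c (r *\<^sub>R a) = r *\<^sub>R dI x c a"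
  using linear_dI2[of x c]
  by (simp_all add: linear_add linear_diff linear_neg linear_scale
      linear_dI1[THEN linear_add] linear_dI1[THEN linear_diff] linear_dI1[THEN linear_neg]
      linear_dI1[THEN linear_scale])

text \<open>Derivative of I^2 = -1 along \<open>v\<close>.\<close>

lemma dI_I [simp]: "dI x v (I x u) = - I x (dI x v u)"
proof -
  have "field_deriv A x (\<lambda>y. I y (I y (extend A x u y))) = field_deriv A x (extend A x (- u))"
    by (rule field_deriv_cong[OF open_domain mem_chart_at]) (simp add: linear_neg[OF linear_extend])
  then show ?thesis
    using field_deriv_I[OF open_domain mem_chart_at vector_field_I[OF open_domain vector_field_extend],
        of x u v]
    by (simp add: field_deriv_extend extend_same add_eq_0_iff2 flip: dI_def)
qed

text \<open>Derivative of the compatibility g(Ia, Ib) = g(a, b) along \<open>v\<close>.\<close>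

lemma dg_I:
  "dg x v (I x a) (I x b) + g x (dI x v a) (I x b) + g x (I x a) (dI x v b) = dg x v a b"
  using dir_deriv_g[OF open_domain mem_chart_at vector_field_I[OF open_domain vector_field_extend]
      vector_field_I[OF open_domain vector_field_extend], of x v a b]
  by (simp add: hermitian dg_def[symmetric] extend_same flip: dI_def)

text \<open>The Nijenhuis tensor [Iu, Iv] - [u, v] - I[Iu, v] - I[u, Iv] on fields with constant
  components in the chart at \<open>x\<close>, for which [u, v] = 0.\<close>

definition nijenhuis :: "'m \<Rightarrow> 'e \<Rightarrow> 'e \<Rightarrow> 'e" where
  "nijenhuis x u v = dI x (I x u) v - dI x (I x v) u + I x (dI x v u) - I x (dI x u v)"

text \<open>All derivatives of \<open>X\<close> and \<open>Y\<close> cancel. The left side is I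
  applied to the real part, plus the imaginary part, of the bracket of IX + iX with IY + iY; its
  vanishing says that this bracket is a +i-eigenvector.\<close>

lemma lie_bracket_nijenhuis:
  assumes "open U" "x \<in> U" "vector_field A U X" "vector_field A U Y"
  shows "I x (lie_bracket A (\<lambda>y. I y (X y)) (\<lambda>y. I y (Y y)) x - lie_bracket A X Y x) +
    (lie_bracket A (\<lambda>y. I y (X y)) Y x + lie_bracket A X (\<lambda>y. I y (Y y)) x) =
    I x (nijenhuis x (X x) (Y x))"
  by (simp add: lie_bracket_field_deriv field_deriv_I[OF assms(1,2)] assms(3,4) nijenhuis_def
      algebra_simps)

proposition complex_structure_iff_nijenhuis:
  "complex_structure A I \<longleftrightarrow> (\<forall>x u v. nijenhuis x u v = 0)"
proof
  assume cs: "complex_structure A I"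
  show "\<forall>x u v. nijenhuis x u v = 0"
  proof (intro allI)
    fix x u v
    let ?U = "fst (chart_at A x)"
    \<comment> \<open>The +i-eigenvector i(u - i I u), chosen because its imaginary part is
      \<open>u\<close> itself.\<close>
    let ?Z = "\<lambda>u y. (I y (extend A x u y), extend A x u y)"
    have f: "vector_field A ?U (extend A x u)" "vector_field A ?U (\<lambda>y. I y (extend A x u y))" for u
      using vector_field_extend vector_field_I[OF open_domain] by auto
    have "plus_i_eigen (I x) (complexify_bracket (lie_bracket A) (?Z u) (?Z v) x)"
      using cs[unfolded complex_structure_def, THEN conjunct2, THEN spec[of _ ?U],
          THEN spec[of _ "?Z u"], THEN spec[of _ "?Z v"]]
        open_domain[of x] mem_chart_at[of x] f
      by (simp add: plus_i_eigen_def o_def)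
    then have "I x (nijenhuis x u v) = 0"
      using lie_bracket_nijenhuis[OF open_domain mem_chart_at f(1) f(1), of u v]
      by (simp add: plus_i_eigen_def complexify_bracket_def o_def extend_same)
    then show "nijenhuis x u v = 0" by (simp add: I_eq_0_iff)
  qed
next
  assume N: "\<forall>x u v. nijenhuis x u v = 0"
  show "complex_structure A I"
    unfolding complex_structure_def
  proof (intro conjI acs allI impI ballI, elim conjE)
    fix U Z W x
    assume U: "open U" "x \<in> U"
      and f: "vector_field A U (fst \<circ> Z)" "vector_field A U (snd \<circ> Z)"
        "vector_field A U (fst \<circ> W)" "vector_field A U (snd \<circ> W)"
      and eig: "\<forall>x\<in>U. plus_i_eigen (I x) (Z x) \<and> plus_i_eigen (I x) (W x)"
    note pe = plus_i_eigen_iff[OF linear_I I_I]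
    have d: "field_deriv A x (fst \<circ> Z) = field_deriv A x (\<lambda>y. I y ((snd \<circ> Z) y))"
      "field_deriv A x (fst \<circ> W) = field_deriv A x (\<lambda>y. I y ((snd \<circ> W) y))"
      using eig by (auto intro!: field_deriv_cong[OF U] simp: pe)
    have v: "(fst \<circ> Z) x = I x ((snd \<circ> Z) x)" "(fst \<circ> W) x = I x ((snd \<circ> W) x)"
      using eig U(2) by (auto simp: pe)
    have "I x (snd (complexify_bracket (lie_bracket A) Z W x)) =
        fst (complexify_bracket (lie_bracket A) Z W x)"
    proof -
      have "I x (fst (complexify_bracket (lie_bracket A) Z W x))
          + snd (complexify_bracket (lie_bracket A) Z W x) = 0"
        using lie_bracket_nijenhuis[OF U f(2,4)] N
        by (simp add: complexify_bracket_def lie_bracket_field_deriv d v del: o_apply)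
      then have "I x (I x (fst (complexify_bracket (lie_bracket A) Z W x))
          + snd (complexify_bracket (lie_bracket A) Z W x)) = 0" by simp
      then show ?thesis by simp
    qed
    then show "plus_i_eigen (I x) (complexify_bracket (lie_bracket A) Z W x)"
      by (simp add: pe)
  qed
qed

text \<open>The exterior derivative of the fundamental form on constant-component fields, with every
  term expanded by the Leibniz rule.\<close>

definition d_omega :: "'m \<Rightarrow> 'e \<Rightarrow> 'e \<Rightarrow> 'e \<Rightarrow> real" where
  "d_omega x u v w = dg x u (I x v) w + g x (dI x u v) w - (dg x v (I x u) w + g x (dI x v u) w)
     + (dg x w (I x u) v + g x (dI x w u) v)"

abbreviation "omega \<equiv> fundamental_form g I"

lemma dir_deriv_omega:
  "dir_deriv A x w (\<lambda>y. omega y [extend A x u y, extend A x v y]) =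
    complex_of_real (dg x w (I x u) v + g x (dI x w u) v)"
proof -
  note f = vector_field_I[OF open_domain[of x] vector_field_extend[of x u]] vector_field_extend[of x v]
  have "dir_deriv A x w (\<lambda>y. complex_of_real (g y (I y (extend A x u y)) (extend A x v y))) =
      complex_of_real (dir_deriv A x w (\<lambda>y. g y (I y (extend A x u y)) (extend A x v y)))"
    by (rule dir_deriv_bounded_linear[OF bounded_linear_of_real diff_at_g[OF open_domain f mem_chart_at]])
  then show ?thesis
    by (simp add: fundamental_form_def dir_deriv_g[OF open_domain mem_chart_at f] extend_same
        field_deriv_extend flip: dI_def)
qed

text \<open>Compatibility of \<open>g\<close> with \<open>I\<close> gives omega(Ia, Ib) = omega(a,
  b), so omega has type (1,1) and only the middle summand of each Dolbeault operator
  survives.\<close>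

lemma type_part_omega:
  "type_part (I y) 2 0 (omega y) [a, b] = 0"
  "type_part (I y) 0 2 (omega y) [a, b] = 0"
  "type_part (I y) 1 1 (omega y) [a, b] = omega y [a, b]"
proof -
  have bs: "{bs. length bs = 2 + 0 \<and> count_list bs True = 2} = {[True, True]}"
    "{bs. length bs = 0 + 2 \<and> count_list bs True = 0} = {[False, False]}"
    "{bs. length bs = 1 + 1 \<and> count_list bs True = 1} = {[True, False], [False, True]}"
    by (auto simp: length_Suc_conv numeral_eq_Suc split: if_splits)
  show "type_part (I y) 2 0 (omega y) [a, b] = 0" "type_part (I y) 0 2 (omega y) [a, b] = 0"
    "type_part (I y) 1 1 (omega y) [a, b] = omega y [a, b]"
    unfolding type_part_def bs
    by (simp_all add: proj_type_def fundamental_form_def g_I complex_eq_iff)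
qed

lemma ext_deriv_type_part_omega:
  "ext_deriv A (\<lambda>y. type_part (I y) 2 0 (omega y)) x [u, v, w] = 0"
  "ext_deriv A (\<lambda>y. type_part (I y) 0 2 (omega y)) x [u, v, w] = 0"
  "ext_deriv A (\<lambda>y. type_part (I y) 1 1 (omega y)) x [u, v, w] = complex_of_real (d_omega x u v w)"
  by (simp_all add: ext_deriv_def type_part_omega dir_deriv_const dir_deriv_omega d_omega_def
      numeral_3_eq_3 del: One_nat_def)

lemma d_omega_linear_simps [simp]:
  "d_omega x (r *\<^sub>R u) v w = r * d_omega x u v w"
  "d_omega x u (r *\<^sub>R v) w = r * d_omega x u v w"
  "d_omega x u v (r *\<^sub>R w) = r * d_omega x u v w"
  "d_omega x (- u) v w = - d_omega x u v w"
  "d_omega x u (- v) w = - d_omega x u v w"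
  "d_omega x u v (- w) = - d_omega x u v w"
  by (simp_all add: d_omega_def algebra_simps)

text \<open>The (1,2)- and (2,1)-parts of the real form d omega are conjugate, so only an imaginary
  part is left. The denominator 4 is 8, from three halved projections, divided by the 2 from the
  conjugate pair. The coefficient 3 appears because the three type patterns agree in sign when
  \<open>I\<close> hits every argument; when it hits one argument, two of them cancel.\<close>

lemma d_c_omega:
  "d_c A I 2 omega x [u, v, w] = complex_of_real (- (d_omega x (I x u) v w + d_omega x u (I x v) w
     + d_omega x u v (I x w) + 3 * d_omega x (I x u) (I x v) (I x w)) / 4)"
proof -
  have sum3: "(\<Sum>p\<le>2. F p) = F 0 + F 1 + F 2" for F :: "nat \<Rightarrow> complex"
    by (simp add: numeral_2_eq_2)
  define \<beta> where "\<beta> = ext_deriv A (\<lambda>y. type_part (I y) 1 1 (omega y)) x"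
  have \<beta>: "\<beta> [a, b, c] = complex_of_real (d_omega x a b c)" for a b c
    by (simp only: \<beta>_def ext_deriv_type_part_omega)
  have bar: "dolbeault_bar A I 2 omega x [u, v, w] = type_part (I x) 1 2 \<beta> [u, v, w]"
    unfolding dolbeault_bar_def sum3 \<beta>_def
    by (simp add: type_part_3_eq_0 ext_deriv_type_part_omega numeral_2_eq_2[symmetric])
  have hol: "dolbeault A I 2 omega x [u, v, w] = type_part (I x) 2 1 \<beta> [u, v, w]"
    unfolding dolbeault_def sum3 \<beta>_def
    by (simp add: type_part_3_eq_0 ext_deriv_type_part_omega numeral_2_eq_2[symmetric])
  show ?thesis
    unfolding d_c_def bar hol type_part_21 type_part_12
    by (simp add: \<beta> proj_type_def complex_eq_iff)
qed

lemma dg_I1: "dg x v (I x a) b = - dg x v a (I x b) - g x (dI x v a) b - g x a (dI x v b)"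
proof -
  have "g x (I x a) (dI x v (I x b)) = - g x a (dI x v b)"
    by (simp add: hermitian)
  then show ?thesis
    using dg_I[of x v a "I x b"] by simp
qed

lemma d_omega_alternating:
  "d_omega x v u w = - d_omega x u v w" "d_omega x u w v = - d_omega x u v w"
proof -
  \<comment> \<open>Derivative of omega(a, b) = - omega(b, a).\<close>
  have skew: "dg x v (I x a) b + g x (dI x v a) b = - (dg x v (I x b) a + g x (dI x v b) a)" for v a b
    using dg_I1[of x v a b] dg_sym[of x v a "I x b"] g_sym[of x a "dI x v b"] by linarith
  show "d_omega x v u w = - d_omega x u v w"
    using skew[of w v u] unfolding d_omega_def by linarith
  show "d_omega x u w v = - d_omega x u v w"
    using skew[of u v w] unfolding d_omega_def by linarith
qed

text \<open>The right side is 2 g((nabla_w I) u, v) for the Levi-Civita connection, written out by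
  the Koszul formula. Without the assumption the two sides differ by g(I N(u, v), w), with N the
  Nijenhuis tensor.\<close>

lemma d_omega_eq_if_nijenhuis_eq_0:
  assumes "\<And>u v. nijenhuis x u v = 0"
  shows "d_omega x u v w - d_omega x (I x u) (I x v) w =
    dg x u (I x v) w - dg x (I x v) u w + dg x w u (I x v)
    + dg x (I x u) v w - dg x v (I x u) w + dg x w (I x u) v + 2 * g x (dI x w u) v"
proof -
  have "g x (I x (nijenhuis x u v)) w = 0"
    by (simp add: assms)
  then show ?thesis
    by (simp add: d_omega_def nijenhuis_def g_I)
qed

text \<open>For integrable I the exterior derivative of a (1,1)-form has only (2,1)- and
  (1,2)-parts; the equation is the vanishing of the other two types.\<close>

lemma d_omega_30_eq_0:
  assumes "\<And>u v. nijenhuis x u v = 0"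
  shows "d_omega x u v w = d_omega x (I x u) (I x v) w + d_omega x (I x u) v (I x w)
    + d_omega x u (I x v) (I x w)"
proof -
  \<comment> \<open>Symmetry of \<open>K\<close> is the vanishing of the Nijenhuis tensor. Below,
    \<open>F a b c\<close> is the coordinate derivative of omega(b, c) along \<open>a\<close>, so
    that d omega is the cyclic sum of \<open>F\<close>.\<close>
  define K where "K a b = dI x a b + I x (dI x (I x a) b)" for a b
  have K_sym: "K a b = K b a" for a b
  proof -
    have "I x (nijenhuis x a b) = K a b - K b a"
      by (simp add: nijenhuis_def K_def)
    then show ?thesis by (simp add: assms)
  qed
  define F where "F a b c = dg x a (I x b) c + g x (dI x a b) c" for a b c
  have F_sym: "F a b c = - F a c b" for a b c
    using dg_I1[of x a b c] dg_sym[of x a b "I x c"] g_sym[of x b "dI x a c"]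
    unfolding F_def by linarith
  have F_I: "F a b c - F a (I x b) (I x c) = g x (dI x a b) c - g x b (dI x a c)" for a b c
    using dg_I1[of x a b c] by (simp add: F_def hermitian)
  have F_II: "F a b c - F a (I x b) (I x c) - F (I x a) (I x b) c - F (I x a) b (I x c)
      = g x (K a b) c - g x b (K a c)" for a b c
    using F_I[of a b c] F_I[of "I x a" "I x b" c] by (simp add: F_def K_def g_I)
  have d: "d_omega x a b c = F a b c + F b c a + F c a b" for a b c
    using F_sym[of b a c] by (simp add: d_omega_def F_def)
  show ?thesis
    \<comment> \<open>In the cyclic sum of \<open>F_II\<close> the right sides cancel in pairs by
      the symmetry of \<open>K\<close> and \<open>g\<close>.\<close>
    using F_II[of u v w] F_II[of v w u] F_II[of w u v]
      g_sym[of x w "K u v"] g_sym[of x u "K v w"] g_sym[of x v "K u w"]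
    unfolding d K_sym[of v u] K_sym[of w u] K_sym[of w v] by linarith
qed

text \<open>Without a (3,0)-part, d^c omega is - d omega(I., I., I.), see \<open>dc0\<close>. The
  first condition is the form D I = 0 takes in \<open>bismut_parallel_iff_d_c\<close>; since d omega
  and \<open>H\<close> are alternating, it may be rotated cyclically.\<close>

lemma d_c_omega_eq_iff:
  assumes N: "\<And>u v. nijenhuis x u v = 0" and H: "diff_form A 3 H"
  shows "(\<forall>u v w. r * (d_omega x u v w - d_omega x (I x u) (I x v) w) =
      H x [I x u, v, w] + H x [u, I x v, w]) \<longleftrightarrow>
    (\<forall>u v w. complex_of_real r * d_c A I 2 omega x [u, v, w] = complex_of_real (H x [u, v, w]))"
    (is "?L \<longleftrightarrow> ?R")
proof -
  note lin = diff_form_linear[OF H, THEN linear_neg]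
  note R3 = d_omega_30_eq_0[OF N]
  have dc0: "d_c A I 2 omega x [u, v, w] = complex_of_real (- d_omega x (I x u) (I x v) (I x w))"
    for u v w
    unfolding d_c_omega of_real_eq_iff using R3[of "I x u" "I x v" "I x w"] by simp
  have dc: "complex_of_real r * d_c A I 2 omega x [u, v, w] =
      complex_of_real (- r * d_omega x (I x u) (I x v) (I x w))" for u v w
    by (simp add: dc0)
  have R: "?R \<longleftrightarrow> (\<forall>u v w. - r * d_omega x (I x u) (I x v) (I x w) = H x [u, v, w])"
    unfolding dc of_real_eq_iff ..
  show ?thesis
    unfolding R
  proof (intro iffI allI)
    fix u v w
    assume L: ?L
    have L1: "r * (d_omega x u v w - d_omega x (I x u) (I x v) w) =
        H x [I x u, v, w] + H x [u, I x v, w]" for u v w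
      using L by blast
    have cyc: "d_omega x b c a = d_omega x a b c" "H x [b, c, a] = H x [a, b, c]" for a b c
      using d_omega_alternating(1)[of x b a c] d_omega_alternating(2)[of x b a c]
        diff_form_alternating(1)[OF H, of x b a c] diff_form_alternating(2)[OF H, of x b a c]
      by linarith+
    have L2: "r * (d_omega x u v w - d_omega x u (I x v) (I x w)) =
        H x [u, I x v, w] + H x [u, v, I x w]" for u v w
      using L1[of v w u]
      by (simp only: cyc[of v w u] cyc[of "I x v" "I x w" u] cyc[of "I x v" w u] cyc[of v "I x w" u])
    have L3: "r * (d_omega x u v w - d_omega x (I x u) v (I x w)) =
        H x [I x u, v, w] + H x [u, v, I x w]" for u v w
      using L1[of w u v]
      by (simp only: cyc[of u v w] cyc[of "I x u" v "I x w"] cyc[of "I x u" v w] cyc[of u v "I x w"]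
          add.commute)
    \<comment> \<open>The first three equations and \<open>R3\<close> add up to r d omega(Iu, Iv,
      Iw) = - h, where h is the sum of the values of H with I in two slots. The next three and
      \<open>R3\<close> give 2 r d omega(Iu, Iv, Iw) = h - 3 H(u, v, w). Eliminating h gives the
      claim.\<close>
    note eqs = L1[of "I x u" "I x v" "I x w"] L2[of "I x u" "I x v" "I x w"]
      L3[of "I x u" "I x v" "I x w"] L1[of "I x u" v w] L2[of u "I x v" w] L3[of u v "I x w"]
      R3[of "I x u" "I x v" "I x w"]
    note eqs' = eqs[unfolded I_I lin d_omega_linear_simps]
    show "- r * d_omega x (I x u) (I x v) (I x w) = H x [u, v, w]"
      using eqs' by algebra
  next
    fix u v w
    assume R: "\<forall>u v w. - r * d_omega x (I x u) (I x v) (I x w) = H x [u, v, w]"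
    show "r * (d_omega x u v w - d_omega x (I x u) (I x v) w) =
        H x [I x u, v, w] + H x [u, I x v, w]"
      unfolding R3[of u v w] R[rule_format, symmetric] I_I d_omega_linear_simps by algebra
  qed
qed

end

section \<open>The bracket in an isotropic splitting\<close>

lemma one_form_linear: "one_form A U \<xi> \<Longrightarrow> x \<in> U \<Longrightarrow> linear (\<xi> x)"
  unfolding one_form_def by (elim conjE) simp

context manifold
begin

lemma one_form_add:
  assumes "one_form A U \<xi>" "one_form A U \<eta>"
  shows "one_form A U (\<lambda>y v. \<xi> y v + \<eta> y v)"
  unfolding one_form_def
proof (intro conjI ballI allI impI)
  show "linear (\<lambda>v. \<xi> x v + \<eta> x v)" if "x \<in> U" for x
    using assms[THEN one_form_linear, OF that] by (rule linear_compose_add)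
  fix V X
  assume V: "open V \<and> V \<subseteq> U \<and> vector_field A V X"
  then have "smooth_fun A V (\<lambda>y. \<xi> y (X y))" "smooth_fun A V (\<lambda>y. \<eta> y (X y))"
    using assms unfolding one_form_def by (meson, meson)
  then show "smooth_fun A V (\<lambda>y. \<xi> y (X y) + \<eta> y (X y))"
    using smooth_fun_lincomb[of V "\<lambda>y. \<xi> y (X y)" "\<lambda>y. \<eta> y (X y)" 1 1] V by simp
qed

definition d_form :: "('m \<Rightarrow> 'e \<Rightarrow> real) \<Rightarrow> 'm \<Rightarrow> 'e \<Rightarrow> 'e \<Rightarrow> real" where
  "d_form \<xi> x w v = dir_deriv A x w (\<lambda>y. \<xi> y (extend A x v y))"

lemma diff_at_one_form:
  assumes "open U" "x \<in> U" "one_form A U \<xi>"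
  shows "diff_at A x (\<lambda>y. \<xi> y (extend A x v y))"
proof -
  have "vector_field A (U \<inter> fst (chart_at A x)) (extend A x v)"
    by (rule vector_field_subset[OF vector_field_extend]) simp
  then have "smooth_fun A (U \<inter> fst (chart_at A x)) (\<lambda>y. \<xi> y (extend A x v y))"
    using assms open_Int[OF assms(1) open_domain[of x]] unfolding one_form_def
    by (elim conjE) simp
  then show ?thesis
    by (rule smooth_fun_imp_diff_at) (use assms(2) mem_chart_at in simp)
qed

lemma linear_d_form1:
  assumes "open U" "x \<in> U" "one_form A U \<xi>"
  shows "linear (\<lambda>w. d_form \<xi> x w v)"
  unfolding d_form_def by (rule linear_dir_deriv[OF diff_at_one_form[OF assms]])

lemma linear_d_form2:
  assumes "open U" "x \<in> U" "one_form A U \<xi>"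
  shows "linear (d_form \<xi> x w)"
  unfolding d_form_def[abs_def]
proof (rule linear_dir_deriv_family[where U = "U \<inter> fst (chart_at A x)"])
  show "linear (\<lambda>v. \<xi> y (extend A x v y))" if "y \<in> U \<inter> fst (chart_at A x)" for y
    using linear_compose[OF linear_extend one_form_linear[OF assms(3)], of y x y] that
    by (simp add: o_def)
qed (use assms diff_at_one_form[OF assms] open_domain mem_chart_at in auto)

lemma d_form_add:
  assumes "open U" "x \<in> U" "one_form A U \<xi>" "one_form A U \<eta>"
  shows "d_form (\<lambda>y v. \<xi> y v + \<eta> y v) x w v = d_form \<xi> x w v + d_form \<eta> x w v"
  unfolding d_form_def
  by (rule dir_deriv_add) (use assms diff_at_one_form in blast)+

lemma lie_deriv1_d_form:
  "lie_deriv1 A X \<eta> x v = d_form \<eta> x (X x) v - \<eta> x (- field_deriv A x X v)"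
  by (simp add: lie_deriv1_def lie_bracket_field_deriv field_deriv_extend extend_same d_form_def)

lemma ext_deriv_d_form:
  "ext_deriv A (\<lambda>y vs. \<xi> y (hd vs)) x [u, v] = d_form \<xi> x u v - d_form \<xi> x v u"
  by (simp add: ext_deriv_def d_form_def numeral_2_eq_2)

definition courant_cov ::
    "('m \<Rightarrow> 'e) \<Rightarrow> ('m \<Rightarrow> 'e) \<Rightarrow> ('m \<Rightarrow> 'e \<Rightarrow> real) \<Rightarrow> ('m \<Rightarrow> 'e \<Rightarrow> real) \<Rightarrow> 'm \<Rightarrow> 'e \<Rightarrow> real" where
  "courant_cov X Y \<xi> \<eta> x v =
     lie_deriv1 A X \<eta> x v - ext_deriv A (\<lambda>y vs. \<xi> y (hd vs)) x [Y x, v]"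

lemma courant_cov_eq:
  assumes "x \<in> U" "one_form A U \<eta>"
  shows "courant_cov X Y \<xi> \<eta> x v =
    d_form \<eta> x (X x) v + \<eta> x (field_deriv A x X v) - (d_form \<xi> x (Y x) v - d_form \<xi> x v (Y x))"
  using linear_neg[OF one_form_linear[OF assms(2,1)]]
  by (simp add: courant_cov_def lie_deriv1_d_form ext_deriv_d_form)

text \<open>Additivity in the pair of forms, for fixed \<open>X\<close> and \<open>Y\<close>, is
  what separates the effect of a change of splitting in \<open>bracket_splitting\<close>.\<close>

lemma courant_cov_add:
  assumes "open U" "x \<in> U" "one_form A U \<xi>" "one_form A U \<eta>" "one_form A U \<xi>'" "one_form A U \<eta>'"
  shows "courant_cov X Y (\<lambda>y v. \<xi> y v + \<xi>' y v) (\<lambda>y v. \<eta> y v + \<eta>' y v) x v =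
    courant_cov X Y \<xi> \<eta> x v + courant_cov X Y \<xi>' \<eta>' x v"
  by (simp add: courant_cov_eq[OF assms(2)] assms one_form_add d_form_add[OF assms(1,2)])

lemma linear_courant_cov:
  assumes "open U" "x \<in> U" "vector_field A U X" "one_form A U \<xi>" "one_form A U \<eta>"
  shows "linear (courant_cov X Y \<xi> \<eta> x)"
proof -
  have eq: "courant_cov X Y \<xi> \<eta> x = (\<lambda>v. d_form \<eta> x (X x) v + \<eta> x (field_deriv A x X v)
      - (d_form \<xi> x (Y x) v - d_form \<xi> x v (Y x)))"
    by (rule ext) (rule courant_cov_eq[OF assms(2,5)])
  show ?thesis
    unfolding eq
    by (intro linear_compose_add linear_compose_sub linear_d_form1[OF assms(1,2,4)]
        linear_d_form2[OF assms(1,2,4)] linear_d_form2[OF assms(1,2,5)]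
        linear_compose[OF linear_field_deriv[OF assms(3,2)] one_form_linear[OF assms(5,2)],
          unfolded o_def])
qed

end

section \<open>Courant algebroids with a global isotropic splitting\<close>

locale split_courant = manifold A
  for A :: "('m::{t2_space,second_countable_topology}, 'e::real_inner) chart set" +
  fixes E :: "('m, 'e, 'v::real_vector, 'f::real_inner) courant"
    and s :: "'m \<Rightarrow> 'e \<Rightarrow> 'v" and H :: "'m \<Rightarrow> 'e list \<Rightarrow> real"
  assumes courant: "courant_algebroid A E"
    and split: "splitting A E UNIV s"
    and isotropic: "\<And>x u v. pairing E x (s x u) (s x v) = 0"
    and H_form: "splitting_3form A E s H"
begin

lemma subspace_fibre: "subspace (fibre E x)"
  using courant unfolding courant_algebroid_def vector_bundle_def by (elim conjE) simp

lemma triv: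
  assumes "(V, \<Phi>) \<in> trivs E"
  shows "open V" "y \<in> V \<Longrightarrow> linear_on (fibre E y) (\<Phi> y)"
  using courant assms unfolding courant_algebroid_def vector_bundle_def by fastforce+

lemma esection_lincomb:
  "open U \<Longrightarrow> esection A E U a \<Longrightarrow> esection A E U b \<Longrightarrow>
    esection A E U (\<lambda>y. r *\<^sub>R a y + t *\<^sub>R b y)"
  by (rule smooth_section_lincomb) (auto dest: triv intro: subspace_fibre)

lemma esection_mem: "esection A E U a \<Longrightarrow> x \<in> U \<Longrightarrow> a x \<in> fibre E x"
  unfolding smooth_section_def by blast

lemma extension: "smooth_extension A E"
  and smooth_pair: "smooth_pairing A E"
  and sheaf: "sheaf_bracket A E"
  using courant unfolding courant_algebroid_def by (elim conjE, simp)+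

lemma linear_on_anchor: "linear_on (fibre E x) (anchor E x)"
  using extension unfolding smooth_extension_def by (elim conjE) simp

lemma vector_field_anchor: "open U \<Longrightarrow> esection A E U a \<Longrightarrow> vector_field A U (\<lambda>y. anchor E y (a y))"
  using extension unfolding smooth_extension_def by (elim conjE) simp

lemma coanchor_lincomb:
  "linear \<alpha> \<Longrightarrow> linear \<beta> \<Longrightarrow>
    coanchor E x (\<lambda>v. a * \<alpha> v + b * \<beta> v) = a *\<^sub>R coanchor E x \<alpha> + b *\<^sub>R coanchor E x \<beta>"
  using extension unfolding smooth_extension_def by (elim conjE) simp

lemma coanchor_add:
  "linear \<alpha> \<Longrightarrow> linear \<beta> \<Longrightarrow>
    coanchor E x (\<lambda>v. \<alpha> v + \<beta> v) = coanchor E x \<alpha> + coanchor E x \<beta>"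
  using coanchor_lincomb[of \<alpha> \<beta> x 1 1] by simp

lemma coanchor_scale: "linear \<alpha> \<Longrightarrow> coanchor E x (\<lambda>v. r * \<alpha> v) = r *\<^sub>R coanchor E x \<alpha>"
  using coanchor_lincomb[of \<alpha> \<alpha> x r 0] by simp

lemma coanchor_zero: "coanchor E x (\<lambda>v. 0) = 0"
  using coanchor_scale[of "\<lambda>v. 0" x 0] linear_zero by simp

lemma coanchor_image: "coanchor E x ` {\<alpha>. linear \<alpha>} = {e \<in> fibre E x. anchor E x e = 0}"
  using extension unfolding smooth_extension_def by (elim conjE) simp

lemma coanchor_mem: "linear \<alpha> \<Longrightarrow> coanchor E x \<alpha> \<in> fibre E x"
  using coanchor_image by blast

lemma esection_coanchor: "open U \<Longrightarrow> one_form A U \<xi> \<Longrightarrow> esection A E U (\<lambda>y. coanchor E y (\<xi> y))"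
  using extension unfolding smooth_extension_def by (elim conjE) simp

lemma pairing_linear_on: "a \<in> fibre E x \<Longrightarrow> linear_on (fibre E x) (pairing E x a)"
  and pairing_sym: "a \<in> fibre E x \<Longrightarrow> b \<in> fibre E x \<Longrightarrow> pairing E x a b = pairing E x b a"
  using smooth_pair unfolding smooth_pairing_def by (elim conjE, simp)+

lemma pairing_nondegenerate:
  "a \<in> fibre E x \<Longrightarrow> (\<And>b. b \<in> fibre E x \<Longrightarrow> pairing E x a b = 0) \<Longrightarrow> a = 0"
  using smooth_pair unfolding smooth_pairing_def by (elim conjE) simp

lemma smooth_fun_pairing:
  "open U \<Longrightarrow> esection A E U a \<Longrightarrow> esection A E U b \<Longrightarrow> smooth_fun A U (\<lambda>y. pairing E y (a y) (b y))"
  using smooth_pair unfolding smooth_pairing_def by (elim conjE) simp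

lemma pairing_lincomb_right:
  "a \<in> fibre E x \<Longrightarrow> b \<in> fibre E x \<Longrightarrow> c \<in> fibre E x \<Longrightarrow>
    pairing E x a (r *\<^sub>R b + t *\<^sub>R c) = r * pairing E x a b + t * pairing E x a c"
  using pairing_linear_on unfolding linear_on_def by simp

lemma pairing_add_right:
  "a \<in> fibre E x \<Longrightarrow> b \<in> fibre E x \<Longrightarrow> c \<in> fibre E x \<Longrightarrow>
    pairing E x a (b + c) = pairing E x a b + pairing E x a c"
  using pairing_lincomb_right[of a x b c 1 1] by simp

lemma pairing_add_left:
  "a \<in> fibre E x \<Longrightarrow> b \<in> fibre E x \<Longrightarrow> c \<in> fibre E x \<Longrightarrow>
    pairing E x (a + b) c = pairing E x a c + pairing E x b c"
  by (simp add: pairing_sym[of _ x c] pairing_add_right subspace_add[OF subspace_fibre])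

lemma pairing_diff_left:
  "a \<in> fibre E x \<Longrightarrow> b \<in> fibre E x \<Longrightarrow> c \<in> fibre E x \<Longrightarrow>
    pairing E x (a - b) c = pairing E x a c - pairing E x b c"
  using pairing_lincomb_right[of c x a b 1 "-1"]
  by (simp add: pairing_sym[of _ x c] subspace_diff[OF subspace_fibre])

lemma linear_s: "linear (s x)"
  and s_mem: "s x v \<in> fibre E x"
  and anchor_s: "anchor E x (s x v) = v"
  and esection_s: "open V \<Longrightarrow> vector_field A V X \<Longrightarrow> esection A E V (\<lambda>y. s y (X y))"
  using split unfolding splitting_def by auto

lemma H_diff_form: "diff_form A 3 H"
  and bracket_s: "open U \<Longrightarrow> vector_field A U X \<Longrightarrow> vector_field A U Y \<Longrightarrow> x \<in> U \<Longrightarrow>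
    bracket E U (\<lambda>y. s y (X y)) (\<lambda>y. s y (Y y)) x =
      s x (lie_bracket A X Y x) + coanchor E x (\<lambda>v. H x [Y x, X x, v])"
  using H_form unfolding splitting_3form_def by (elim conjE, simp)+

lemma bracket_cong:
  assumes "open U" "open V" "V \<subseteq> U" "esection A E U a" "esection A E U b" "x \<in> V"
    and "\<And>y. y \<in> V \<Longrightarrow> a' y = a y" "\<And>y. y \<in> V \<Longrightarrow> b' y = b y"
  shows "bracket E V a' b' x = bracket E U a b x"
  by (rule sheaf[unfolded sheaf_bracket_def, THEN conjunct2, rule_format]) (use assms in auto)

text \<open>Two lifts of a vector differ by an element of the kernel of the anchor, hence by a
  covector. Its smooth dependence comes from the pairing formula B(u)(v) = 2<s u - \<sigma> u,
  \<sigma> v>.\<close>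

lemma splitting_difference:
  assumes \<sigma>: "standard_splitting A E U \<sigma>"
  obtains B where "\<And>y v. y \<in> U \<Longrightarrow> s y v = \<sigma> y v + coanchor E y (B y v)"
    "\<And>V X. open V \<Longrightarrow> V \<subseteq> U \<Longrightarrow> vector_field A V X \<Longrightarrow> one_form A V (\<lambda>y. B y (X y))"
proof -
  have \<sigma>': "linear (\<sigma> y)" "\<sigma> y v \<in> fibre E y" "anchor E y (\<sigma> y v) = v" if "y \<in> U" for y v
    using \<sigma> that unfolding standard_splitting_def splitting_def by auto
  have \<sigma>_sec: "esection A E V (\<lambda>y. \<sigma> y (X y))" if "open V" "V \<subseteq> U" "vector_field A V X" for V X
    using \<sigma> that unfolding standard_splitting_def splitting_def by (elim conjE) simp
  have \<sigma>_pair: "pairing E y (\<sigma> y u + coanchor E y \<alpha>) (\<sigma> y v + coanchor E y \<beta>) = (\<alpha> v + \<beta> u) / 2"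
    if "y \<in> U" "linear \<alpha>" "linear \<beta>" for y u v \<alpha> \<beta>
    using \<sigma> that unfolding standard_splitting_def by (elim conjE) simp
  define B where "B y v = (SOME \<beta>. linear \<beta> \<and> coanchor E y \<beta> = s y v - \<sigma> y v)" for y v
  have B: "linear (B y v) \<and> coanchor E y (B y v) = s y v - \<sigma> y v" if "y \<in> U" for y v
  proof -
    have "anchor E y (1 *\<^sub>R s y v + (-1) *\<^sub>R \<sigma> y v) = 1 *\<^sub>R v + (-1) *\<^sub>R v"
      using linear_on_anchor[of y] \<sigma>'[OF that] s_mem[of y v] anchor_s[of y v]
      unfolding linear_on_def by metis
    moreover have "s y v - \<sigma> y v \<in> fibre E y"
      using subspace_diff[OF subspace_fibre] s_mem \<sigma>'[OF that] by blast
    ultimately have "s y v - \<sigma> y v \<in> coanchor E y ` {\<alpha>. linear \<alpha>}"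
      unfolding coanchor_image by simp
    then have "\<exists>\<beta>. linear \<beta> \<and> coanchor E y \<beta> = s y v - \<sigma> y v"
      by (auto simp: image_iff)
    from someI_ex[OF this] show ?thesis unfolding B_def .
  qed
  have B_pair: "B y u v = 2 * pairing E y (s y u - \<sigma> y u) (\<sigma> y v)" if "y \<in> U" for y u v
    using \<sigma>_pair[OF that, of "B y u" "\<lambda>v. 0" 0 v] B[OF that, of u] linear_0[OF \<sigma>'(1)[OF that]]
    by (simp add: coanchor_zero linear_zero)
  show ?thesis
  proof (rule that)
    show "s y v = \<sigma> y v + coanchor E y (B y v)" if "y \<in> U" for y v
      using B[OF that] by simp
    fix V X
    assume V: "open V" "V \<subseteq> U" "vector_field A V X"
    show "one_form A V (\<lambda>y. B y (X y))"
      unfolding one_form_def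
    proof (intro conjI ballI allI impI, goal_cases)
      case (1 y)
      then show ?case using B V(2) by blast
    next
      case (2 W Y)
      then have W: "open W" "W \<subseteq> V" "W \<subseteq> U" "vector_field A W X" "vector_field A W Y"
        using V vector_field_subset by blast+
      have "esection A E W (\<lambda>y. 1 *\<^sub>R s y (X y) + (-1) *\<^sub>R \<sigma> y (X y))"
        by (intro esection_lincomb esection_s \<sigma>_sec W)
      then have "smooth_fun A W (\<lambda>y. pairing E y (1 *\<^sub>R s y (X y) + (-1) *\<^sub>R \<sigma> y (X y)) (\<sigma> y (Y y)))"
        by (intro smooth_fun_pairing \<sigma>_sec W)
      \<comment> \<open>The factor 2 in \<open>B_pair\<close> is produced by adding the smooth
        function to itself.\<close>
      from smooth_fun_lincomb[OF W(1) this this, of 1 1]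
      show ?case
        by (subst smooth_fun_cong[OF W(1), of _ "\<lambda>y. 1 *\<^sub>R pairing E y (1 *\<^sub>R s y (X y) + (-1) *\<^sub>R \<sigma> y (X y)) (\<sigma> y (Y y))
          + 1 *\<^sub>R pairing E y (1 *\<^sub>R s y (X y) + (-1) *\<^sub>R \<sigma> y (X y)) (\<sigma> y (Y y))"])
          (use B_pair W(3) in auto)
    qed
  qed
qed

lemma standard_splitting_at:
  obtains U \<sigma> where "open U" "x \<in> U" "standard_splitting A E U \<sigma>"
  using courant unfolding courant_algebroid_def by blast

text \<open>Isotropy of \<open>s\<close> makes \<open>B\<close> skew, so its two contributions
  cancel and the formula for the standard splitting carries over.\<close>

lemma pairing_splitting:
  assumes "linear \<alpha>" "linear \<beta>"
  shows "pairing E x (s x u + coanchor E x \<alpha>) (s x v + coanchor E x \<beta>) = (\<alpha> v + \<beta> u) / 2"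
proof -
  obtain U \<sigma> where U: "open U" "x \<in> U" "standard_splitting A E U \<sigma>"
    by (rule standard_splitting_at)
  obtain B where B: "\<And>y v. y \<in> U \<Longrightarrow> s y v = \<sigma> y v + coanchor E y (B y v)"
    "\<And>V X. open V \<Longrightarrow> V \<subseteq> U \<Longrightarrow> vector_field A V X \<Longrightarrow> one_form A V (\<lambda>y. B y (X y))"
    using splitting_difference[OF U(3)] by blast
  have linB: "linear (B x v)" for v
  proof -
    let ?V = "U \<inter> fst (chart_at A x)"
    have "one_form A ?V (\<lambda>y. B y (extend A x v y))"
      using U(1) open_domain vector_field_subset[OF vector_field_extend] by (intro B(2)) auto
    then have "linear (B x (extend A x v x))"
      by (rule one_form_linear) (use U(2) mem_chart_at in auto)
    then show ?thesis by (simp add: extend_same)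
  qed
  have \<sigma>_pair: "pairing E x (\<sigma> x u + coanchor E x \<alpha>) (\<sigma> x v + coanchor E x \<beta>) = (\<alpha> v + \<beta> u) / 2"
    if "linear \<alpha>" "linear \<beta>" for u v \<alpha> \<beta>
    using U that unfolding standard_splitting_def by (elim conjE) simp
  have "B x u v + B x v u = 0"
    using \<sigma>_pair[OF linB linB, of u u v v] isotropic[of x u v] by (simp add: B(1)[OF U(2)])
  moreover have "s x u + coanchor E x \<alpha> = \<sigma> x u + coanchor E x (\<lambda>v. B x u v + \<alpha> v)"
    if "linear \<alpha>" for u \<alpha>
    using B(1)[OF U(2)] coanchor_add[OF linB that] by simp
  ultimately show ?thesis
    using \<sigma>_pair[OF linear_compose_add[OF linB assms(1)] linear_compose_add[OF linB assms(2)],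
        of u u v v] assms by simp
qed

text \<open>The derivative of \<open>B\<close> is never computed. Relative to a local standard
  splitting \<sigma>, the sections are \<sigma> X + (B X + \<xi>) and \<sigma> Y + (B Y + \<eta>).
  Additivity of \<open>courant_cov\<close> splits off the contribution of \<open>B\<close>, and the
  case \<xi> = \<eta> = 0, which defines \<open>H\<close>, evaluates it.\<close>

lemma bracket_splitting:
  assumes U: "open U" "x \<in> U" and XY: "vector_field A U X" "vector_field A U Y"
    and \<xi>\<eta>: "one_form A U \<xi>" "one_form A U \<eta>"
  shows "bracket E U (\<lambda>y. s y (X y) + coanchor E y (\<xi> y)) (\<lambda>y. s y (Y y) + coanchor E y (\<eta> y)) x =
    s x (lie_bracket A X Y x) +
    coanchor E x (\<lambda>v. H x [Y x, X x, v] + courant_cov X Y \<xi> \<eta> x v)"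
proof -
  obtain W \<sigma> where W: "open W" "x \<in> W" "standard_splitting A E W \<sigma>"
    by (rule standard_splitting_at)
  obtain B where B: "\<And>y v. y \<in> W \<Longrightarrow> s y v = \<sigma> y v + coanchor E y (B y v)"
    "\<And>V X. open V \<Longrightarrow> V \<subseteq> W \<Longrightarrow> vector_field A V X \<Longrightarrow> one_form A V (\<lambda>y. B y (X y))"
    using splitting_difference[OF W(3)] by blast
  define V where "V = U \<inter> W"
  have V: "open V" "x \<in> V" "V \<subseteq> U" "V \<subseteq> W"
    using U W by (auto simp: V_def)
  have f: "vector_field A V X" "vector_field A V Y" "one_form A V \<xi>" "one_form A V \<eta>"
    using XY[THEN vector_field_subset, OF V(3)] \<xi>\<eta>[THEN one_form_subset, OF V(3)] by auto
  note BX = B(2)[OF V(1,4) f(1)] and BY = B(2)[OF V(1,4) f(2)]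
  have std: "bracket E V (\<lambda>y. \<sigma> y (X y) + coanchor E y (\<xi> y)) (\<lambda>y. \<sigma> y (Y y) + coanchor E y (\<eta> y)) x =
      \<sigma> x (lie_bracket A X Y x) + coanchor E x (courant_cov X Y \<xi> \<eta> x)"
    if "one_form A V \<xi>" "one_form A V \<eta>" for \<xi> \<eta>
    using W(3) V f(1,2) that unfolding standard_splitting_def courant_cov_def[abs_def]
    by (elim conjE) simp
  have sec: "esection A E O' (\<lambda>y. s y (Z y) + coanchor E y (\<zeta> y))"
    if "open O'" "vector_field A O' Z" "one_form A O' \<zeta>" for O' Z \<zeta>
    using esection_lincomb[OF that(1) esection_s[OF that(1,2)] esection_coanchor[OF that(1,3)], of 1 1]
    by simp
  note sX = esection_s[OF V(1) f(1)] and sY = esection_s[OF V(1) f(2)]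
  have linH: "linear (\<lambda>v. H x [Y x, X x, v])"
    by (rule diff_form_linear[OF H_diff_form])
  note lin = linear_courant_cov[OF V(1,2) f(1)]
  have "s x (lie_bracket A X Y x) + coanchor E x (\<lambda>v. H x [Y x, X x, v]) =
      bracket E V (\<lambda>y. s y (X y)) (\<lambda>y. s y (Y y)) x"
    by (rule bracket_s[OF V(1) f(1,2) V(2), symmetric])
  also have "\<dots> = bracket E V (\<lambda>y. \<sigma> y (X y) + coanchor E y (B y (X y)))
      (\<lambda>y. \<sigma> y (Y y) + coanchor E y (B y (Y y))) x"
    by (rule bracket_cong[OF V(1,1) order_refl sX sY V(2), symmetric]) (use B(1) V(4) in auto)
  also have "\<dots> = \<sigma> x (lie_bracket A X Y x) +
      coanchor E x (courant_cov X Y (\<lambda>y. B y (X y)) (\<lambda>y. B y (Y y)) x)"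
    by (rule std[OF BX BY])
  finally have 1: "s x (lie_bracket A X Y x) + coanchor E x (\<lambda>v. H x [Y x, X x, v]) =
      \<sigma> x (lie_bracket A X Y x) +
      coanchor E x (courant_cov X Y (\<lambda>y. B y (X y)) (\<lambda>y. B y (Y y)) x)" .
  have "bracket E U (\<lambda>y. s y (X y) + coanchor E y (\<xi> y)) (\<lambda>y. s y (Y y) + coanchor E y (\<eta> y)) x =
      bracket E V (\<lambda>y. \<sigma> y (X y) + coanchor E y (\<lambda>v. B y (X y) v + \<xi> y v))
      (\<lambda>y. \<sigma> y (Y y) + coanchor E y (\<lambda>v. B y (Y y) v + \<eta> y v)) x"
  proof (rule bracket_cong[OF U(1) V(1,3) sec[OF U(1) XY(1) \<xi>\<eta>(1)] sec[OF U(1) XY(2) \<xi>\<eta>(2)] V(2),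
        symmetric])
    fix y assume y: "y \<in> V"
    then have "y \<in> W" using V(4) by blast
    show "\<sigma> y (X y) + coanchor E y (\<lambda>v. B y (X y) v + \<xi> y v) = s y (X y) + coanchor E y (\<xi> y)"
      "\<sigma> y (Y y) + coanchor E y (\<lambda>v. B y (Y y) v + \<eta> y v) = s y (Y y) + coanchor E y (\<eta> y)"
      by (simp_all add: B(1)[OF \<open>y \<in> W\<close>] coanchor_add[OF one_form_linear[OF BX y] one_form_linear[OF f(3) y]]
          coanchor_add[OF one_form_linear[OF BY y] one_form_linear[OF f(4) y]])
  qed
  also have "\<dots> = \<sigma> x (lie_bracket A X Y x) +
      coanchor E x (courant_cov X Y (\<lambda>y v. B y (X y) v + \<xi> y v) (\<lambda>y v. B y (Y y) v + \<eta> y v) x)"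
    by (rule std) (intro one_form_add BX BY f)+
  also have "courant_cov X Y (\<lambda>y v. B y (X y) v + \<xi> y v) (\<lambda>y v. B y (Y y) v + \<eta> y v) x =
      (\<lambda>v. courant_cov X Y (\<lambda>y. B y (X y)) (\<lambda>y. B y (Y y)) x v + courant_cov X Y \<xi> \<eta> x v)"
    by (rule ext) (rule courant_cov_add[OF V(1,2) BX BY f(3,4)])
  also have "coanchor E x \<dots> = coanchor E x (courant_cov X Y (\<lambda>y. B y (X y)) (\<lambda>y. B y (Y y)) x) +
      coanchor E x (courant_cov X Y \<xi> \<eta> x)"
    by (rule coanchor_add[OF lin[OF BX BY] lin[OF f(3,4)]])
  finally show ?thesis
    using 1 coanchor_add[OF linH lin[OF f(3,4)]] by (simp add: add.assoc[symmetric])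
qed

end

section \<open>Integrability in terms of the bi-Hermitian data\<close>

text \<open>The two signs are treated uniformly: \<open>II 1\<close> and \<open>II (-1)\<close> are \<open>I\<^sub>+\<close> and \<open>I\<^sub>-\<close>,
  \<open>J 1\<close> and \<open>J (-1)\<close> are the two generalized complex structures, and \<open>sg 1\<close> and \<open>sg (-1)\<close>
  are \<open>s\<^sub>+\<close> and \<open>s\<^sub>-\<close>.\<close>

locale almost_gk = split_courant A E s H
  for A :: "('m::{t2_space,second_countable_topology}, 'e::real_inner) chart set"
    and E :: "('m, 'e, 'v::real_vector, 'f::real_inner) courant"
    and s :: "'m \<Rightarrow> 'e \<Rightarrow> 'v" and H :: "'m \<Rightarrow> 'e list \<Rightarrow> real" +
  fixes g :: "'m \<Rightarrow> 'e \<Rightarrow> 'e \<Rightarrow> real" and II :: "real \<Rightarrow> 'm \<Rightarrow> 'e \<Rightarrow> 'e"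
    and J :: "real \<Rightarrow> 'm \<Rightarrow> 'v \<Rightarrow> 'v" and sg :: "real \<Rightarrow> 'm \<Rightarrow> 'e \<Rightarrow> 'v"
  assumes hermitian_II: "e \<in> {1, -1} \<Longrightarrow> almost_hermitian A g (II e)"
    and sg_eq: "sg e x v = s x v + e *\<^sub>R coanchor E x (g x v)"
    and almost_J: "d \<in> {1, -1} \<Longrightarrow> almost_gen_complex A E (J d)"
    and J_sg: "d \<in> {1, -1} \<Longrightarrow> e \<in> {1, -1} \<Longrightarrow>
      J d x (sg e x v) = sg e x ((if e = 1 then 1 else d) *\<^sub>R II e x v)"
    and sg_decomp: "a \<in> fibre E x \<Longrightarrow> \<exists>X :: real \<Rightarrow> 'e. a = sg 1 x (X 1) + sg (-1) x (X (-1))"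
    and sg_decomp_section: "open U \<Longrightarrow> esection A E U b \<Longrightarrow>
      \<exists>X :: real \<Rightarrow> 'm \<Rightarrow> 'e. vector_field A U (X 1) \<and> vector_field A U (X (-1)) \<and>
        (\<forall>y\<in>U. b y = sg 1 y (X 1 y) + sg (-1) y (X (-1) y))"
begin

sublocale P: almost_hermitian A g "II 1"
  by (rule hermitian_II) simp

abbreviation "gdot \<equiv> P.dg"

abbreviation "DI e \<equiv> almost_hermitian.dI A (II e)"

lemma coanchor_g: "e *\<^sub>R coanchor E x (g x v) = coanchor E x (g x (e *\<^sub>R v))"
proof -
  have "g x (e *\<^sub>R v) = (\<lambda>w. e * g x v w)"
    by (rule ext) simp
  then show ?thesis by (simp add: coanchor_scale[OF P.linear_g])
qed

text \<open>\<open>mform e1 e2 e3\<close> is \<open>2\<langle>[sg e1 X, sg e2 Y], sg e3 Z\<rangle>\<close> at \<open>x\<close>, in terms of the values and the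
  derivatives of \<open>X\<close> and \<open>Y\<close> at \<open>x\<close>. \<open>cform e\<close> is \<open>2e g(\<nabla>\<^sub>W X, Y)\<close> for the metric connection
  \<open>\<nabla>\<close> with torsion \<open>-eH\<close>.\<close>

definition mform ::
    "real \<Rightarrow> real \<Rightarrow> real \<Rightarrow> 'm \<Rightarrow> 'e \<Rightarrow> ('e \<Rightarrow> 'e) \<Rightarrow> 'e \<Rightarrow> ('e \<Rightarrow> 'e) \<Rightarrow> 'e \<Rightarrow> real" where
  "mform e1 e2 e3 x X dX Y dY Z = H x [Y, X, Z]
     + e2 * (gdot x X Y Z + g x (dY X) Z + g x Y (dX Z))
     - e1 * (gdot x Y X Z + g x (dX Y) Z - gdot x Z X Y - g x (dX Z) Y)
     + e3 * g x (dY X - dX Y) Z"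

definition cform :: "real \<Rightarrow> 'm \<Rightarrow> 'e \<Rightarrow> 'e \<Rightarrow> ('e \<Rightarrow> 'e) \<Rightarrow> 'e \<Rightarrow> real" where
  "cform e x W X dX Y =
     H x [Y, X, W] + e * (gdot x X Y W - gdot x Y X W + gdot x W X Y + 2 * g x (dX W) Y)"

lemma H_linear_simps [simp]:
  "H x [a + b, u, v] = H x [a, u, v] + H x [b, u, v]"
  "H x [u, a + b, v] = H x [u, a, v] + H x [u, b, v]"
  "H x [u, v, a + b] = H x [u, v, a] + H x [u, v, b]"
  "H x [- a, u, v] = - H x [a, u, v]" "H x [u, - a, v] = - H x [u, a, v]"
  "H x [u, v, - a] = - H x [u, v, a]"
  "H x [r *\<^sub>R a, u, v] = r * H x [a, u, v]" "H x [u, r *\<^sub>R a, v] = r * H x [u, a, v]"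
  "H x [u, v, r *\<^sub>R a] = r * H x [u, v, a]"
  using diff_form_linear[OF H_diff_form, THEN linear_add]
    diff_form_linear[OF H_diff_form, THEN linear_neg]
    diff_form_linear[OF H_diff_form, THEN linear_scale] by simp_all

lemma H_swap: "H x [v, u, w] = - H x [u, v, w]" "H x [u, w, v] = - H x [u, v, w]"
  by (rule diff_form_alternating[OF H_diff_form])+

text \<open>After reordering the arguments of \<open>H\<close> these are Koszul formulas for the
  connection of the repeated sign. Only the last summand of \<open>mform\<close> involves
  \<open>e3\<close>, whence the extra Lie bracket term when all signs agree.\<close>

lemma mform_cform:
  assumes "e \<in> {1, -1}"
  shows "mform e e (- e) x X dX Y dY Z = cform e x Z X dX Y"
    and "mform e e e x X dX Y dY Z = cform e x Z X dX Y + 2 * e * g x (dY X - dX Y) Z"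
    and "mform e (- e) e x X dX Y dY Z = - cform e x Y X dX Z"
    and "mform e (- e) (- e) x X dX Y dY Z = cform (- e) x X Y dY Z"
proof -
  have H: "H x [Z, X, Y] = - H x [Y, X, Z]" "H x [Z, Y, X] = H x [Y, X, Z]"
    using H_swap(1)[of x X Y Z] H_swap(1)[of x X Z Y] H_swap(2)[of x X Y Z]
      H_swap(2)[of x Y X Z] H_swap(1)[of x Y Z X] by linarith+
  have gs: "g x Y (dX Z) = g x (dX Z) Y" "gdot x X Z Y = gdot x X Y Z" "gdot x Y Z X = gdot x Y X Z"
    "gdot x Z Y X = gdot x Z X Y"
    by (rule P.g_sym P.dg_sym)+
  show "mform e e (- e) x X dX Y dY Z = cform e x Z X dX Y"
    "mform e e e x X dX Y dY Z = cform e x Z X dX Y + 2 * e * g x (dY X - dX Y) Z"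
    "mform e (- e) e x X dX Y dY Z = - cform e x Y X dX Z"
    "mform e (- e) (- e) x X dX Y dY Z = cform (- e) x X Y dY Z"
    unfolding mform_def cform_def H gs P.g_linear_simps by algebra+
qed

lemma bracket_pairing:
  assumes U: "open U" "x \<in> U"
    and f: "vector_field A U X" "vector_field A U X'" "vector_field A U Y" "vector_field A U Y'"
    and a: "\<And>y. y \<in> U \<Longrightarrow> a y = s y (X y) + coanchor E y (g y (X' y))"
    and b: "\<And>y. y \<in> U \<Longrightarrow> b y = s y (Y y) + coanchor E y (g y (Y' y))"
  shows "bracket E U a b x \<in> fibre E x"
    and "2 * pairing E x (bracket E U a b x) (s x Z + coanchor E x (g x Z')) =
      H x [Y x, X x, Z] + gdot x (X x) (Y' x) Z + g x (field_deriv A x Y' (X x)) Z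
      + g x (Y' x) (field_deriv A x X Z)
      - (gdot x (Y x) (X' x) Z + g x (field_deriv A x X' (Y x)) Z
        - gdot x Z (X' x) (Y x) - g x (field_deriv A x X' Z) (Y x))
      + g x Z' (field_deriv A x Y (X x) - field_deriv A x X (Y x))"
proof -
  note of = P.one_form_g[OF f(2)] P.one_form_g[OF f(4)]
  have sec: "esection A E U (\<lambda>y. s y (Z y) + coanchor E y (g y (Z' y)))"
    if "vector_field A U Z" "vector_field A U Z'" for Z Z'
    using esection_lincomb[OF U(1) esection_s[OF U(1) that(1)]
        esection_coanchor[OF U(1) P.one_form_g[OF that(2)]], of 1 1] by simp
  define q where "q = (\<lambda>v. H x [Y x, X x, v] +
      courant_cov X Y (\<lambda>y. g y (X' y)) (\<lambda>y. g y (Y' y)) x v)"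
  have br: "bracket E U a b x = s x (lie_bracket A X Y x) + coanchor E x q"
    unfolding q_def bracket_splitting[OF U f(1,3) of, symmetric]
    by (rule bracket_cong[OF U(1) U(1) order_refl sec[OF f(1,2)] sec[OF f(3,4)] U(2) a b])
  have q: "linear q"
    unfolding q_def
    by (intro linear_compose_add diff_form_linear[OF H_diff_form] linear_courant_cov[OF U f(1) of])
  show "bracket E U a b x \<in> fibre E x"
    unfolding br by (intro subspace_add[OF subspace_fibre] s_mem coanchor_mem q)
  have dg: "d_form (\<lambda>y. g y (X y)) x w v = gdot x w (X x) v + g x (field_deriv A x X w) v"
    if "vector_field A U X" for X w v
  proof -
    have "vector_field A (U \<inter> fst (chart_at A x)) X" 
      "vector_field A (U \<inter> fst (chart_at A x)) (extend A x v)"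
      using vector_field_subset[OF that] vector_field_subset[OF vector_field_extend] by auto
    then show ?thesis
      unfolding d_form_def
      using P.dir_deriv_g[OF open_Int[OF U(1) open_domain[of x]], of x X "extend A x v" w] U(2)
        mem_chart_at
      by (simp add: extend_same field_deriv_extend)
  qed
  show "2 * pairing E x (bracket E U a b x) (s x Z + coanchor E x (g x Z')) =
      H x [Y x, X x, Z] + gdot x (X x) (Y' x) Z + g x (field_deriv A x Y' (X x)) Z
      + g x (Y' x) (field_deriv A x X Z)
      - (gdot x (Y x) (X' x) Z + g x (field_deriv A x X' (Y x)) Z
        - gdot x Z (X' x) (Y x) - g x (field_deriv A x X' Z) (Y x))
      + g x Z' (field_deriv A x Y (X x) - field_deriv A x X (Y x))"
    unfolding br pairing_splitting[OF q P.linear_g]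
    by (simp add: q_def courant_cov_eq[OF U(2) of(2)] dg f lie_bracket_field_deriv)
qed

lemma bracket_pairing_sg:
  assumes U: "open U" "x \<in> U" and f: "vector_field A U X" "vector_field A U Y"
    and a: "\<And>y. y \<in> U \<Longrightarrow> a y = sg e1 y (X y)" and b: "\<And>y. y \<in> U \<Longrightarrow> b y = sg e2 y (Y y)"
  shows "2 * pairing E x (bracket E U a b x) (sg e3 x Z) =
    mform e1 e2 e3 x (X x) (field_deriv A x X) (Y x) (field_deriv A x Y) Z"
proof -
  have sg: "sg e y v = s y v + coanchor E y (g y (e *\<^sub>R v))" for e y v
    by (simp add: sg_eq coanchor_g)
  note F = f[THEN vector_field_scale[OF U(1)]] and fd = f[THEN field_deriv_scale, OF U(2)]
  have "2 * pairing E x (bracket E U a b x) (sg e3 x Z) =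
      H x [Y x, X x, Z] + gdot x (X x) (e2 *\<^sub>R Y x) Z
      + g x (field_deriv A x (\<lambda>y. e2 *\<^sub>R Y y) (X x)) Z
      + g x (e2 *\<^sub>R Y x) (field_deriv A x X Z)
      - (gdot x (Y x) (e1 *\<^sub>R X x) Z + g x (field_deriv A x (\<lambda>y. e1 *\<^sub>R X y) (Y x)) Z
        - gdot x Z (e1 *\<^sub>R X x) (Y x) - g x (field_deriv A x (\<lambda>y. e1 *\<^sub>R X y) Z) (Y x))
      + g x (e3 *\<^sub>R Z) (field_deriv A x Y (X x) - field_deriv A x X (Y x))"
    unfolding sg by (rule bracket_pairing(2)[OF U f(1) F(1) f(2) F(2)]) (simp_all add: a b sg)
  then show ?thesis
    by (simp add: fd mform_def P.g_sym[of x Z] algebra_simps)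
qed

lemma bracket_pairing_sum:
  assumes U: "open U" "x \<in> U"
    and f: "vector_field A U (X 1)" "vector_field A U (X (-1))"
      "vector_field A U (Y 1)" "vector_field A U (Y (-1))"
    and a: "\<And>y. y \<in> U \<Longrightarrow> a y = sg 1 y (X 1 y) + sg (-1) y (X (-1) y)"
    and b: "\<And>y. y \<in> U \<Longrightarrow> b y = sg 1 y (Y 1 y) + sg (-1) y (Y (-1) y)"
  shows "bracket E U a b x \<in> fibre E x"
    and "2 * pairing E x (bracket E U a b x) (sg 1 x (Z 1) + sg (-1) x (Z (-1))) =
      (\<Sum>e1\<in>{1, -1}. \<Sum>e2\<in>{1, -1}. \<Sum>e3\<in>{1, -1}. mform e1 e2 e3 x
        (X e1 x) (field_deriv A x (X e1)) (Y e2 x) (field_deriv A x (Y e2)) (Z e3))"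
proof -
  have sg: "sg 1 y u + sg (-1) y v =
      s y (1 *\<^sub>R u + 1 *\<^sub>R v) + coanchor E y (g y (1 *\<^sub>R u + (-1) *\<^sub>R v))" for y u v
  proof -
    have "g y (1 *\<^sub>R u + (-1) *\<^sub>R v) = (\<lambda>w. 1 * g y u w + (-1) * g y v w)"
      by (rule ext) simp
    then show ?thesis
      by (simp only: sg_eq coanchor_lincomb[OF P.linear_g P.linear_g] linear_add[OF linear_s]
          scaleR_one) simp
  qed
  note F = vector_field_lincomb[OF U(1) f(1,2)] vector_field_lincomb[OF U(1) f(3,4)]
  note fd = field_deriv_lincomb[OF f(1,2) U(2)] field_deriv_lincomb[OF f(3,4) U(2)]
  have a': "a y = s y (1 *\<^sub>R X 1 y + 1 *\<^sub>R X (-1) y)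
      + coanchor E y (g y (1 *\<^sub>R X 1 y + (-1) *\<^sub>R X (-1) y))" if "y \<in> U" for y
    unfolding a[OF that] sg ..
  have b': "b y = s y (1 *\<^sub>R Y 1 y + 1 *\<^sub>R Y (-1) y)
      + coanchor E y (g y (1 *\<^sub>R Y 1 y + (-1) *\<^sub>R Y (-1) y))" if "y \<in> U" for y
    unfolding b[OF that] sg ..
  note bp = bracket_pairing[OF U F(1)[of 1 1] F(1)[of 1 "-1"] F(2)[of 1 1] F(2)[of 1 "-1"] a' b']
  show "bracket E U a b x \<in> fibre E x"
    by (rule bp(1))
  show "2 * pairing E x (bracket E U a b x) (sg 1 x (Z 1) + sg (-1) x (Z (-1))) =
      (\<Sum>e1\<in>{1, -1}. \<Sum>e2\<in>{1, -1}. \<Sum>e3\<in>{1, -1}. mform e1 e2 e3 x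
        (X e1 x) (field_deriv A x (X e1)) (Y e2 x) (field_deriv A x (Y e2)) (Z e3))"
    unfolding sg
    by (rule bp(2)[THEN trans]) (simp_all only: fd,
        simp add: f[THEN linear_field_deriv, OF U(2), THEN linear_add]
        f[THEN linear_field_deriv, OF U(2), THEN linear_diff] mform_def P.g_sym[of x "Z _"] algebra_simps)
qed

text \<open>D_w(Iu) = I D_w u for the metric connection of sign \<open>e\<close>, with
  \<open>I\<close> moved onto \<open>v\<close> by skewness. The vector \<open>u\<close> is extended
  with constant components, so its derivative is 0 and that of \<open>I u\<close> is
  \<open>DI e x z u\<close>.\<close>

definition bismut_parallel :: "real \<Rightarrow> 'm \<Rightarrow> bool" where
  "bismut_parallel e x \<longleftrightarrow> (\<forall>w u v.
     cform e x w (II e x u) (\<lambda>z. DI e x z u) v = - cform e x w u (\<lambda>z. 0) (II e x v))"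

text \<open>The terms in \<open>dX\<close> cancel because I is skew, so parallelism passes from
  constant components to arbitrary first derivatives.\<close>

lemma cform_II:
  assumes e: "e \<in> {1, -1}" and P: "bismut_parallel e x"
  shows "cform e x w (II e x X) (\<lambda>z. DI e x z X + II e x (dX z)) Y =
    - cform e x w X dX (II e x Y)"
proof -
  interpret I: almost_hermitian A g "II e"
    by (rule hermitian_II[OF e])
  show ?thesis
    using P[unfolded bismut_parallel_def, rule_format, of w X Y]
    by (simp add: cform_def I.g_I algebra_simps)
qed

lemma mform_scale:
  assumes "linear dX" "linear dY"
  shows "mform e1 e2 e3 x (a *\<^sub>R X) (\<lambda>z. a *\<^sub>R dX z) (b *\<^sub>R Y) (\<lambda>z. b *\<^sub>R dY z) (c *\<^sub>R Z) =
    a * b * c * mform e1 e2 e3 x X dX Y dY Z"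
  using assms[THEN linear_scale] by (simp add: mform_def algebra_simps)

text \<open>\<open>lie_bracket_nijenhuis\<close> paired with \<open>Z\<close>, for prescribed first
  derivatives \<open>dX\<close> and \<open>dY\<close>; the skewness of I moves it from
  \<open>Z\<close> to the brackets.\<close>

lemma bracket_nijenhuis:
  assumes e: "e \<in> {1, -1}" and lin: "linear dX" "linear dY"
  shows "g x (dY X - dX Y) (II e x Z)
    - g x ((DI e x (II e x X) Y + II e x (dY (II e x X))) - (DI e x (II e x Y) X + II e x (dX (II e x Y)))) (II e x Z)
    + g x ((DI e x X Y + II e x (dY X)) - dX (II e x Y)) Z
    + g x (dY (II e x X) - (DI e x Y X + II e x (dX Y))) Z =
    g x (II e x (almost_hermitian.nijenhuis A (II e) x X Y)) Z"
proof -
  interpret I: almost_hermitian A g "II e"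
    by (rule hermitian_II[OF e])
  show ?thesis
    by (simp add: I.nijenhuis_def I.hermitian flip: I.g_I) (simp add: I.g_I)
qed

text \<open>Two of the three signs agree; the parallelism of one of \<open>I\<^sub>\<plusminus>\<close> is then sufficient, except
  when all three agree.\<close>

lemma mform_integrability:
  fixes d e1 e2 e3 :: real and X Y Z :: 'e and dX dY :: "'e \<Rightarrow> 'e"
  assumes d: "d \<in> {1, -1}" and es: "e1 \<in> {1, -1}" "e2 \<in> {1, -1}" "e3 \<in> {1, -1}"
    and par: "\<And>e. e \<in> {1, -1} \<Longrightarrow> bismut_parallel e x"
    and N: "\<And>e u v. e \<in> {1, -1} \<Longrightarrow> almost_hermitian.nijenhuis A (II e) x u v = 0"
    and lin: "linear dX" "linear dY"
  defines "k \<equiv> \<lambda>e. if e = 1 then 1 else d"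
    and "X' \<equiv> II e1 x X" and "dX' \<equiv> \<lambda>z. DI e1 x z X + II e1 x (dX z)"
    and "Y' \<equiv> II e2 x Y" and "dY' \<equiv> \<lambda>z. DI e2 x z Y + II e2 x (dY z)"
  shows "k e3 * mform e1 e2 e3 x X dX Y dY (II e3 x Z)
    - k e1 * k e2 * k e3 * mform e1 e2 e3 x X' dX' Y' dY' (II e3 x Z)
    + k e2 * mform e1 e2 e3 x X dX Y' dY' Z + k e1 * mform e1 e2 e3 x X' dX' Y dY Z = 0"
proof -
  have k2: "k e * k e = 1" for e
    using d by (auto simp: k_def)
  have II_II: "II e x (II e x v) = - v" if "e \<in> {1, -1}" for e v
    by (rule almost_hermitian.I_I[OF hermitian_II[OF that]])
  have cm: "cform e x w Z dZ (- v) = - cform e x w Z dZ v" for e w Z dZ v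
    by (simp add: cform_def algebra_simps)
  consider "e2 = e1" "e3 = e1" | "e2 = e1" "e3 = - e1" | "e2 = - e1" "e3 = e1" | "e2 = - e1" "e3 = e2"
    using es by auto
  then show ?thesis
  proof cases
    \<comment> \<open>By parallelism the \<open>cform\<close> terms cancel, the first with the
      second and the third with the fourth; a multiple of \<open>bracket_nijenhuis\<close> is
      left.\<close>
    case 1
    show ?thesis
      using bracket_nijenhuis[OF es(1) lin, of x X Y Z]
      unfolding N[OF es(1)] almost_hermitian.I_linear_simps(5)[OF hermitian_II[OF es(1)]] P.g_linear_simps(9) 1 mform_cform(2)[OF es(1)] X'_def dX'_def Y'_def dY'_def
        cform_II[OF es(1) par[OF es(1)]] II_II[OF es(1)] cm
      using k2[of e1] by algebra
  next
    case 2
    show ?thesis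
      unfolding 2 mform_cform(1)[OF es(1)] X'_def dX'_def Y'_def dY'_def
        cform_II[OF es(1) par[OF es(1)]] II_II[OF es(1)] cm
      using k2[of e1] by algebra
  next
    case 3
    show ?thesis
      unfolding 3 mform_cform(3)[OF es(1)] X'_def dX'_def
        cform_II[OF es(1) par[OF es(1)]] II_II[OF es(1)] cm
      using k2[of e1] by algebra
  next
    case 4
    have e2: "- e1 \<in> {1, -1}" using es(1) by auto
    show ?thesis
      unfolding 4 mform_cform(4)[OF es(1)] Y'_def dY'_def
        cform_II[OF e2 par[OF e2]] II_II[OF e2] cm
      using k2[of "- e1"] by algebra
  qed
qed

text \<open>The factor by which \<open>J d\<close> differs from \<open>II e\<close> on the image of
  \<open>sg e\<close>: the two generalized complex structures agree on C_+ and are opposite on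
  C_-.\<close>

abbreviation kap :: "real \<Rightarrow> real \<Rightarrow> real" where
  "kap d e \<equiv> if e = 1 then 1 else d"

lemma esection_sg:
  assumes "open U" "vector_field A U X"
  shows "esection A E U (\<lambda>y. sg e y (X y))"
  using esection_lincomb[OF assms(1) esection_s[OF assms]
      esection_coanchor[OF assms(1) P.one_form_g[OF assms(2)]], of 1 e]
  by (simp add: sg_eq)

lemma sg_mem: "sg e x v \<in> fibre E x"
  unfolding sg_eq
  by (intro subspace_add[OF subspace_fibre] subspace_scale[OF subspace_fibre] s_mem coanchor_mem
      P.linear_g)

lemma bracket_mem:
  assumes "open U" "esection A E U a" "esection A E U b" "x \<in> U"
  shows "bracket E U a b x \<in> fibre E x"
proof -
  have "esection A E U (bracket E U a b)"
    using sheaf assms unfolding sheaf_bracket_def by (elim conjE) simp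
  then show ?thesis using esection_mem assms(4) by blast
qed

section \<open>Involutivity expressed by pairings\<close>

lemma J_props:
  assumes "d \<in> {1, -1}"
  shows "linear_on (fibre E x) (J d x)"
    and "a \<in> fibre E x \<Longrightarrow> J d x a \<in> fibre E x"
    and "a \<in> fibre E x \<Longrightarrow> J d x (J d x a) = - a"
    and "a \<in> fibre E x \<Longrightarrow> b \<in> fibre E x \<Longrightarrow> pairing E x (J d x a) (J d x b) = pairing E x a b"
    and "open U \<Longrightarrow> esection A E U c \<Longrightarrow> esection A E U (\<lambda>y. J d y (c y))"
  using almost_J[OF assms] unfolding almost_gen_complex_def by (elim conjE, simp)+

lemma J_add:
  "d \<in> {1, -1} \<Longrightarrow> a \<in> fibre E x \<Longrightarrow> b \<in> fibre E x \<Longrightarrow> J d x (a + b) = J d x a + J d x b"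
  using J_props(1)[of d x] unfolding linear_on_def by (metis scaleR_one)

lemma J_minus: "d \<in> {1, -1} \<Longrightarrow> a \<in> fibre E x \<Longrightarrow> J d x (- a) = - J d x a"
  using J_props(1)[of d x] unfolding linear_on_def
  by (metis (no_types) add.right_neutral scaleR_minus1_left scaleR_zero_left)

lemma J_sg_sum:
  assumes "d \<in> {1, -1}"
  shows "J d x (sg 1 x u + sg (-1) x v) =
    sg 1 x (kap d 1 *\<^sub>R II 1 x u) + sg (-1) x (kap d (-1) *\<^sub>R II (-1) x v)"
  using J_sg[OF assms, of 1 x u] J_sg[OF assms, of "-1" x v] by (simp add: J_add[OF assms] sg_mem)

text \<open>An orthogonal \<open>J\<close> with square -1 is skew, so by nondegeneracy
  \<open>J\<close> can be moved from the bracket to the test vector \<open>c\<close>. The brackets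
  then enter only through pairings, which \<open>mform\<close> computes.\<close>

lemma J_eq_minus_iff:
  assumes d: "d \<in> {1, -1}" and D: "D \<in> fibre E x" and S: "S \<in> fibre E x"
  shows "J d x D = - S \<longleftrightarrow> (\<forall>c\<in>fibre E x. pairing E x D (J d x c) = pairing E x S c)"
proof -
  have JD: "pairing E x (J d x D) c = - pairing E x D (J d x c)" if c: "c \<in> fibre E x" for c
  proof -
    have "pairing E x (J d x D) (J d x (J d x c)) = pairing E x D (J d x c)"
      by (rule J_props(4)[OF d D J_props(2)[OF d c]])
    then show ?thesis
      using pairing_lincomb_right[OF J_props(2)[OF d D] c c, of "-1" 0] J_props(3)[OF d c] by simp
  qed
  have sum: "pairing E x (J d x D + S) c = - pairing E x D (J d x c) + pairing E x S c"
    if c: "c \<in> fibre E x" for c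
    by (simp add: pairing_add_left[OF J_props(2)[OF d D] S c] JD[OF c])
  have mem: "J d x D + S \<in> fibre E x"
    by (intro subspace_add[OF subspace_fibre] J_props(2)[OF d D] S)
  have zero: "pairing E x 0 c = 0" if c: "c \<in> fibre E x" for c
    using pairing_diff_left[OF c c c] by simp
  have "J d x D = - S \<longleftrightarrow> J d x D + S = 0"
    by (simp add: eq_neg_iff_add_eq_0)
  also have "\<dots> \<longleftrightarrow> (\<forall>c\<in>fibre E x. pairing E x (J d x D + S) c = 0)"
    using pairing_nondegenerate[OF mem] zero by auto
  also have "\<dots> \<longleftrightarrow> (\<forall>c\<in>fibre E x. pairing E x D (J d x c) = pairing E x S c)"
    by (auto simp: sum)
  finally show ?thesis .
qed

lemma II_jet:
  assumes e: "e \<in> {1, -1}" and U: "open U" "x \<in> U" and X: "vector_field A U X"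
  shows "vector_field A U (\<lambda>y. k *\<^sub>R II e y (X y))"
    and "field_deriv A x (\<lambda>y. k *\<^sub>R II e y (X y)) =
      (\<lambda>z. k *\<^sub>R (DI e x z (X x) + II e x (field_deriv A x X z)))"
    and "linear (\<lambda>z. DI e x z (X x) + II e x (field_deriv A x X z))"
proof -
  interpret I: almost_hermitian A g "II e"
    by (rule hermitian_II[OF e])
  note IX = I.vector_field_I[OF U(1) X]
  show "vector_field A U (\<lambda>y. k *\<^sub>R II e y (X y))"
    by (rule vector_field_scale[OF U(1) IX])
  show "field_deriv A x (\<lambda>y. k *\<^sub>R II e y (X y)) =
      (\<lambda>z. k *\<^sub>R (DI e x z (X x) + II e x (field_deriv A x X z)))"
    by (rule ext) (simp only: field_deriv_scale[OF IX U(2)] I.field_deriv_I[OF U X])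
  show "linear (\<lambda>z. DI e x z (X x) + II e x (field_deriv A x X z))"
    using linear_field_deriv[OF IX U(2)] unfolding I.field_deriv_I[OF U X, abs_def] .
qed

text \<open>Eigensections are given by their imaginary parts, which are split along C_+ and C_-.
  Pairing with \<open>c\<close>, split in the same way, turns involutivity into a sum over eight
  triples of signs, and \<open>mform_integrability\<close> makes each summand vanish.\<close>

lemma gen_complex_if_parallel:
  assumes d: "d \<in> {1, -1}"
    and par: "\<And>e x. e \<in> {1, -1} \<Longrightarrow> bismut_parallel e x"
    and N: "\<And>e x u v. e \<in> {1, -1} \<Longrightarrow> almost_hermitian.nijenhuis A (II e) x u v = 0"
  shows "gen_complex A E (J d)"
  unfolding gen_complex_def
proof (intro conjI almost_J[OF d] allI impI ballI, elim conjE)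
  fix U z w x
  assume U: "open U" "x \<in> U"
    and sec: "esection A E U (fst \<circ> z)" "esection A E U (snd \<circ> z)"
      "esection A E U (fst \<circ> w)" "esection A E U (snd \<circ> w)"
    and eig: "\<forall>x\<in>U. plus_i_eigen (J d x) (z x) \<and> plus_i_eigen (J d x) (w x)"
  obtain X :: "real \<Rightarrow> 'm \<Rightarrow> 'e" where X: "vector_field A U (X 1)" "vector_field A U (X (-1))"
    "\<And>y. y \<in> U \<Longrightarrow> (snd \<circ> z) y = sg 1 y (X 1 y) + sg (-1) y (X (-1) y)"
    using sg_decomp_section[OF U(1) sec(2)] by blast
  obtain Y :: "real \<Rightarrow> 'm \<Rightarrow> 'e" where Y: "vector_field A U (Y 1)" "vector_field A U (Y (-1))"
    "\<And>y. y \<in> U \<Longrightarrow> (snd \<circ> w) y = sg 1 y (Y 1 y) + sg (-1) y (Y (-1) y)"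
    using sg_decomp_section[OF U(1) sec(4)] by blast
  define JX where "JX X e = (\<lambda>y. kap d e *\<^sub>R II e y (X e y))" for X :: "real \<Rightarrow> 'm \<Rightarrow> 'e" and e
  have J_X: "(fst \<circ> z) y = sg 1 y (JX X 1 y) + sg (-1) y (JX X (-1) y)"
    "(fst \<circ> w) y = sg 1 y (JX Y 1 y) + sg (-1) y (JX Y (-1) y)" if "y \<in> U" for y
  proof -
    have "fst (z y) = J d y (snd (z y))" "fst (w y) = J d y (snd (w y))"
      using eig that by (auto simp: plus_i_eigen_def)
    then show "(fst \<circ> z) y = sg 1 y (JX X 1 y) + sg (-1) y (JX X (-1) y)"
      "(fst \<circ> w) y = sg 1 y (JX Y 1 y) + sg (-1) y (JX Y (-1) y)"
      using X(3)[OF that] Y(3)[OF that] by (simp_all only: o_apply J_sg_sum[OF d] JX_def)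
  qed
  have pm: "1 \<in> {1, -1 :: real}" "-1 \<in> {1, -1 :: real}" by auto
  have vf: "vector_field A U (JX X 1)" "vector_field A U (JX X (-1))"
    "vector_field A U (JX Y 1)" "vector_field A U (JX Y (-1))"
    unfolding JX_def by (intro II_jet(1)[OF _ U] X Y pm)+
  let ?br = "bracket E U"
  let ?fz = "fst \<circ> z" and ?sz = "snd \<circ> z" and ?fw = "fst \<circ> w" and ?sw = "snd \<circ> w"
  note br_mem = bracket_mem[OF U(1) _ _ U(2)]
  let ?D = "?br ?fz ?fw x - ?br ?sz ?sw x" and ?S = "?br ?fz ?sw x + ?br ?sz ?fw x"
  have D: "?D \<in> fibre E x" and S: "?S \<in> fibre E x"
    by (intro subspace_diff[OF subspace_fibre] subspace_add[OF subspace_fibre] br_mem sec)+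
  have "J d x ?D = - ?S"
    unfolding J_eq_minus_iff[OF d D S]
  proof
    fix c assume c: "c \<in> fibre E x"
    then obtain Z :: "real \<Rightarrow> 'e" where Z: "c = sg 1 x (Z 1) + sg (-1) x (Z (-1))"
      using sg_decomp by blast
    define JZ where "JZ e = kap d e *\<^sub>R II e x (Z e)" for e
    have JZ: "J d x c = sg 1 x (JZ 1) + sg (-1) x (JZ (-1))"
      unfolding Z JZ_def by (rule J_sg_sum[OF d])
    let ?m = "\<lambda>X Y Z. \<Sum>e1\<in>{1, -1}. \<Sum>e2\<in>{1, -1}. \<Sum>e3\<in>{1, -1}. mform e1 e2 e3 x
        (X e1 x) (field_deriv A x (X e1)) (Y e2 x) (field_deriv A x (Y e2)) (Z e3)"
    have "?m X Y JZ - ?m (JX X) (JX Y) JZ + ?m X (JX Y) Z + ?m (JX X) Y Z = 0"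
      unfolding sum.distrib[symmetric] sum_subtractf[symmetric]
    proof (intro sum.neutral ballI)
      fix e1 e2 e3 :: real
      assume e: "e1 \<in> {1, -1}" "e2 \<in> {1, -1}" "e3 \<in> {1, -1}"
      have vf: "vector_field A U (X e1)" "vector_field A U (Y e2)"
        using e X Y by auto
      note lin = vf[THEN linear_field_deriv, OF U(2)]
      note j1 = II_jet[OF e(1) U vf(1)] and j2 = II_jet[OF e(2) U vf(2)]
      show "mform e1 e2 e3 x (X e1 x) (field_deriv A x (X e1)) (Y e2 x) (field_deriv A x (Y e2)) (JZ e3)
        - mform e1 e2 e3 x (JX X e1 x) (field_deriv A x (JX X e1)) (JX Y e2 x)
          (field_deriv A x (JX Y e2)) (JZ e3)
        + mform e1 e2 e3 x (X e1 x) (field_deriv A x (X e1)) (JX Y e2 x)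
          (field_deriv A x (JX Y e2)) (Z e3)
        + mform e1 e2 e3 x (JX X e1 x) (field_deriv A x (JX X e1)) (Y e2 x)
          (field_deriv A x (Y e2)) (Z e3) = 0"
        using mform_integrability[OF d e par N lin, of x "X e1 x" "Y e2 x" "Z e3"]
          mform_scale[OF lin, of e1 e2 e3 x 1 "X e1 x" 1 "Y e2 x" "kap d e3" "II e3 x (Z e3)"]
          mform_scale[OF j1(3) j2(3), of e1 e2 e3 x "kap d e1" "II e1 x (X e1 x)" "kap d e2"
            "II e2 x (Y e2 x)" "kap d e3" "II e3 x (Z e3)"]
          mform_scale[OF lin(1) j2(3), of e1 e2 e3 x 1 "X e1 x" "kap d e2" "II e2 x (Y e2 x)" 1 "Z e3"]
          mform_scale[OF j1(3) lin(2), of e1 e2 e3 x "kap d e1" "II e1 x (X e1 x)" 1 "Y e2 x" 1 "Z e3"]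
        unfolding JX_def JZ_def j1(2) j2(2) by (simp only: scaleR_one mult_1 mult_1_right)
    qed
    moreover have "2 * pairing E x (?br ?sz ?sw x) (J d x c) = ?m X Y JZ"
      unfolding JZ by (rule bracket_pairing_sum(2)[OF U X(1,2) Y(1,2) X(3) Y(3)])
    moreover have "2 * pairing E x (?br ?fz ?fw x) (J d x c) = ?m (JX X) (JX Y) JZ"
      unfolding JZ by (rule bracket_pairing_sum(2)[OF U vf J_X])
    moreover have "2 * pairing E x (?br ?sz ?fw x) c = ?m X (JX Y) Z"
      unfolding Z by (rule bracket_pairing_sum(2)[OF U X(1,2) vf(3,4) X(3) J_X(2)])
    moreover have "2 * pairing E x (?br ?fz ?sw x) c = ?m (JX X) Y Z"
      unfolding Z by (rule bracket_pairing_sum(2)[OF U vf(1,2) Y(1,2) J_X(1) Y(3)])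
    moreover have "pairing E x ?D (J d x c) =
        pairing E x (?br ?fz ?fw x) (J d x c) - pairing E x (?br ?sz ?sw x) (J d x c)"
      by (intro pairing_diff_left br_mem sec J_props(2)[OF d c])
    moreover have "pairing E x ?S c = pairing E x (?br ?fz ?sw x) c + pairing E x (?br ?sz ?fw x) c"
      by (intro pairing_add_left br_mem sec c)
    ultimately show "pairing E x ?D (J d x c) = pairing E x ?S c"
      by linarith
  qed
  moreover from this have "J d x ?S = ?D"
    using J_minus[OF d J_props(2)[OF d D]] J_props(3)[OF d D]
    by (metis minus_minus)
  ultimately show "plus_i_eigen (J d x) (complexify_bracket (bracket E U) z w x)"
    by (simp add: plus_i_eigen_def complexify_bracket_def)
qed

section \<open>From integrability to parallelism and vanishing Nijenhuis tensors\<close>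

lemma integrability_components:
  assumes gc: "gen_complex A E (J d)" and d: "d \<in> {1, -1}"
    and e: "e1 \<in> {1, -1}" "e2 \<in> {1, -1}" "e3 \<in> {1, -1}"
  shows "kap d e3 * mform e1 e2 e3 x u (\<lambda>z. 0) v (\<lambda>z. 0) (II e3 x w)
    - kap d e1 * kap d e2 * kap d e3 *
      mform e1 e2 e3 x (II e1 x u) (\<lambda>z. DI e1 x z u) (II e2 x v) (\<lambda>z. DI e2 x z v) (II e3 x w)
    + kap d e2 * mform e1 e2 e3 x u (\<lambda>z. 0) (II e2 x v) (\<lambda>z. DI e2 x z v) w
    + kap d e1 * mform e1 e2 e3 x (II e1 x u) (\<lambda>z. DI e1 x z u) v (\<lambda>z. 0) w = 0"
proof -
  let ?U = "fst (chart_at A x)"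
  \<comment> \<open>Constant components have zero derivative at \<open>x\<close>, so that only the
    derivatives of the almost complex structures enter.\<close>
  let ?X = "extend A x u" and ?Y = "extend A x v"
  let ?JX = "\<lambda>y. kap d e1 *\<^sub>R II e1 y (?X y)" and ?JY = "\<lambda>y. kap d e2 *\<^sub>R II e2 y (?Y y)"
  let ?a = "\<lambda>y. sg e1 y (?X y)" and ?b = "\<lambda>y. sg e2 y (?Y y)"
  let ?Ja = "\<lambda>y. J d y (?a y)" and ?Jb = "\<lambda>y. J d y (?b y)"
  note U = open_domain[of x] mem_chart_at[of x]
  note vf = vector_field_extend[of x u] vector_field_extend[of x v]
  note j1 = II_jet[OF e(1) U vf(1)] and j2 = II_jet[OF e(2) U vf(2)]
  have sec: "esection A E ?U ?a" "esection A E ?U ?b" "esection A E ?U ?Ja" "esection A E ?U ?Jb"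
    using esection_sg[OF U(1)] vf J_props(5)[OF d U(1)] by auto
  note br_mem = bracket_mem[OF U(1) _ _ U(2)]
  let ?br = "bracket E ?U"
  let ?D = "?br ?Ja ?Jb x - ?br ?a ?b x" and ?S = "?br ?Ja ?b x + ?br ?a ?Jb x"
  have D: "?D \<in> fibre E x" and S: "?S \<in> fibre E x"
    by (intro subspace_diff[OF subspace_fibre] subspace_add[OF subspace_fibre] br_mem sec)+
  have "plus_i_eigen (J d x)
      (complexify_bracket (bracket E ?U) (\<lambda>y. (?Ja y, ?a y)) (\<lambda>y. (?Jb y, ?b y)) x)"
    using gc[unfolded gen_complex_def, THEN conjunct2, THEN spec[of _ ?U],
        THEN spec[of _ "\<lambda>y. (?Ja y, ?a y)"], THEN spec[of _ "\<lambda>y. (?Jb y, ?b y)"]]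
      U sec J_props(3)[OF d sg_mem] by (simp add: plus_i_eigen_def o_def)
  then have "J d x ?D = - ?S"
    by (simp add: plus_i_eigen_def complexify_bracket_def o_def add.commute)
  then have eq: "pairing E x ?D (J d x (sg e3 x w)) = pairing E x ?S (sg e3 x w)"
    using J_eq_minus_iff[OF d D S] sg_mem by blast
  have "pairing E x ?D (J d x (sg e3 x w)) =
      pairing E x (?br ?Ja ?Jb x) (J d x (sg e3 x w)) - pairing E x (?br ?a ?b x) (J d x (sg e3 x w))"
    by (intro pairing_diff_left br_mem sec J_props(2)[OF d sg_mem])
  moreover have "pairing E x ?S (sg e3 x w) =
      pairing E x (?br ?Ja ?b x) (sg e3 x w) + pairing E x (?br ?a ?Jb x) (sg e3 x w)"
    by (intro pairing_add_left br_mem sec sg_mem)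
  moreover have "2 * pairing E x (?br ?Ja ?Jb x) (J d x (sg e3 x w)) =
      mform e1 e2 e3 x (?JX x) (field_deriv A x ?JX) (?JY x) (field_deriv A x ?JY)
        (kap d e3 *\<^sub>R II e3 x w)"
    unfolding J_sg[OF d e(3)] by (rule bracket_pairing_sg[OF U j1(1) j2(1)]) (rule J_sg[OF d] e)+
  moreover have "2 * pairing E x (?br ?a ?b x) (J d x (sg e3 x w)) =
      mform e1 e2 e3 x (?X x) (field_deriv A x ?X) (?Y x) (field_deriv A x ?Y)
        (kap d e3 *\<^sub>R II e3 x w)"
    unfolding J_sg[OF d e(3)] by (rule bracket_pairing_sg[OF U vf]) (rule refl)+
  moreover have "2 * pairing E x (?br ?Ja ?b x) (sg e3 x w) =
      mform e1 e2 e3 x (?JX x) (field_deriv A x ?JX) (?Y x) (field_deriv A x ?Y) w"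
    by (rule bracket_pairing_sg[OF U j1(1) vf(2)]) (rule J_sg[OF d] e refl)+
  moreover have "2 * pairing E x (?br ?a ?Jb x) (sg e3 x w) =
      mform e1 e2 e3 x (?X x) (field_deriv A x ?X) (?JY x) (field_deriv A x ?JY) w"
    by (rule bracket_pairing_sg[OF U vf(1) j2(1)]) (rule J_sg[OF d] e refl)+
  ultimately have sum: "mform e1 e2 e3 x (?X x) (field_deriv A x ?X) (?Y x) (field_deriv A x ?Y)
        (kap d e3 *\<^sub>R II e3 x w)
    - mform e1 e2 e3 x (?JX x) (field_deriv A x ?JX) (?JY x) (field_deriv A x ?JY)
        (kap d e3 *\<^sub>R II e3 x w)
    + mform e1 e2 e3 x (?X x) (field_deriv A x ?X) (?JY x) (field_deriv A x ?JY) w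
    + mform e1 e2 e3 x (?JX x) (field_deriv A x ?JX) (?Y x) (field_deriv A x ?Y) w = 0"
    using eq by linarith
  have I0: "II e1 x 0 = 0" "II e2 x 0 = 0"
    by (rule almost_hermitian.I_linear_simps(5)[OF hermitian_II] e)+
  have lin: "linear (\<lambda>z. DI e1 x z u)" "linear (\<lambda>z. DI e2 x z v)"
    by (rule almost_hermitian.linear_dI1[OF hermitian_II] e)+
  show ?thesis
    using sum
      mform_scale[OF linear_zero linear_zero, of e1 e2 e3 x 1 u 1 v "kap d e3" "II e3 x w"]
      mform_scale[OF lin, of e1 e2 e3 x "kap d e1" "II e1 x u" "kap d e2" "II e2 x v" "kap d e3"
        "II e3 x w"]
      mform_scale[OF linear_zero lin(2), of e1 e2 e3 x 1 u "kap d e2" "II e2 x v" 1 w]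
      mform_scale[OF lin(1) linear_zero, of e1 e2 e3 x "kap d e1" "II e1 x u" 1 v 1 w]
    unfolding j1(2) j2(2) field_deriv_extend extend_same I0
    by (simp only: scaleR_one scaleR_zero_right mult_1 mult_1_right add_0_right)
qed

text \<open>For signs e, e, -e the factor between the first two and the last two terms of
  \<open>integrability_components\<close> is \<open>kap d e * kap d (- e) = d\<close>. Having the
  equation for both values of \<open>d\<close> forces the last two terms to cancel each other, and
  this is parallelism.\<close>

lemma parallel_if_gen_complex:
  assumes gc: "gen_complex A E (J 1)" "gen_complex A E (J (-1))" and e: "e \<in> {1, -1}"
  shows "bismut_parallel e x"
  unfolding bismut_parallel_def
proof (intro allI)
  fix w u v
  have pm: "1 \<in> {1, -1 :: real}" "-1 \<in> {1, -1 :: real}" "- e \<in> {1, -1}"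
    using e by auto
  show "cform e x w (II e x u) (\<lambda>z. DI e x z u) v = - cform e x w u (\<lambda>z. 0) (II e x v)"
    using integrability_components[OF gc(1) pm(1) e e pm(3), of x u v w]
      integrability_components[OF gc(2) pm(2) e e pm(3), of x u v w] e
    unfolding mform_cform(1)[OF e] by auto
qed

text \<open>For three equal signs the connection terms cancel by parallelism, and the remaining Lie
  brackets assemble into g(I N(u, v), w) by \<open>bracket_nijenhuis\<close>.\<close>

lemma nijenhuis_eq_0_if_gen_complex:
  assumes gc: "gen_complex A E (J 1)" "gen_complex A E (J (-1))" and e: "e \<in> {1, -1}"
  shows "almost_hermitian.nijenhuis A (II e) x u v = 0"
proof -
  interpret I: almost_hermitian A g "II e"
    by (rule hermitian_II[OF e])
  have pm: "1 \<in> {1, -1 :: real}" by auto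
  note par = parallel_if_gen_complex[OF gc e]
  have cm: "cform e x w X dX (- Y) = - cform e x w X dX Y" for w X dX Y
    by (simp add: cform_def algebra_simps)
  have c: "cform e x w (II e x X) (\<lambda>z. DI e x z X) Y = - cform e x w X (\<lambda>z. 0) (II e x Y)" for w X Y
    using par unfolding bismut_parallel_def by blast
  have "g x (II e x (I.nijenhuis x u v)) w = 0" for w
  proof -
    have "2 * e * g x (II e x (I.nijenhuis x u v)) w = 0"
      using integrability_components[OF gc(1) pm e e e, of x u v w]
        bracket_nijenhuis[OF e linear_zero linear_zero, of x w u v]
      unfolding mform_cform(2)[OF e] c cm I.I_I I.I_linear_simps(5) if_cancel
        add_0_right P.g_linear_simps
      by algebra
    then show ?thesis using e by auto
  qed
  then have "II e x (I.nijenhuis x u v) = 0"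
    by (rule I.g_nondegenerate)
  then show ?thesis
    by (simp add: I.I_eq_0_iff)
qed

text \<open>The Levi-Civita part of D_w I is the difference of values of d omega in
  \<open>d_omega_eq_if_nijenhuis_eq_0\<close>; the torsion part is \<open>H\<close> with I in the
  first or second slot. \<open>d_c_omega_eq_iff\<close> turns their balance into the equation for
  d^c omega.\<close>

lemma bismut_parallel_iff_d_c:
  assumes e: "e \<in> {1, -1}"
    and N: "\<And>u v. almost_hermitian.nijenhuis A (II e) x u v = 0"
  shows "bismut_parallel e x \<longleftrightarrow> (\<forall>u v w. complex_of_real e *
    d_c A (II e) 2 (fundamental_form g (II e)) x [u, v, w] = complex_of_real (H x [u, v, w]))"
proof -
  interpret I: almost_hermitian A g "II e"
    by (rule hermitian_II[OF e])
  have eq: "cform e x w (II e x u) (\<lambda>z. DI e x z u) v + cform e x w u (\<lambda>z. 0) (II e x v) =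
      e * (I.d_omega x u v w - I.d_omega x (II e x u) (II e x v) w)
      - (H x [II e x u, v, w] + H x [u, II e x v, w])" for u v w
    unfolding I.d_omega_eq_if_nijenhuis_eq_0[OF N] cform_def H_swap(1)[of x v "II e x u"]
      H_swap(1)[of x "II e x v" u] P.g_linear_simps
    by algebra
  have "bismut_parallel e x \<longleftrightarrow> (\<forall>w u v.
      e * (I.d_omega x u v w - I.d_omega x (II e x u) (II e x v) w) =
      H x [II e x u, v, w] + H x [u, II e x v, w])"
    unfolding bismut_parallel_def eq_neg_iff_add_eq_0 eq by simp
  also have "\<dots> \<longleftrightarrow> (\<forall>u v w. complex_of_real e *
      d_c A (II e) 2 (fundamental_form g (II e)) x [u, v, w] = complex_of_real (H x [u, v, w]))"
    unfolding I.d_c_omega_eq_iff[OF N H_diff_form, of e, symmetric] by blast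
  finally show ?thesis .
qed

proposition gen_complex_iff:
  "gen_complex A E (J 1) \<and> gen_complex A E (J (-1)) \<longleftrightarrow>
    (\<forall>e\<in>{1, -1}. complex_structure A (II e) \<and> (\<forall>x u v w. complex_of_real e *
      d_c A (II e) 2 (fundamental_form g (II e)) x [u, v, w] = complex_of_real (H x [u, v, w])))"
    (is "?L \<longleftrightarrow> ?R")
proof
  note cs = almost_hermitian.complex_structure_iff_nijenhuis[OF hermitian_II]
  {
    assume L: ?L
    show ?R
    proof
      fix e :: real
      assume e: "e \<in> {1, -1}"
      have N: "almost_hermitian.nijenhuis A (II e) x u v = 0" for x u v
        using nijenhuis_eq_0_if_gen_complex L e by blast
      then show "complex_structure A (II e) \<and> (\<forall>x u v w. complex_of_real e *
          d_c A (II e) 2 (fundamental_form g (II e)) x [u, v, w] = complex_of_real (H x [u, v, w]))"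
        using parallel_if_gen_complex[OF _ _ e] L
        unfolding cs[OF e] bismut_parallel_iff_d_c[OF e N] by blast
    qed
  }
  assume R: ?R
  have N: "almost_hermitian.nijenhuis A (II e) x u v = 0" if "e \<in> {1, -1}" for e x u v
    using R that cs[OF that] by blast
  have par: "bismut_parallel e x" if "e \<in> {1, -1}" for e x
    unfolding bismut_parallel_iff_d_c[OF that N[OF that]] using R that by blast
  show ?L
    using gen_complex_if_parallel[OF _ par N] by simp
qed

end

section \<open>Passage from the given bi-Hermitian data to the signed notation\<close>

theorem theorem2p18:
  fixes A :: "('m::{t2_space,second_countable_topology}, 'e::real_inner) chart set"
    and E :: "('m, 'e, 'v::real_vector, 'f::real_inner) courant"
    and Jp Jm :: "'m \<Rightarrow> 'v \<Rightarrow> 'v"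
    and s :: "'m \<Rightarrow> 'e \<Rightarrow> 'v"
    and g :: "'m \<Rightarrow> 'e \<Rightarrow> 'e \<Rightarrow> real"
    and Iplus Iminus :: "'m \<Rightarrow> 'e \<Rightarrow> 'e"
    and H :: "'m \<Rightarrow> 'e list \<Rightarrow> real"
  assumes "smooth_atlas A"
    and "courant_algebroid A E"
    and "almost_gen_kahler A E Jp Jm"
    and "bihermitian_data_of A E Jp Jm s g Iplus Iminus"
    and "splitting_3form A E s H"
  shows "gen_kahler A E Jp Jm \<longleftrightarrow>
           complex_structure A Iplus \<and> complex_structure A Iminus \<and>
           (\<forall>x u v w.
              d_c A Iplus 2 (fundamental_form g Iplus) x [u, v, w] = complex_of_real (H x [u, v, w])) \<and>
           (\<forall>x u v w.
              - d_c A Iminus 2 (fundamental_form g Iminus) x [u, v, w] = complex_of_real (H x [u, v, w]))"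
proof -
  have bh: "almost_bihermitian A E s g Iplus Iminus"
    using assms(4) unfolding bihermitian_data_of_def by (elim conjE)
  obtain sp sm where
    sp: "inverse_projection E (C_eigen E Jp Jm 1) sp"
      "\<And>x v. sp x v = s x v + coanchor E x (g x v)" "\<And>x v. sp x (Iplus x v) = Jp x (sp x v)" and
    sm: "inverse_projection E (C_eigen E Jp Jm (-1)) sm"
      "\<And>x v. sm x v = s x v - coanchor E x (g x v)" "\<And>x v. sm x (Iminus x v) = Jp x (sm x v)"
    using assms(4) unfolding bihermitian_data_of_def by (elim conjE exE) metis
  interpret C: split_courant A E s H
    by unfold_locales (use assms bh in \<open>auto simp: almost_bihermitian_def\<close>)
  have Jp: "linear_on (fibre E x) (Jp x)" "a \<in> fibre E x \<Longrightarrow> Jp x a \<in> fibre E x"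
    "a \<in> fibre E x \<Longrightarrow> Jp x (Jp x a) = - a"
    "open U \<Longrightarrow> esection A E U b \<Longrightarrow> esection A E U (\<lambda>y. Jp y (b y))"
    and Jm: "linear_on (fibre E x) (Jm x)" "a \<in> fibre E x \<Longrightarrow> Jm x a \<in> fibre E x"
    "a \<in> fibre E x \<Longrightarrow> Jm x (Jm x a) = - a"
    "open U \<Longrightarrow> esection A E U b \<Longrightarrow> esection A E U (\<lambda>y. Jm y (b y))"
    and comm: "a \<in> fibre E x \<Longrightarrow> Jp x (Jm x a) = Jm x (Jp x a)" for x a U b
    using assms(3) unfolding almost_gen_kahler_def almost_gen_complex_def by (elim conjE, simp)+
  have lincomb: "f (r *\<^sub>R a + t *\<^sub>R b) = r *\<^sub>R f a + t *\<^sub>R f b"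
    if "linear_on F f" "a \<in> F" "b \<in> F" for f :: "'v \<Rightarrow> 'v" and F r t a b
    using that unfolding linear_on_def by blast
  have J_minus: "Jp x (- a) = - Jp x a" if "a \<in> fibre E x" for x a
    using lincomb[OF Jp(1) that that, of "-1" 0] by simp
  have sp_C: "sp x v \<in> fibre E x" "Jp x (Jm x (sp x v)) = - sp x v"
    and sm_C: "sm x v \<in> fibre E x" "Jp x (Jm x (sm x v)) = sm x v" for x v
    using sp(1) sm(1) unfolding inverse_projection_def C_eigen_def
    by auto (metis minus_minus)
  \<comment> \<open>On C_+ the product of the two structures is -1, so \<open>Jm\<close> equals
    \<open>Jp\<close> there; on C_- it is 1, so \<open>Jm\<close> is \<open>- Jp\<close>.\<close>
  have Jm_sp: "Jm x (sp x v) = sp x (Iplus x v)" for x v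
    using Jp(3)[OF Jm(2)[OF sp_C(1)], of x v] J_minus[OF sp_C(1)]
    by (simp add: sp_C(2) sp(3))
  have Jm_sm: "Jm x (sm x v) = - sm x (Iminus x v)" for x v
    using Jp(3)[OF Jm(2)[OF sm_C(1)], of x v] by (simp add: sm_C(2) sm(3))
  \<comment> \<open>The projection (a + r G a)/2 to the eigenbundle of G = - Jp Jm for the
    eigenvalue r; G squares to 1 because the two structures commute.\<close>
  define half where "half r x a = (1/2) *\<^sub>R a + (- r/2) *\<^sub>R Jp x (Jm x a)" for r x a
  have JJJJ: "Jp x (Jm x (Jp x (Jm x a))) = a" if "a \<in> fibre E x" for x a
  proof -
    have "Jp x (Jm x (Jp x (Jm x a))) = Jp x (Jp x (Jm x (Jm x a)))"
      using comm[OF Jm(2)[OF that]] by simp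
    also have "\<dots> = a"
      using Jp(3)[OF Jm(2)[OF Jm(2)[OF that]]] Jm(3)[OF that] by simp
    finally show ?thesis .
  qed
  have half_C: "half r x a \<in> C_eigen E Jp Jm r x" if "a \<in> fibre E x" "r \<in> {1, -1}" for r x a
  proof -
    have K: "Jp x (Jm x a) \<in> fibre E x"
      using Jp(2) Jm(2) that by blast
    have "Jp x (Jm x (half r x a)) = (1/2) *\<^sub>R Jp x (Jm x a) + (- r/2) *\<^sub>R a"
      unfolding half_def lincomb[OF Jm(1) that(1) K]
        lincomb[OF Jp(1) Jm(2)[OF that(1)] Jm(2)[OF K]] JJJJ[OF that(1)] ..
    moreover have "half r x a \<in> fibre E x"
      unfolding half_def
      by (intro subspace_add[OF C.subspace_fibre] subspace_scale[OF C.subspace_fibre] that K)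
    ultimately show ?thesis
      using that(2) unfolding C_eigen_def by (auto simp: half_def)
  qed
  have half_sum: "half 1 x a + half (-1) x a = a" for x a
    by (simp add: half_def flip: scaleR_add_left)
  have sp_half: "sp x (anchor E x (half 1 x a)) = half 1 x a"
    and sm_half: "sm x (anchor E x (half (-1) x a)) = half (-1) x a" if "a \<in> fibre E x" for x a
    using sp(1) sm(1) half_C[OF that, of 1] half_C[OF that, of "-1"]
    unfolding inverse_projection_def by auto
  have decomp: "a = sp x (anchor E x (half 1 x a)) + sm x (anchor E x (half (-1) x a))"
    if "a \<in> fibre E x" for x a
    using half_sum sp_half[OF that] sm_half[OF that] by simp
  \<comment> \<open>The components are smooth as anchors of smooth sections.\<close>
  have half_sec: "vector_field A U (\<lambda>y. anchor E y (half r y (b y)))"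
    if "open U" "esection A E U b" for U b r
    unfolding half_def
    by (intro C.vector_field_anchor C.esection_lincomb Jp(4) Jm(4) that)
  define II where "II e = (if e = 1 then Iplus else Iminus)" for e :: real
  define J where "J d = (if d = 1 then Jp else Jm)" for d :: real
  define sg where "sg e x v = s x v + e *\<^sub>R coanchor E x (g x v)" for e x v
  have sg: "sg 1 x v = sp x v" "sg (-1) x v = sm x v" for x v
    by (simp_all add: sg_def sp(2) sm(2))
  have herm: "almost_hermitian A g (II e)" for e
    using bh by unfold_locales (auto simp: almost_bihermitian_def II_def)
  have sm_minus: "sm x (- v) = - sm x v" for x v
  proof -
    interpret P: almost_hermitian A g "II 1"
      by (rule herm)
    have "g x (- v) = (\<lambda>w. -1 * g x v w)"
      by (rule ext) simp
    then show ?thesis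
      by (simp only: sm(2) C.coanchor_scale[OF P.linear_g] linear_neg[OF C.linear_s]) simp
  qed
  interpret K: almost_gk A E s H g II J sg
  proof unfold_locales
    fix d e :: real and x v
    assume "d \<in> {1, -1}" "e \<in> {1, -1}"
    then show "J d x (sg e x v) = sg e x ((if e = 1 then 1 else d) *\<^sub>R II e x v)"
      by (auto simp: sg J_def II_def sp(3) sm(3) Jm_sp Jm_sm sm_minus)
  next
    fix a x
    assume "a \<in> fibre E x"
    then show "\<exists>X :: real \<Rightarrow> 'e. a = sg 1 x (X 1) + sg (-1) x (X (-1))"
      unfolding sg using decomp by (intro exI[of _ "\<lambda>e. anchor E x (half e x a)"])
  next
    fix U b
    assume "open U" "esection A E U b"
    then show "\<exists>X :: real \<Rightarrow> 'm \<Rightarrow> 'e. vector_field A U (X 1) \<and> vector_field A U (X (-1)) \<and>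
        (\<forall>y\<in>U. b y = sg 1 y (X 1 y) + sg (-1) y (X (-1) y))"
      unfolding sg using half_sec decomp C.esection_mem
      by (intro exI[of _ "\<lambda>e y. anchor E y (half e y (b y))"]) blast
  qed (use bh assms(3) in \<open>auto simp: sg_def J_def II_def almost_gen_kahler_def almost_bihermitian_def\<close>)
  have "gen_kahler A E Jp Jm \<longleftrightarrow> gen_complex A E (J 1) \<and> gen_complex A E (J (-1))"
    using assms(3) by (simp add: gen_kahler_def J_def)
  then show ?thesis
    unfolding K.gen_complex_iff by (auto simp: II_def)
qed

end
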